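(* Let $q\in\mathbb{C}^{*}$ be not a root of unity, let $\alpha$ be an irrational complex number, and let $L/k=(\mathbb{C}(t,t^\alpha),\sigma,\theta^* )/\mathbb{C}$ be the $q$-skew iterative $\sigma$-differential field extension described in the context. Then there is an inclusion $$\mathcal{NCF}_{L/k}\hookrightarrow\widehat{QG}_{II\,q}$$ of functors on the category $(NCAlg/L^\natural)$ with values in the category of sets. Assume moreover that the functorial injection $\mathcal{NCF}_{L/k}(A)\hookrightarrow\widehat{QG}_{2\,q}(A)$ described in the context is bijective for every $A\in(NCAlg/L^\natural)$. Then the inclusion $\mathcal{NCF}_{L/k}\hookrightarrow\widehat{QG}_{II\,q}$ is a bijection, so that $\mathcal{NCF}_{L/k}\simeq\widehat{QG}_{II\,q}$, and the quantum formal group $\widehat{QG}_{II\,q}$ operates on the functor $\mathcal{NCF}_{L/k}$ through the initial conditions: if $u\in\widehat{QG}_{II\,q}(A)$ and $\varphi\in\mathcal{NCF}_{L/k}(A)$ corresponds to $v\in\widehat{QG}_{II\,q}(A)$, and the set of coefficients of $u$ and the set of coefficients of $v$ are mutually commutative, then $u\cdot\varphi$ is the deformation corresponding to the product $u*v$. (In this sense the quantum formal Galois group of $L/k$ is $\widehat{QG}_{II\,q}$.)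
   Context: Notation. $[n]_q=1+q+\dots+q^{n-1}$, $[n]_q!=\prod_{i=1}^n[i]_q$, $[0]_q!=1$; for $\beta\in\alpha+\mathbb{Z}$, $[\beta]_q=\frac{q^\beta-1}{q-1}$ (a value of $\log q$ being fixed), $\binom{\alpha}{n}_q=\frac{[\alpha]_q[\alpha-1]_q\cdots[\alpha-n+1]_q}{[n]_q!}$. All algebras are associative and unital. The field. $y=t^\alpha$; $t$ and $y$ are algebraically independent over $\mathbb{C}$. $\sigma$ is the $\mathbb{C}$-automorphism of $\mathbb{C}(t,y)$ with $\sigma(t)=qt$, $\sigma(y)=q^\alpha y$; $\theta^{(0)}=\mathrm{Id}$, $\theta^{(1)}(a)=\frac{\sigma(a)-a}{(q-1)t}$, $\theta^{(n)}=\frac1{[n]_q!}(\theta^{(1)})^n$. $L^\natural$ is the abstract field; $L^\sharp$ is $L^\natural$ with the derivations $\partial/\partial t,\partial/\partial y$. Twisted power series. For a $\mathbb{C}$-algebra $B$, $F(\mathbb{Z},B)$ is the ring of functions $\mathbb{Z}\to B$ with shift $(\Sigma f)(n)=f(n+1)$. $F(\mathbb{Z},B)[[X]]$ is the set of formal series $\sum_{i\ge0}X^ia_i$, $a_i\in F(\mathbb{Z},B)$, with multiplication determined by $aX=X\Sigma(a)$, and operators $\hat\Sigma(\sum X^ia_i)=\sum X^iq^i\Sigma(a_i)$, $\hat\Theta^{(l)}(\sum X^ia_i)=\sum X^i\binom{i+l}{l}_qa_{i+l}$, where $\binom{m}{n}_q=\frac{[m]_q!}{[n]_q![m-n]_q!}$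 for integers. Derivations of $B$ act on coefficients. Galois hull. The universal Hopf morphism is $\iota_0:L\to F(\mathbb{Z},L^\natural)[[X]]$, $a\mapsto\sum_iX^iu[\theta^{(i)}(a)]$, $u[b](n)=\sigma^n(b)$. Elements of $L^\sharp$ are identified with constant functions of degree $0$ in $X$. $\mathcal{L}$ is the smallest subalgebra of $F(\mathbb{Z},L^\sharp)[[X]]$ containing $\iota_0(L)$ and $L^\sharp$ and invariant under $\hat\Sigma$, all $\hat\Theta^{(l)}$, $\partial/\partial t$, $\partial/\partial y$; $\mathcal{K}=L^\sharp$. With $Q(n)=q^n$, $Q^{\beta}(n)=q^{n\beta}$, one has $\iota_0(t)=tQ+X$ and $\iota_0(y)=Y_0y$, $Y_0=\sum_{n\ge0}X^n\binom{\alpha}{n}_qt^{-n}Q^{\alpha-n}$. Deformations. $(NCAlg/L^\natural)$ is the category of not necessarily commutative $L^\natural$-algebras $A$ with $L^\natural$ mapping to the center. The Taylor morphism $L^\sharp\to L^\natural[[W_1,W_2]]$, $a\mapsto\sum\frac{1}{n!m!}\frac{\partial^{n+m}a}{\partial t^n\partial y^m}W_1^nW_2^m$ and $L^\natural\to A$ induce the canonical morphism $\iota:\mathcal{L}\to F(\mathbb{Z},A[[W_1,W_2]])[[X]]$. $\mathcal{NCF}_{L/k}(A)$ is the set of algebra morphisms $\varphi:\mathcal{L}\to F(\mathbb{Z},A[[W_1,W_2]])[[X]]$ compatible with $\hat\Sigma$, all $\hat\Theta^{(l)}$ and the derivations ($\partial/\partial t,\partial/\partial y$ on $\mathcal{L}$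 corresponding to $\partial/\partial W_1,\partial/\partial W_2$), equal to $\iota$ on $\mathcal{K}$, and congruent to $\iota$ modulo nilpotent elements (all coefficients in $A$ of $\varphi(x)-\iota(x)$ are nilpotent for every $x\in\mathcal{L}$). Quantum formal groups. $\widehat{QG}_{2\,q}(A)$ is the set of pairs $\left(\begin{bmatrix}e&f\\0&1\end{bmatrix},b(W_1)\right)$ with $e,f\in A$, $ef=qfe$, $b(W_1)\in A[[W_1]]$, $[e(t+W_1)+f,\,b(W_1)]=0$, and $e-1$, $f$ and all coefficients of $b(W_1)-1$ nilpotent. The injection $\mathcal{NCF}_{L/k}(A)\hookrightarrow\widehat{QG}_{2\,q}(A)$ sends $\varphi$ to the pair determined by $\varphi(\iota_0(t))=(e(t+W_1)+f)Q+X$ and $\varphi(Y_0)=\sum_{n\ge0}X^n\binom{\alpha}{n}_q(e(t+W_1)+f)^{-n}Q^{\alpha-n}b(W_1)$. $\widehat{QG}_{II\,q}(A)$ is the set of pairs $\bigl((e-1)t+f+eW_1,\ (b(W_1)-1)y+b(W_1)W_2\bigr)\in A[[W_1,W_2]]^2$ with $e,f\in A$, $ef=qfe$, $b(W_1)\in A[[W_1]]$, the two components commuting with each other, and $e-1$, $f$ and all coefficients of $b(W_1)-1$ nilpotent. The inclusion of the theorem sends $\varphi$ to the pair with the same $(e,f,b)$; the pair is regarded as the coordinate transformation of the initial conditions $(W_1,W_2)\mapsto((e-1)t+f+eW_1,(b(W_1)-1)y+b(W_1)W_2)$. For $u$ given by $(e,f,b)$ and $v$ given by $(g,h,c)$ whose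 sets of coefficients are mutually commutative (every element of one commutes with every element of the other), the product $u*v$ is the composite transformation $\bigl((eg-1)t+eh+f+egW_1,\ (\beta-1)y+\beta W_2\bigr)$ with $\beta=b((g-1)t+h+gW_1)\,c(W_1)$. *)

theory Defs
  imports
    "HOL-Analysis.Finite_Cartesian_Product"
    "HOL-Analysis.Cartesian_Space"
    "HOL-Computational_Algebra.Formal_Power_Series"
    "HOL-Computational_Algebra.Polynomial_Factorial"
    "HOL-Computational_Algebra.Field_as_Ring"
    "HOL-Library.Groups_Big_Fun"
    "HOL-Library.FuncSet"
begin

unbundle no vec_syntax
unbundle fps_syntax

section \<open>\<open>q\<close>-numbers\<close>

text \<open>A value \<open>lq\<close> of the logarithm of \<open>q\<close> is fixed throughout, i.e. \<open>exp lq = q\<close>.\<close>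

definition qpow :: "complex \<Rightarrow> complex \<Rightarrow> complex" where
  "qpow lq \<beta> = exp (\<beta> * lq)"

definition qnum :: "complex \<Rightarrow> complex \<Rightarrow> complex \<Rightarrow> complex" where
  "qnum q lq \<beta> = (qpow lq \<beta> - 1) / (q - 1)"

definition qint :: "complex \<Rightarrow> nat \<Rightarrow> complex" where
  "qint q n = (\<Sum>i<n. q ^ i)"

definition qfact :: "complex \<Rightarrow> nat \<Rightarrow> complex" where
  "qfact q n = (\<Prod>i=1..n. qint q i)"

definition qbinom_nat :: "complex \<Rightarrow> nat \<Rightarrow> nat \<Rightarrow> complex" where
  "qbinom_nat q m n = qfact q m / (qfact q n * qfact q (m - n))"

definition qbinom :: "complex \<Rightarrow> complex \<Rightarrow> complex \<Rightarrow> nat \<Rightarrow> complex" where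
  "qbinom q lq \<alpha> n = (\<Prod>i<n. qnum q lq (\<alpha> - of_nat i)) / qfact q n"

section \<open>The field \<open>L = \<complex>(t, y)\<close>\<close>

text \<open>
  \<open>L\<close> is the fraction field of \<open>\<complex>[t][y]\<close>: \<open>y\<close> is the outer and \<open>t\<close> the inner polynomial
  variable. The abstract field and the differential field have the same underlying type.
\<close>

type_synonym ratfun = "complex poly poly fract"

definition Cst :: "complex \<Rightarrow> ratfun" where
  "Cst c = to_fract [:[:c:]:]"

definition t_var :: ratfun where
  "t_var = to_fract [:[:0, 1:]:]"

definition y_var :: ratfun where
  "y_var = to_fract [:0, 1:]"

text \<open>\<open>p(t, y) \<mapsto> p(q t, q\<^sup>\<alpha> y)\<close> on polynomials, extended to numerators and denominators.\<close>

definition sigma_poly :: "complex \<Rightarrow> complex \<Rightarrow> complex \<Rightarrow> complex poly poly \<Rightarrow> complex poly poly" where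
  "sigma_poly q lq \<alpha> p = pcompose (map_poly (\<lambda>c. pcompose c [:0, q:]) p) [:0, [:qpow lq \<alpha>:]:]"

definition sigma :: "complex \<Rightarrow> complex \<Rightarrow> complex \<Rightarrow> ratfun \<Rightarrow> ratfun" where
  "sigma q lq \<alpha> r = (case quot_of_fract r of (p, s) \<Rightarrow>
     to_fract (sigma_poly q lq \<alpha> p) / to_fract (sigma_poly q lq \<alpha> s))"

definition sigma_int :: "complex \<Rightarrow> complex \<Rightarrow> complex \<Rightarrow> int \<Rightarrow> ratfun \<Rightarrow> ratfun" where
  "sigma_int q lq \<alpha> n = (if n \<ge> 0 then sigma q lq \<alpha> ^^ nat n else inv (sigma q lq \<alpha>) ^^ nat (- n))"

definition theta1 :: "complex \<Rightarrow> complex \<Rightarrow> complex \<Rightarrow> ratfun \<Rightarrow> ratfun" where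
  "theta1 q lq \<alpha> a = (sigma q lq \<alpha> a - a) / (Cst (q - 1) * t_var)"

definition theta :: "complex \<Rightarrow> complex \<Rightarrow> complex \<Rightarrow> nat \<Rightarrow> ratfun \<Rightarrow> ratfun" where
  "theta q lq \<alpha> n a = Cst (1 / qfact q n) * (theta1 q lq \<alpha> ^^ n) a"

definition quotient_rule :: "(complex poly poly \<Rightarrow> complex poly poly) \<Rightarrow> ratfun \<Rightarrow> ratfun" where
  "quotient_rule d r = (case quot_of_fract r of (p, s) \<Rightarrow> to_fract (d p * s - p * d s) / to_fract (s * s))"

definition D_t :: "ratfun \<Rightarrow> ratfun" where
  "D_t = quotient_rule (map_poly pderiv)"

definition D_y :: "ratfun \<Rightarrow> ratfun" where
  "D_y = quotient_rule pderiv"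

section \<open>Twisted power series \<open>F(\<int>, B)[[X]]\<close>\<close>

text \<open>\<open>tps_nth f i n\<close> is \<open>a\<^sub>i(n)\<close> for \<open>f = \<Sum>\<^sub>i X\<^sup>i a\<^sub>i\<close>.\<close>

typedef 'b tps = "UNIV :: (nat \<Rightarrow> int \<Rightarrow> 'b) set"
  morphisms tps_nth Tps by simp

setup_lifting type_definition_tps

lemma tps_nth_Tps [simp]: "tps_nth (Tps f) = f"
  by (simp add: Tps_inverse)

lemma tps_eqI: "(\<And>i n. tps_nth f i n = tps_nth g i n) \<Longrightarrow> f = g"
  by (metis ext tps_nth_inject)

text \<open>
  The rings \<open>B\<close> and \<open>A\<close> are taken in the sort \<open>{ring, monoid_mult}\<close>, which is \<^class>\<open>ring_1\<close>
  without the axiom \<open>0 \<noteq> 1\<close>, so that the zero algebra is admitted. From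
  \<open>a X = X \<Sigma>(a)\<close> one gets \<open>(X\<^sup>i a)(X\<^sup>j b) = X\<^sup>i\<^sup>+\<^sup>j \<Sigma>\<^sup>j(a) b\<close>.
\<close>

instantiation tps :: (ring) ring
begin

definition "0 = Tps (\<lambda>i n. 0)"
definition "f + g = Tps (\<lambda>i n. tps_nth f i n + tps_nth g i n)"
definition "f - g = Tps (\<lambda>i n. tps_nth f i n - tps_nth g i n)"
definition "- f = Tps (\<lambda>i n. - tps_nth f i n)"
definition "f * g = Tps (\<lambda>k n. \<Sum>j=0..k. tps_nth f (k - j) (n + int j) * tps_nth g j n)"

instance
proof
  fix f g h :: "'a tps"
  show "f * g * h = f * (g * h)"
  proof (rule tps_eqI)
    fix k n
    define T where "T = (\<lambda>a b c. tps_nth f c (n + int a + int b) * tps_nth g b (n + int a) * tps_nth h a n)"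
    have 1: "tps_nth (f * g * h) k n = (\<Sum>j=0..k. \<Sum>i=0..k - j. T j i (k - j - i))"
      by (simp add: times_tps_def sum_distrib_right T_def)
    have 2: "(\<Sum>m=0..k. \<Sum>j=0..m. T j (m - j) (k - m)) = (\<Sum>j=0..k. \<Sum>i=0..k - j. T j i (k - j - i))"
      by (rule fps_mult_assoc_lemma)
    have "T j (m - j) (k - m) = tps_nth f (k - m) (n + int m) * (tps_nth g (m - j) (n + int j) * tps_nth h j n)"
      if "j \<in> {0..m}" for j m
      using that by (simp add: T_def of_nat_diff mult.assoc)
    then have 3: "(\<Sum>m=0..k. \<Sum>j=0..m. T j (m - j) (k - m)) = tps_nth (f * (g * h)) k n"
      by (simp add: times_tps_def sum_distrib_left)
    from 1 2 3 show "tps_nth (f * g * h) k n = tps_nth (f * (g * h)) k n" by simp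
  qed
qed (auto intro!: tps_eqI simp: zero_tps_def plus_tps_def minus_tps_def uminus_tps_def times_tps_def
       algebra_simps sum.distrib)

end

instantiation tps :: ("{ring, monoid_mult}") monoid_mult
begin

definition "1 = Tps (\<lambda>i n. if i = 0 then 1 else 0)"

instance
proof
  fix f :: "'a tps"
  show "1 * f = f"
  proof (rule tps_eqI)
    fix k n
    have "tps_nth (1 * f) k n = (\<Sum>j=0..k. if j = k then tps_nth f j n else 0)"
      unfolding times_tps_def one_tps_def tps_nth_Tps by (intro sum.cong refl) auto
    then show "tps_nth (1 * f) k n = tps_nth f k n" by simp
  qed
  show "f * 1 = f"
  proof (rule tps_eqI)
    fix k n
    have "tps_nth (f * 1) k n = (\<Sum>j=0..k. if j = 0 then tps_nth f k n else 0)"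
      unfolding times_tps_def one_tps_def tps_nth_Tps by (intro sum.cong refl) auto
    then show "tps_nth (f * 1) k n = tps_nth f k n" by simp
  qed
qed

end

instance fps :: ("{semiring_0, monoid_mult}") monoid_mult
  by standard (simp_all add: fps_one_mult)

definition tps_map :: "('b \<Rightarrow> 'c) \<Rightarrow> 'b tps \<Rightarrow> 'c tps" where
  "tps_map h f = Tps (\<lambda>i n. h (tps_nth f i n))"

text \<open>Elements of \<open>B\<close> as constant functions of degree \<open>0\<close>.\<close>

definition tps_const :: "'b::zero \<Rightarrow> 'b tps" where
  "tps_const b = Tps (\<lambda>i n. if i = 0 then b else 0)"

definition tps_X :: "'b::{zero, one} tps" where
  "tps_X = Tps (\<lambda>i n. if i = 1 then 1 else 0)"

text \<open>In the following operators \<open>s\<close> is the structure map \<open>\<complex> \<Rightarrow> B\<close> of the coefficient algebra.\<close>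

definition tps_Q :: "complex \<Rightarrow> (complex \<Rightarrow> 'b::zero) \<Rightarrow> complex \<Rightarrow> 'b tps" where
  "tps_Q lq s \<beta> = Tps (\<lambda>i n. if i = 0 then s (qpow lq (of_int n * \<beta>)) else 0)"

definition tps_Sigma :: "complex \<Rightarrow> (complex \<Rightarrow> 'b::times) \<Rightarrow> 'b tps \<Rightarrow> 'b tps" where
  "tps_Sigma q s f = Tps (\<lambda>i n. s (q ^ i) * tps_nth f i (n + 1))"

definition tps_Theta :: "complex \<Rightarrow> (complex \<Rightarrow> 'b::times) \<Rightarrow> nat \<Rightarrow> 'b tps \<Rightarrow> 'b tps" where
  "tps_Theta q s l f = Tps (\<lambda>i n. s (qbinom_nat q (i + l) l) * tps_nth f (i + l) n)"

section \<open>The Galois hull\<close>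

definition iota0 :: "complex \<Rightarrow> complex \<Rightarrow> complex \<Rightarrow> ratfun \<Rightarrow> ratfun tps" where
  "iota0 q lq \<alpha> a = Tps (\<lambda>i n. sigma_int q lq \<alpha> n (theta q lq \<alpha> i a))"

inductive_set galois_hull :: "complex \<Rightarrow> complex \<Rightarrow> complex \<Rightarrow> ratfun tps set"
  for q lq \<alpha> :: complex where
  iota0: "iota0 q lq \<alpha> a \<in> galois_hull q lq \<alpha>"
| const: "tps_const a \<in> galois_hull q lq \<alpha>"
| add: "x \<in> galois_hull q lq \<alpha> \<Longrightarrow> x' \<in> galois_hull q lq \<alpha> \<Longrightarrow> x + x' \<in> galois_hull q lq \<alpha>"
| diff: "x \<in> galois_hull q lq \<alpha> \<Longrightarrow> x' \<in> galois_hull q lq \<alpha> \<Longrightarrow> x - x' \<in> galois_hull q lq \<alpha>"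
| mult: "x \<in> galois_hull q lq \<alpha> \<Longrightarrow> x' \<in> galois_hull q lq \<alpha> \<Longrightarrow> x * x' \<in> galois_hull q lq \<alpha>"
| Sigma: "x \<in> galois_hull q lq \<alpha> \<Longrightarrow> tps_Sigma q Cst x \<in> galois_hull q lq \<alpha>"
| Theta: "x \<in> galois_hull q lq \<alpha> \<Longrightarrow> tps_Theta q Cst l x \<in> galois_hull q lq \<alpha>"
| D_t: "x \<in> galois_hull q lq \<alpha> \<Longrightarrow> tps_map D_t x \<in> galois_hull q lq \<alpha>"
| D_y: "x \<in> galois_hull q lq \<alpha> \<Longrightarrow> tps_map D_y x \<in> galois_hull q lq \<alpha>"

definition Y0 :: "complex \<Rightarrow> complex \<Rightarrow> complex \<Rightarrow> ratfun tps" where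
  "Y0 q lq \<alpha> = Tps (\<lambda>i n. Cst (qbinom q lq \<alpha> i) * inverse t_var ^ i
                          * Cst (qpow lq (of_int n * (\<alpha> - of_nat i))))"

section \<open>Algebras over \<open>L\<close> and the rings \<open>A[[W\<^sub>1]] \<subseteq> A[[W\<^sub>1, W\<^sub>2]]\<close>\<close>

text \<open>An \<open>L\<close>-algebra \<open>A\<close> is given by its structure map \<open>\<eta>\<close> into the center.\<close>

definition nc_algebra :: "(ratfun \<Rightarrow> 'a::{ring, monoid_mult}) \<Rightarrow> bool" where
  "nc_algebra \<eta> \<longleftrightarrow>
     (\<forall>a b. \<eta> (a + b) = \<eta> a + \<eta> b) \<and> (\<forall>a b. \<eta> (a * b) = \<eta> a * \<eta> b) \<and> \<eta> 1 = 1 \<and>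
     (\<forall>a x. \<eta> a * x = x * \<eta> a)"

definition nc_algebra_hom ::
    "(ratfun \<Rightarrow> 'a::{ring, monoid_mult}) \<Rightarrow> (ratfun \<Rightarrow> 'b::{ring, monoid_mult}) \<Rightarrow> ('a \<Rightarrow> 'b) \<Rightarrow> bool" where
  "nc_algebra_hom \<eta> \<eta>' g \<longleftrightarrow>
     (\<forall>x y. g (x + y) = g x + g y) \<and> (\<forall>x y. g (x * y) = g x * g y) \<and> g 1 = 1 \<and>
     (\<forall>a. g (\<eta> a) = \<eta>' a)"

definition nilpotent :: "'a::{ring, monoid_mult} \<Rightarrow> bool" where
  "nilpotent a \<longleftrightarrow> (\<exists>k. a ^ k = 0)"

text \<open>
  \<open>A[[W\<^sub>1, W\<^sub>2]]\<close> is \<open>A[[W\<^sub>1]][[W\<^sub>2]]\<close>: in \<^typ>\<open>'a fps fps\<close> the outer variable is \<open>W\<^sub>2\<close> and the inner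
  one is \<open>W\<^sub>1\<close>, so the coefficient of \<open>W\<^sub>1\<^sup>n W\<^sub>2\<^sup>m\<close> in \<open>F\<close> is \<open>F $ m $ n\<close>. The embedding
  \<open>A[[W\<^sub>1]] \<rightarrow> A[[W\<^sub>1, W\<^sub>2]]\<close> is \<^const>\<open>fps_const\<close>.
\<close>

definition const_W :: "'a::zero \<Rightarrow> 'a fps fps" where
  "const_W a = fps_const (fps_const a)"

definition W1 :: "'a::{zero, one} fps fps" where
  "W1 = fps_const fps_X"

definition W2 :: "'a::{zero, one} fps fps" where
  "W2 = fps_X"

text \<open>
  Formal derivative; \<^const>\<open>fps_deriv\<close> is not available without \<open>0 \<noteq> 1\<close>, hence the
  \<open>(n + 1)\<close>-fold sum.
\<close>

definition fps_diff :: "'a::comm_monoid_add fps \<Rightarrow> 'a fps" where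
  "fps_diff f = Abs_fps (\<lambda>n. \<Sum>_<n + 1. f $ (n + 1))"

definition fps_map :: "('a \<Rightarrow> 'b) \<Rightarrow> 'a fps \<Rightarrow> 'b fps" where
  "fps_map h f = Abs_fps (\<lambda>n. h (f $ n))"

definition D_W1 :: "'a::comm_monoid_add fps fps \<Rightarrow> 'a fps fps" where
  "D_W1 = fps_map fps_diff"

definition D_W2 :: "'a::comm_monoid_add fps fps \<Rightarrow> 'a fps fps" where
  "D_W2 = fps_diff"

definition map_W :: "('a \<Rightarrow> 'b) \<Rightarrow> 'a fps fps \<Rightarrow> 'b fps fps" where
  "map_W h = fps_map (fps_map h)"

definition fps2_coeffs :: "'a fps fps \<Rightarrow> 'a set" where
  "fps2_coeffs F = {F $ m $ n | m n. True}"

definition scalar_W :: "(ratfun \<Rightarrow> 'a::zero) \<Rightarrow> complex \<Rightarrow> 'a fps fps" where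
  "scalar_W \<eta> c = const_W (\<eta> (Cst c))"

text \<open>
  Substitution \<open>(W\<^sub>1, W\<^sub>2) := (s\<^sub>1, s\<^sub>2)\<close> into \<open>F\<close>, computed coefficientwise; it is meaningful when
  each of these sums has only finitely many nonzero terms.
\<close>

definition subst_W ::
    "'a::{ring, monoid_mult} fps fps \<Rightarrow> 'a fps fps \<times> 'a fps fps \<Rightarrow> 'a fps fps" where
  "subst_W F s = Abs_fps (\<lambda>M. Abs_fps (\<lambda>N.
     Sum_any (\<lambda>(m, n). (const_W (F $ m $ n) * fst s ^ n * snd s ^ m) $ M $ N)))"

section \<open>Infinitesimal deformations\<close>

definition taylor :: "ratfun \<Rightarrow> ratfun fps fps" where
  "taylor a = Abs_fps (\<lambda>m. Abs_fps (\<lambda>n. Cst (1 / (fact n * fact m)) * (D_t ^^ n) ((D_y ^^ m) a)))"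

definition canonical :: "(ratfun \<Rightarrow> 'a) \<Rightarrow> ratfun tps \<Rightarrow> 'a fps fps tps" where
  "canonical \<eta> = tps_map (\<lambda>a. map_W \<eta> (taylor a))"

text \<open>
  Deformations are functions on the hull only; they are represented as functions that are
  \<^const>\<open>undefined\<close> outside of it.
\<close>

definition NCF :: "complex \<Rightarrow> complex \<Rightarrow> complex \<Rightarrow> (ratfun \<Rightarrow> 'a::{ring, monoid_mult})
    \<Rightarrow> (ratfun tps \<Rightarrow> 'a fps fps tps) set" where
  "NCF q lq \<alpha> \<eta> = {\<phi> \<in> extensional (galois_hull q lq \<alpha>).
     \<phi> 1 = 1 \<and>
     (\<forall>x \<in> galois_hull q lq \<alpha>. \<forall>x' \<in> galois_hull q lq \<alpha>. \<phi> (x + x') = \<phi> x + \<phi> x' \<and> \<phi> (x * x') = \<phi> x * \<phi> x') \<and>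
     (\<forall>c. \<forall>x \<in> galois_hull q lq \<alpha>. \<phi> (tps_const (Cst c) * x) = tps_const (scalar_W \<eta> c) * \<phi> x) \<and>
     (\<forall>x \<in> galois_hull q lq \<alpha>.
        \<phi> (tps_Sigma q Cst x) = tps_Sigma q (scalar_W \<eta>) (\<phi> x) \<and>
        (\<forall>l. \<phi> (tps_Theta q Cst l x) = tps_Theta q (scalar_W \<eta>) l (\<phi> x)) \<and>
        \<phi> (tps_map D_t x) = tps_map D_W1 (\<phi> x) \<and>
        \<phi> (tps_map D_y x) = tps_map D_W2 (\<phi> x)) \<and>
     (\<forall>a. \<phi> (tps_const a) = canonical \<eta> (tps_const a)) \<and>
     (\<forall>x \<in> galois_hull q lq \<alpha>. \<forall>i n. \<forall>c \<in> fps2_coeffs (tps_nth (\<phi> x - canonical \<eta> x) i n). nilpotent c)}"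

definition NCF_map :: "complex \<Rightarrow> complex \<Rightarrow> complex \<Rightarrow> ('a \<Rightarrow> 'b)
    \<Rightarrow> (ratfun tps \<Rightarrow> 'a fps fps tps) \<Rightarrow> (ratfun tps \<Rightarrow> 'b fps fps tps)" where
  "NCF_map q lq \<alpha> g \<phi> = restrict (\<lambda>x. tps_map (map_W g) (\<phi> x)) (galois_hull q lq \<alpha>)"

lemma map_W_id [simp]: "map_W id = id"
  by (simp add: map_W_def fps_map_def fun_eq_iff fps_eq_iff)

lemma map_W_comp: "map_W (g \<circ> h) F = map_W g (map_W h F)"
  by (simp add: map_W_def fps_map_def)

lemma NCF_map_id: "\<phi> \<in> NCF q lq \<alpha> \<eta> \<Longrightarrow> NCF_map q lq \<alpha> id \<phi> = \<phi>"
  unfolding NCF_def NCF_map_def by (simp add: tps_map_def tps_nth_inverse extensional_restrict)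

lemma NCF_map_comp: "NCF_map q lq \<alpha> (g \<circ> h) \<phi> = NCF_map q lq \<alpha> g (NCF_map q lq \<alpha> h \<phi>)"
  unfolding NCF_map_def by (rule ext) (simp add: tps_map_def map_W_comp restrict_def)

section \<open>Quantum formal groups\<close>

text \<open>\<open>e (t + W\<^sub>1) + f\<close> in \<open>A[[W\<^sub>1]]\<close>\<close>

definition affine_t :: "(ratfun \<Rightarrow> 'a::{ring, monoid_mult}) \<Rightarrow> 'a \<Rightarrow> 'a \<Rightarrow> 'a fps" where
  "affine_t \<eta> e f = fps_const e * (fps_const (\<eta> t_var) + fps_X) + fps_const f"

definition QG2 :: "complex \<Rightarrow> (ratfun \<Rightarrow> 'a::{ring, monoid_mult}) \<Rightarrow> (('a ^ 2 ^ 2) \<times> 'a fps) set" where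
  "QG2 q \<eta> = {(vector [vector [e, f], vector [0, 1]], b) | e f b.
     e * f = \<eta> (Cst q) * f * e \<and>
     affine_t \<eta> e f * b = b * affine_t \<eta> e f \<and>
     nilpotent (e - 1) \<and> nilpotent f \<and> (\<forall>k. nilpotent ((b - 1) $ k))}"

definition II_pair :: "(ratfun \<Rightarrow> 'a::{ring, monoid_mult}) \<Rightarrow> 'a \<Rightarrow> 'a \<Rightarrow> 'a fps
    \<Rightarrow> 'a fps fps \<times> 'a fps fps" where
  "II_pair \<eta> e f b =
     (const_W ((e - 1) * \<eta> t_var + f) + const_W e * W1,
      fps_const (b - 1) * const_W (\<eta> y_var) + fps_const b * W2)"

definition QGII :: "complex \<Rightarrow> (ratfun \<Rightarrow> 'a::{ring, monoid_mult}) \<Rightarrow> ('a fps fps \<times> 'a fps fps) set" where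
  "QGII q \<eta> = {u. \<exists>e f b. u = II_pair \<eta> e f b \<and>
     e * f = \<eta> (Cst q) * f * e \<and>
     fst u * snd u = snd u * fst u \<and>
     nilpotent (e - 1) \<and> nilpotent f \<and> (\<forall>k. nilpotent ((b - 1) $ k))}"

definition QGII_map :: "('a \<Rightarrow> 'b) \<Rightarrow> 'a fps fps \<times> 'a fps fps \<Rightarrow> 'b fps fps \<times> 'b fps fps" where
  "QGII_map g = map_prod (map_W g) (map_W g)"

lemma QGII_map_id: "QGII_map id u = u"
  by (simp add: QGII_map_def prod.map_id0)

lemma QGII_map_comp: "QGII_map (g \<circ> h) u = QGII_map g (QGII_map h u)"
  by (simp add: QGII_map_def map_prod_def map_W_comp split: prod.split)

definition pair_coeffs :: "'a fps fps \<times> 'a fps fps \<Rightarrow> 'a set" where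
  "pair_coeffs u = fps2_coeffs (fst u) \<union> fps2_coeffs (snd u)"

definition mutually_commute ::
    "'a::{ring, monoid_mult} fps fps \<times> 'a fps fps \<Rightarrow> 'a fps fps \<times> 'a fps fps \<Rightarrow> bool" where
  "mutually_commute u v \<longleftrightarrow> (\<forall>a \<in> pair_coeffs u. \<forall>b \<in> pair_coeffs v. a * b = b * a)"

text \<open>The composite of the coordinate transformations \<open>v\<close> and \<open>u\<close>, \<open>v\<close> being applied first.\<close>

definition QGII_mult :: "'a::{ring, monoid_mult} fps fps \<times> 'a fps fps \<Rightarrow> 'a fps fps \<times> 'a fps fps
    \<Rightarrow> 'a fps fps \<times> 'a fps fps" where
  "QGII_mult u v = (subst_W (fst u) v, subst_W (snd u) v)"

section \<open>The parameters of a deformation\<close>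

definition two_sided_inverse :: "'a::{ring, monoid_mult} \<Rightarrow> 'a" where
  "two_sided_inverse x = (THE z. x * z = 1 \<and> z * x = 1)"

text \<open>
  \<open>\<phi>(\<iota>\<^sub>0(t)) = (e (t + W\<^sub>1) + f) Q + X\<close> and
  \<open>\<phi>(Y\<^sub>0) = \<Sum> X\<^sup>n (\<alpha> choose n)\<^sub>q (e (t + W\<^sub>1) + f)\<^sup>-\<^sup>n Q\<^sup>\<alpha>\<^sup>-\<^sup>n b(W\<^sub>1)\<close>
\<close>

definition NCF_data :: "complex \<Rightarrow> complex \<Rightarrow> complex \<Rightarrow> (ratfun \<Rightarrow> 'a::{ring, monoid_mult})
    \<Rightarrow> (ratfun tps \<Rightarrow> 'a fps fps tps) \<Rightarrow> 'a \<Rightarrow> 'a \<Rightarrow> 'a fps \<Rightarrow> bool" where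
  "NCF_data q lq \<alpha> \<eta> \<phi> e f b \<longleftrightarrow>
     \<phi> (iota0 q lq \<alpha> t_var) = tps_const (fps_const (affine_t \<eta> e f)) * tps_Q lq (scalar_W \<eta>) 1 + tps_X \<and>
     \<phi> (Y0 q lq \<alpha>) = Tps (\<lambda>i n. scalar_W \<eta> (qbinom q lq \<alpha> i)
        * fps_const (two_sided_inverse (affine_t \<eta> e f) ^ i)
        * scalar_W \<eta> (qpow lq (of_int n * (\<alpha> - of_nat i))) * fps_const b)"

definition to_QG2 :: "complex \<Rightarrow> complex \<Rightarrow> complex \<Rightarrow> (ratfun \<Rightarrow> 'a::{ring, monoid_mult})
    \<Rightarrow> (ratfun tps \<Rightarrow> 'a fps fps tps) \<Rightarrow> ('a ^ 2 ^ 2) \<times> 'a fps" where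
  "to_QG2 q lq \<alpha> \<eta> \<phi> = (THE p. \<exists>e f b. NCF_data q lq \<alpha> \<eta> \<phi> e f b \<and>
     p = (vector [vector [e, f], vector [0, 1]], b))"

definition to_QGII :: "complex \<Rightarrow> complex \<Rightarrow> complex \<Rightarrow> (ratfun \<Rightarrow> 'a::{ring, monoid_mult})
    \<Rightarrow> (ratfun tps \<Rightarrow> 'a fps fps tps) \<Rightarrow> 'a fps fps \<times> 'a fps fps" where
  "to_QGII q lq \<alpha> \<eta> \<phi> = (THE u. \<exists>e f b. NCF_data q lq \<alpha> \<eta> \<phi> e f b \<and> u = II_pair \<eta> e f b)"

text \<open>\<open>u \<cdot> \<phi>\<close>: the deformation whose transformation of the initial conditions is \<open>u * v\<close>, where
  \<open>v\<close> is that of \<open>\<phi>\<close>.\<close>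

definition QGII_act :: "complex \<Rightarrow> complex \<Rightarrow> complex \<Rightarrow> (ratfun \<Rightarrow> 'a::{ring, monoid_mult})
    \<Rightarrow> 'a fps fps \<times> 'a fps fps \<Rightarrow> (ratfun tps \<Rightarrow> 'a fps fps tps) \<Rightarrow> (ratfun tps \<Rightarrow> 'a fps fps tps)" where
  "QGII_act q lq \<alpha> \<eta> u \<phi> =
     the_inv_into (NCF q lq \<alpha> \<eta>) (to_QGII q lq \<alpha> \<eta>) (QGII_mult u (to_QGII q lq \<alpha> \<eta> \<phi>))"

end

theory Submission
  imports Defs
begin

text \<open>
  A deformation \<open>\<phi>\<close> respects the equations that characterise the two generators of the hull. The
  series \<open>T = \<iota>\<^sub>0(t)\<close> satisfies \<open>\<Theta>\<^sup>(\<^sup>1\<^sup>) T = 1\<close>, \<open>\<Sigma> T = q T\<close> and \<open>\<partial>T/\<partial>y = \<partial>\<^sup>2T/\<partial>t\<^sup>2 = 0\<close>, which forces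
  \<open>\<phi>(T) = (e (t + W\<^sub>1) + f) Q + X\<close>. The series \<open>Y\<^sub>0 = \<iota>\<^sub>0(y) y\<^sup>-\<^sup>1\<close> satisfies \<open>T \<Theta>\<^sup>(\<^sup>1\<^sup>) Y\<^sub>0 = [\<alpha>]\<^sub>q Y\<^sub>0\<close>,
  \<open>\<Sigma> Y\<^sub>0 = q\<^sup>\<alpha> Y\<^sub>0\<close> and \<open>\<partial>Y\<^sub>0/\<partial>y = 0\<close>. As \<open>\<phi>(T)\<close> is known and \<open>e (t + W\<^sub>1) + f\<close> is invertible, the first of
  these is a recurrence for the coefficients of \<open>\<phi>(Y\<^sub>0)\<close>, and only a series \<open>b(W\<^sub>1)\<close> remains free
  (\<open>NCF_data_par\<close>). The relation \<open>Q X = q X Q\<close> becomes \<open>e f = q f e\<close>, and \<open>T Y\<^sub>0 = Y\<^sub>0 T\<close> becomes the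
  commutation of \<open>e (t + W\<^sub>1) + f\<close> with \<open>b\<close>, which is that of the two components of the pair in
  \<open>QG\<^sub>I\<^sub>I\<close>. The parameters determine \<open>\<phi>\<close> (\<open>NCF_eqI\<close>): \<open>\<iota>\<^sub>0\<close> is a ring homomorphism (\<open>iota0_mult\<close>), so
  \<open>\<phi>\<close> is known on \<open>\<iota>\<^sub>0(\<complex>(t, y))\<close>; together with \<open>L\<^sup>\<sharp>\<close> this set generates the hull under operations that
  \<open>\<phi>\<close> respects.

  In \<open>QG\<^sub>I\<^sub>I\<close> the relation \<open>e f = q f e\<close> with \<open>e\<close> unipotent and \<open>q \<noteq> 1\<close> implies \<open>f = 0\<close>
  (\<open>q_commuting_unipotent_zero\<close>). The substitution of a pair with parameters \<open>(h, 0, c)\<close> is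
  therefore the dilation \<open>t + W\<^sub>1 \<mapsto> h (t + W\<^sub>1)\<close>. Its coefficients are finite sums because \<open>h - 1\<close> is
  nilpotent; it is multiplicative on series whose coefficients commute with \<open>h\<close>, and two dilations
  with commuting factors compose to the dilation by their product. This gives the formula for \<open>u * v\<close>,
  its associativity and its naturality in \<open>A\<close>.

  For \<open>u * v\<close> to lie in \<open>QG\<^sub>I\<^sub>I\<close> again, sums of products of nilpotent elements of \<open>A\<close> have to be
  nilpotent, which may fail in a noncommutative ring. Here the bijectivity of \<open>NCF(A) \<rightarrow> QG\<^sub>2(A)\<close> enters:
  it implies that any two nilpotent elements \<open>x\<close>, \<open>y\<close> of \<open>A\<close> commute (\<open>nilpotents_commute\<close>). Indeed the
  parameters \<open>(1, 0, 1 + x W\<^sub>1 + y W\<^sub>1\<^sup>2)\<close> must come from a deformation. In the hull the logarithmic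
  derivative \<open>\<lambda> = \<partial>Y\<^sub>0/\<partial>t \<cdot> Y\<^sub>0\<^sup>-\<^sup>1\<close> commutes with \<open>\<partial>\<lambda>/\<partial>t\<close>, both being fixed by \<open>\<Sigma>\<close>; hence \<open>b' b\<^sup>-\<^sup>1\<close> commutes
  with its derivative, and at \<open>W\<^sub>1 = 0\<close> this reads \<open>x (2 y - x\<^sup>2) = (2 y - x\<^sup>2) x\<close>.
\<close>

section \<open>Fractions of polynomials\<close>

lemma ratfun_cases:
  obtains p s where "s \<noteq> 0" "r = to_fract p / to_fract (s :: complex poly poly)"
  by (metis Fract_conv_to_fract Fract_quot_of_fract snd_quot_of_fract_nonzero)

text \<open>
  \<open>sigma\<close> and \<open>quotient_rule\<close> are defined on the normalized representative of a fraction; a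
  comparison of cross products shows that any representative may be used.
\<close>

lemma quot_of_fract_cross:
  assumes "s \<noteq> 0" "quot_of_fract (to_fract p / to_fract s) = (p', s' :: complex poly poly)"
  shows "s' \<noteq> 0" "p * s' = p' * s"
proof -
  show "s' \<noteq> 0"
    using assms(2) snd_quot_of_fract_nonzero by (metis snd_conv)
  have "to_fract p' / to_fract s' = to_fract p / to_fract s"
    using assms(2) Fract_quot_of_fract[of "to_fract p / to_fract s"] by (simp add: Fract_conv_to_fract)
  then have "to_fract (p * s') = to_fract (p' * s)"
    using assms(1) \<open>s' \<noteq> 0\<close> by (simp add: field_simps)
  then show "p * s' = p' * s"
    by (simp only: to_fract_eq_iff)
qed

section \<open>The automorphism \<open>\<sigma>\<close>\<close>

lemma coeff_sigma_poly:
  "coeff (coeff (sigma_poly q lq \<alpha> p) i) j = qpow lq \<alpha> ^ i * q ^ j * coeff (coeff p i) j"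
proof -
  have "coeff (sigma_poly q lq \<alpha> p) i = [:qpow lq \<alpha>:] ^ i * pcompose (coeff p i) [:0, q:]"
    unfolding sigma_poly_def by (simp add: coeff_pcompose_linear coeff_map_poly)
  then show ?thesis
    by (simp add: poly_const_pow coeff_pcompose_linear)
qed

lemma sigma_poly_add: "sigma_poly q lq \<alpha> (p + r) = sigma_poly q lq \<alpha> p + sigma_poly q lq \<alpha> r"
  by (simp add: poly_eq_iff coeff_sigma_poly algebra_simps)

lemma sigma_poly_mult: "sigma_poly q lq \<alpha> (p * r) = sigma_poly q lq \<alpha> p * sigma_poly q lq \<alpha> r"
proof (intro poly_eqI)
  fix i j
  have *: "qpow lq \<alpha> ^ i * q ^ j * (coeff (coeff p k) l * coeff (coeff r (i - k)) (j - l)) =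
      (qpow lq \<alpha> ^ k * q ^ l * coeff (coeff p k) l) *
      (qpow lq \<alpha> ^ (i - k) * q ^ (j - l) * coeff (coeff r (i - k)) (j - l))"
    if "k \<le> i" "l \<le> j" for k l
  proof -
    have "qpow lq \<alpha> ^ i = qpow lq \<alpha> ^ k * qpow lq \<alpha> ^ (i - k)" "q ^ j = q ^ l * q ^ (j - l)"
      using that by (simp_all flip: power_add)
    then show ?thesis by simp
  qed
  show "coeff (coeff (sigma_poly q lq \<alpha> (p * r)) i) j =
      coeff (coeff (sigma_poly q lq \<alpha> p * sigma_poly q lq \<alpha> r) i) j"
    by (simp add: coeff_mult coeff_sum coeff_sigma_poly sum_distrib_left)
       (intro sum.cong refl *; simp)
qed

lemma sigma_poly_1 [simp]: "sigma_poly q lq \<alpha> 1 = 1"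
proof -
  have "sigma_poly q lq \<alpha> 1 = sigma_poly q lq \<alpha> [:[:1:]:]" by (simp add: one_pCons)
  also have "\<dots> = 1"
    by (auto simp: poly_eq_iff coeff_sigma_poly coeff_pCons one_pCons split: nat.split)
  finally show ?thesis .
qed

lemma sigma_poly_0 [simp]: "sigma_poly q lq \<alpha> 0 = 0"
  by (simp add: poly_eq_iff coeff_sigma_poly)

lemma sigma_poly_eq_0_iff:
  assumes "q \<noteq> 0"
  shows "sigma_poly q lq \<alpha> p = 0 \<longleftrightarrow> p = 0"
  using assms by (simp add: poly_eq_iff coeff_sigma_poly qpow_def)

lemma sigma_to_fract_divide:
  assumes "q \<noteq> 0" "s \<noteq> 0"
  shows "sigma q lq \<alpha> (to_fract p / to_fract s) =
    to_fract (sigma_poly q lq \<alpha> p) / to_fract (sigma_poly q lq \<alpha> s)"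
proof -
  obtain p' s' where ps: "quot_of_fract (to_fract p / to_fract s) = (p', s')"
    by fastforce
  note c = quot_of_fract_cross[OF assms(2) ps]
  have "sigma_poly q lq \<alpha> p * sigma_poly q lq \<alpha> s' = sigma_poly q lq \<alpha> p' * sigma_poly q lq \<alpha> s"
    using c(2) by (metis sigma_poly_mult)
  then have "to_fract (sigma_poly q lq \<alpha> p) * to_fract (sigma_poly q lq \<alpha> s') =
      to_fract (sigma_poly q lq \<alpha> p') * to_fract (sigma_poly q lq \<alpha> s)"
    by (simp flip: to_fract_mult)
  then show ?thesis
    using assms c(1) by (simp add: sigma_def ps sigma_poly_eq_0_iff field_simps)
qed

lemma sigma_to_fract:
  assumes "q \<noteq> 0"
  shows "sigma q lq \<alpha> (to_fract p) = to_fract (sigma_poly q lq \<alpha> p)"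
  using sigma_to_fract_divide[OF assms, of 1 lq \<alpha> p] by simp

lemma sigma_1 [simp]: "sigma q lq \<alpha> 1 = 1"
  by (simp add: sigma_def)

lemma sigma_0 [simp]: "sigma q lq \<alpha> 0 = 0"
  by (simp add: sigma_def)

lemma sigma_add:
  assumes q: "q \<noteq> 0"
  shows "sigma q lq \<alpha> (a + b) = sigma q lq \<alpha> a + sigma q lq \<alpha> b"
proof -
  obtain p s where a: "s \<noteq> 0" "a = to_fract p / to_fract s" by (rule ratfun_cases)
  obtain p' s' where b: "s' \<noteq> 0" "b = to_fract p' / to_fract s'" by (rule ratfun_cases)
  have ab: "a + b = to_fract (p * s' + p' * s) / to_fract (s * s')"
    using a b by (simp add: add_frac_eq)
  have s: "s * s' \<noteq> 0" using a b by simp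
  show ?thesis
    unfolding ab sigma_to_fract_divide[OF q s]
    unfolding a(2) b(2) sigma_to_fract_divide[OF q a(1)] sigma_to_fract_divide[OF q b(1)]
    using a(1) b(1) q by (simp add: sigma_poly_add sigma_poly_mult sigma_poly_eq_0_iff add_frac_eq)
qed

lemma sigma_mult:
  assumes q: "q \<noteq> 0"
  shows "sigma q lq \<alpha> (a * b) = sigma q lq \<alpha> a * sigma q lq \<alpha> b"
proof -
  obtain p s where a: "s \<noteq> 0" "a = to_fract p / to_fract s" by (rule ratfun_cases)
  obtain p' s' where b: "s' \<noteq> 0" "b = to_fract p' / to_fract s'" by (rule ratfun_cases)
  have ab: "a * b = to_fract (p * p') / to_fract (s * s')"
    using a b by simp
  have s: "s * s' \<noteq> 0" using a b by simp
  show ?thesis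
    unfolding ab sigma_to_fract_divide[OF q s]
    unfolding a(2) b(2) sigma_to_fract_divide[OF q a(1)] sigma_to_fract_divide[OF q b(1)]
    by (simp add: sigma_poly_mult)
qed

lemma qpow_uminus: "qpow (- lq) \<beta> = inverse (qpow lq \<beta>)"
  by (simp add: qpow_def exp_minus)

lemma qpow_nonzero [simp]: "qpow lq \<beta> \<noteq> 0"
  by (simp add: qpow_def)

lemma qpow_add: "qpow lq (\<beta> + \<gamma>) = qpow lq \<beta> * qpow lq \<gamma>"
  by (simp add: qpow_def distrib_right exp_add)

lemma qpow_0 [simp]: "qpow lq 0 = 1"
  by (simp add: qpow_def)

text \<open>The inverse of \<open>\<sigma>\<close> is the automorphism of the same form that belongs to \<open>q\<^sup>-\<^sup>1\<close>.\<close>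

lemma sigma_inverse_parameter:
  assumes "q \<noteq> 0"
  shows "sigma (inverse q) (- lq) \<alpha> (sigma q lq \<alpha> a) = a"
proof -
  obtain p s where a: "s \<noteq> 0" "a = to_fract p / to_fract s" by (rule ratfun_cases)
  have "sigma_poly (inverse q) (- lq) \<alpha> (sigma_poly q lq \<alpha> p) = p" for p
    using assms by (simp add: poly_eq_iff coeff_sigma_poly qpow_uminus power_inverse field_simps)
  then show ?thesis
    using a assms by (simp add: sigma_to_fract_divide sigma_poly_eq_0_iff)
qed

lemma bij_sigma:
  assumes "q \<noteq> 0"
  shows "bij (sigma q lq \<alpha>)"
  using assms sigma_inverse_parameter[of q lq \<alpha>] sigma_inverse_parameter[of "inverse q" "- lq" \<alpha>]
  by (intro o_bij[of "sigma (inverse q) (- lq) \<alpha>"]) auto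

lemma inv_sigma:
  assumes "q \<noteq> 0"
  shows "inv (sigma q lq \<alpha>) = sigma (inverse q) (- lq) \<alpha>"
  using assms sigma_inverse_parameter[of q lq \<alpha>] sigma_inverse_parameter[of "inverse q" "- lq" \<alpha>]
  by (intro inv_unique_comp) (auto simp: fun_eq_iff)

lemma sigma_int_0 [simp]: "sigma_int q lq \<alpha> 0 a = a"
  by (simp add: sigma_int_def)

lemma sigma_int_Suc:
  assumes "q \<noteq> 0"
  shows "sigma_int q lq \<alpha> (n + 1) a = sigma_int q lq \<alpha> n (sigma q lq \<alpha> a)"
proof (cases "n \<ge> 0")
  case True
  then show ?thesis by (simp add: sigma_int_def nat_add_distrib funpow_swap1)
next
  case False
  define s where "s = sigma q lq \<alpha>"
  have s: "inv s (s x) = x" for x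
    using bij_sigma[OF assms] by (simp add: s_def bij_is_inj)
  define m where "m = nat (- n) - 1"
  have m: "nat (- n) = Suc m" "n + 1 = - int m"
    using False by (auto simp: m_def)
  have "sigma_int q lq \<alpha> (n + 1) a = (inv s ^^ m) a"
    unfolding m(2) by (cases m) (simp_all add: sigma_int_def s_def nat_add_distrib)
  moreover have "sigma_int q lq \<alpha> n (s a) = (inv s ^^ m) a"
    using False by (simp add: sigma_int_def m(1) s_def[symmetric] funpow_swap1 s)
  ultimately show ?thesis by (simp add: s_def)
qed

text \<open>
  Both definitional cases of \<open>sigma_int\<close> iterate an automorphism of the form \<open>sigma\<close>, so its
  homomorphism laws follow from those of \<open>sigma\<close>.
\<close>

lemma sigma_int_induct:
  assumes "q \<noteq> 0" "P (\<lambda>a. a)"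
    and "\<And>f. P f \<Longrightarrow> P (\<lambda>a. f (sigma q lq \<alpha> a))"
    and "\<And>f. P f \<Longrightarrow> P (\<lambda>a. f (sigma (inverse q) (- lq) \<alpha> a))"
  shows "P (sigma_int q lq \<alpha> n)"
proof -
  have 1: "P (sigma q lq \<alpha> ^^ m)" "P (sigma (inverse q) (- lq) \<alpha> ^^ m)" for m
    using assms by (induction m) (simp_all add: id_def funpow_Suc_right o_def del: funpow.simps(2))
  show ?thesis
    unfolding sigma_int_def inv_sigma[OF assms(1)] using 1 by auto
qed

lemma sigma_int_add:
  assumes "q \<noteq> 0"
  shows "sigma_int q lq \<alpha> n (a + b) = sigma_int q lq \<alpha> n a + sigma_int q lq \<alpha> n b"
  by (rule sigma_int_induct[OF assms, where P = "\<lambda>f. \<forall>a b. f (a + b) = f a + f b", rule_format])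
     (use assms in \<open>simp_all add: sigma_add\<close>)

lemma sigma_int_mult:
  assumes "q \<noteq> 0"
  shows "sigma_int q lq \<alpha> n (a * b) = sigma_int q lq \<alpha> n a * sigma_int q lq \<alpha> n b"
  by (rule sigma_int_induct[OF assms, where P = "\<lambda>f. \<forall>a b. f (a * b) = f a * f b", rule_format])
     (use assms in \<open>simp_all add: sigma_mult\<close>)

lemma Cst_add: "Cst (c + d) = Cst c + Cst d"
  by (simp add: Cst_def flip: to_fract_add)

lemma Cst_mult: "Cst (c * d) = Cst c * Cst d"
  by (simp add: Cst_def flip: to_fract_mult)

lemma Cst_1 [simp]: "Cst 1 = 1"
  by (simp add: Cst_def flip: one_pCons)

lemma Cst_0 [simp]: "Cst 0 = 0"
  by (simp add: Cst_def)

lemma Cst_diff: "Cst (c - d) = Cst c - Cst d"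
  by (simp add: Cst_def flip: to_fract_diff)

lemma Cst_eq_0_iff [simp]: "Cst c = 0 \<longleftrightarrow> c = 0"
  by (simp add: Cst_def)

lemma Cst_divide: "Cst (c / d) = Cst c / Cst d"
proof (cases "d = 0")
  case False
  then have "Cst (c / d) * Cst d = Cst c" by (simp flip: Cst_mult)
  with False show ?thesis by (simp add: field_simps)
qed simp

lemma t_var_nonzero [simp]: "t_var \<noteq> 0" and y_var_nonzero [simp]: "y_var \<noteq> 0"
  by (simp_all add: t_var_def y_var_def)

lemma sigma_Cst:
  assumes "q \<noteq> 0"
  shows "sigma q lq \<alpha> (Cst c) = Cst c"
proof -
  have "sigma_poly q lq \<alpha> [:[:c:]:] = [:[:c:]:]"
    by (auto simp: poly_eq_iff coeff_sigma_poly coeff_pCons split: nat.split)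
  then show ?thesis by (simp add: Cst_def sigma_to_fract assms)
qed

lemma sigma_t_var:
  assumes "q \<noteq> 0"
  shows "sigma q lq \<alpha> t_var = Cst q * t_var"
proof -
  have "sigma_poly q lq \<alpha> [:[:0, 1:]:] = [:[:q:]:] * [:[:0, 1:]:]"
    by (auto simp: poly_eq_iff coeff_sigma_poly coeff_pCons split: nat.split)
  then show ?thesis by (simp add: t_var_def Cst_def sigma_to_fract assms flip: to_fract_mult)
qed

lemma sigma_y_var:
  assumes "q \<noteq> 0"
  shows "sigma q lq \<alpha> y_var = Cst (qpow lq \<alpha>) * y_var"
proof -
  have "sigma_poly q lq \<alpha> [:0, 1:] = [:[:qpow lq \<alpha>:]:] * [:0, 1:]"
    by (auto simp: poly_eq_iff coeff_sigma_poly coeff_pCons split: nat.split)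
  then show ?thesis by (simp add: y_var_def Cst_def sigma_to_fract assms flip: to_fract_mult)
qed

lemma sigma_int_Cst:
  assumes "q \<noteq> 0"
  shows "sigma_int q lq \<alpha> n (Cst c) = Cst c"
  by (rule sigma_int_induct[OF assms, where P = "\<lambda>f. f (Cst c) = Cst c"])
     (use assms in \<open>simp_all add: sigma_Cst\<close>)

lemma sigma_int_eigenvector:
  assumes "q \<noteq> 0" "sigma q lq \<alpha> a = Cst (qpow lq \<beta>) * a"
  shows "sigma_int q lq \<alpha> n a = Cst (qpow lq (of_int n * \<beta>)) * a"
proof (induction n rule: int_induct[where k = 0])
  case base
  then show ?case by simp
next
  case (step1 n)
  then show ?case
    by (simp add: sigma_int_Suc assms sigma_int_mult sigma_int_Cst distrib_right qpow_add Cst_mult)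
next
  case (step2 n)
  have "Cst (qpow lq (of_int n * \<beta>)) * a = sigma_int q lq \<alpha> (n - 1 + 1) a"
    using step2 by simp
  also have "\<dots> = Cst (qpow lq \<beta>) * sigma_int q lq \<alpha> (n - 1) a"
    by (simp only: sigma_int_Suc[OF assms(1)] assms(2) sigma_int_mult[OF assms(1)] sigma_int_Cst[OF assms(1)])
  finally have "Cst (qpow lq (of_int (n - 1) * \<beta> + \<beta>)) * a = Cst (qpow lq \<beta>) * sigma_int q lq \<alpha> (n - 1) a"
    by (simp add: algebra_simps)
  then show ?case
    by (simp add: qpow_add Cst_mult)
qed

section \<open>The derivations of \<open>L\<^sup>\<sharp>\<close>\<close>

lemma quotient_rule_to_fract_divide:
  assumes d: "\<And>x y. d (x * y) = d x * y + x * d y" and "s \<noteq> 0"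
  shows "quotient_rule d (to_fract p / to_fract s) = (to_fract (d p) * to_fract s - to_fract p * to_fract (d s)) / (to_fract s * to_fract s)"
proof -
  obtain p' s' where ps: "quot_of_fract (to_fract p / to_fract s) = (p', s')"
    by fastforce
  note c = quot_of_fract_cross[OF assms(2) ps]
  have e: "to_fract p * to_fract s' = to_fract p' * to_fract s"
    using c(2) by (simp flip: to_fract_mult)
  have "to_fract (d (p * s')) = to_fract (d (p' * s))"
    using c(2) by simp
  then have de: "to_fract (d p) * to_fract s' + to_fract p * to_fract (d s') =
      to_fract (d p') * to_fract s + to_fract p' * to_fract (d s)"
    by (simp only: d to_fract_add to_fract_mult)
  have p': "to_fract p' = to_fract p * to_fract s' / to_fract s"
    using e assms(2) by (simp add: field_simps)
  have dp': "to_fract (d p') = (to_fract (d p) * to_fract s' + to_fract p * to_fract (d s')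
      - to_fract p' * to_fract (d s)) / to_fract s"
    using de assms(2) by (simp add: field_simps)
  have "quotient_rule d (to_fract p / to_fract s) =
      (to_fract (d p') * to_fract s' - to_fract p' * to_fract (d s')) / (to_fract s' * to_fract s')"
    by (simp add: quotient_rule_def ps)
  also have "\<dots> = (to_fract (d p) * to_fract s - to_fract p * to_fract (d s)) / (to_fract s * to_fract s)"
    unfolding dp' p' using assms(2) c(1) by (simp add: divide_simps) (simp add: algebra_simps)
  finally show ?thesis .
qed

lemma quotient_rule_to_fract:
  assumes "\<And>x y. d (x * y) = d x * y + x * d y"
  shows "quotient_rule d (to_fract p) = to_fract (d p)"
proof -
  have "d 1 = 0" using assms[of 1 1] by simp
  then show ?thesis using quotient_rule_to_fract_divide[OF assms, of 1 p] by simp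
qed

lemma quotient_rule_add:
  assumes a: "\<And>x y. d (x + y) = d x + d y" and d: "\<And>x y. d (x * y) = d x * y + x * d y"
  shows "quotient_rule d (x + y) = quotient_rule d x + quotient_rule d y"
proof -
  obtain p s where x: "s \<noteq> 0" "x = to_fract p / to_fract s" by (rule ratfun_cases)
  obtain p' s' where y: "s' \<noteq> 0" "y = to_fract p' / to_fract s'" by (rule ratfun_cases)
  have xy: "x + y = to_fract (p * s' + p' * s) / to_fract (s * s')"
    using x y by (simp add: add_frac_eq)
  have s: "s * s' \<noteq> 0" using x y by simp
  show ?thesis
    unfolding xy quotient_rule_to_fract_divide[OF d s] a d
    unfolding x(2) y(2) quotient_rule_to_fract_divide[OF d x(1)] quotient_rule_to_fract_divide[OF d y(1)]
    using x(1) y(1) by (simp add: divide_simps) (simp add: algebra_simps)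
qed

lemma quotient_rule_mult:
  assumes d: "\<And>x y. d (x * y) = d x * y + x * d y"
  shows "quotient_rule d (x * y) = quotient_rule d x * y + x * quotient_rule d y"
proof -
  obtain p s where x: "s \<noteq> 0" "x = to_fract p / to_fract s" by (rule ratfun_cases)
  obtain p' s' where y: "s' \<noteq> 0" "y = to_fract p' / to_fract s'" by (rule ratfun_cases)
  have xy: "x * y = to_fract (p * p') / to_fract (s * s')"
    using x y by simp
  have s: "s * s' \<noteq> 0" using x y by simp
  show ?thesis
    unfolding xy quotient_rule_to_fract_divide[OF d s] d
    unfolding x(2) y(2) quotient_rule_to_fract_divide[OF d x(1)] quotient_rule_to_fract_divide[OF d y(1)]
    using x(1) y(1) by (simp add: divide_simps) (simp add: algebra_simps)
qed

lemma map_poly_pderiv_add: "map_poly pderiv (p + r) = map_poly pderiv p + map_poly pderiv (r :: complex poly poly)"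
  by (simp add: poly_eq_iff coeff_map_poly coeff_pderiv algebra_simps)

lemma pderiv_mult': "pderiv (p * r) = pderiv p * r + p * pderiv (r :: 'a :: idom poly)"
  by (simp add: pderiv_mult algebra_simps)

lemma map_poly_pderiv_mult:
  "map_poly pderiv (p * r) = map_poly pderiv p * r + p * map_poly pderiv (r :: complex poly poly)"
proof (rule poly_eqI)
  fix n
  have s: "pderiv (sum f A) = (\<Sum>x\<in>A. pderiv (f x))" for f :: "nat \<Rightarrow> complex poly" and A
    by (induction A rule: infinite_finite_induct) (simp_all add: pderiv_add)
  show "coeff (map_poly pderiv (p * r)) n = coeff (map_poly pderiv p * r + p * map_poly pderiv r) n"
    by (simp add: coeff_map_poly coeff_mult s pderiv_mult' sum.distrib)
qed

lemma D_t_add: "D_t (x + y) = D_t x + D_t y"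
  unfolding D_t_def by (rule quotient_rule_add) (rule map_poly_pderiv_add map_poly_pderiv_mult)+

lemma D_t_mult: "D_t (x * y) = D_t x * y + x * D_t y"
  unfolding D_t_def by (rule quotient_rule_mult) (rule map_poly_pderiv_mult)

lemma D_y_add: "D_y (x + y) = D_y x + D_y y"
  unfolding D_y_def by (rule quotient_rule_add) (rule pderiv_add pderiv_mult')+

lemma D_y_mult: "D_y (x * y) = D_y x * y + x * D_y y"
  unfolding D_y_def by (rule quotient_rule_mult) (rule pderiv_mult')

lemma to_fract_const_1 [simp]: "to_fract [:[:1::complex:]:] = 1" "to_fract [:1::complex poly:] = 1"
  by (simp_all only: one_pCons[symmetric] to_fract_1)

lemma D_t_Cst [simp]: "D_t (Cst c) = 0"
  and D_t_t_var [simp]: "D_t t_var = 1"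
  unfolding D_t_def Cst_def t_var_def y_var_def
  by (simp_all add: quotient_rule_to_fract map_poly_pderiv_mult map_poly_pCons pderiv_pCons)

lemma D_y_Cst [simp]: "D_y (Cst c) = 0"
  and D_y_t_var [simp]: "D_y t_var = 0"
  unfolding D_y_def Cst_def t_var_def y_var_def
  by (simp_all add: quotient_rule_to_fract pderiv_mult' pderiv_pCons)

lemma D_t_1 [simp]: "D_t 1 = 0" and D_y_1 [simp]: "D_y 1 = 0"
  using D_t_Cst[of 1] D_y_Cst[of 1] by simp_all

lemma D_t_0 [simp]: "D_t 0 = 0" and D_y_0 [simp]: "D_y 0 = 0"
  using D_t_Cst[of 0] D_y_Cst[of 0] by simp_all

lemma D_y_inverse_t_power [simp]: "D_y (inverse t_var ^ i) = 0"
proof -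
  have "D_y (t_var * inverse t_var) = 0" by simp
  then have "D_y (inverse t_var) = 0" by (simp only: D_y_mult) simp
  then show ?thesis by (induction i) (simp_all add: D_y_mult)
qed

section \<open>Twisted power series\<close>

lemma tps_nth_simps [simp]:
  "tps_nth 0 i n = 0"
  "tps_nth (f + g) i n = tps_nth f i n + tps_nth g i n"
  "tps_nth (f' - g') i n = tps_nth f' i n - tps_nth g' i n"
  "tps_nth (1 :: 'c::{ring, monoid_mult} tps) i n = (if i = 0 then 1 else 0)"
  "tps_nth (tps_const b) i n = (if i = 0 then b else 0)"
  "tps_nth (tps_map h k) i n = h (tps_nth k i n)"
  by (simp_all add: zero_tps_def plus_tps_def minus_tps_def one_tps_def tps_const_def tps_map_def)

lemma tps_nth_mult: "tps_nth (f * g) k n = (\<Sum>j=0..k. tps_nth f (k - j) (n + int j) * tps_nth g j n)"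
  by (simp add: times_tps_def)

lemma tps_nth_mult_0 [simp]: "tps_nth (f * g) 0 n = tps_nth f 0 n * tps_nth g 0 n"
  by (simp add: tps_nth_mult)

lemma tps_nth_const_mult [simp]: "tps_nth (tps_const b * f) i n = b * tps_nth f i n"
proof -
  have "tps_nth (tps_const b * f) i n = (\<Sum>j=0..i. if j = i then b * tps_nth f j n else 0)"
    unfolding tps_nth_mult by (intro sum.cong) auto
  then show ?thesis by simp
qed

lemma tps_nth_mult_const [simp]: "tps_nth (f * tps_const b) i n = tps_nth f i n * b"
proof -
  have "tps_nth (f * tps_const b) i n = (\<Sum>j=0..i. if j = 0 then tps_nth f i n * b else 0)"
    unfolding tps_nth_mult by (intro sum.cong) auto
  then show ?thesis by simp
qed

lemma tps_const_mult_commute: "tps_const b * f = f * tps_const (b :: 'a::comm_ring)"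
  by (rule tps_eqI) (simp add: mult.commute)

lemma tps_const_1: "tps_const 1 = 1"
  by (rule tps_eqI) simp

lemma tps_const_mult: "tps_const b * tps_const c = tps_const (b * c :: 'a::ring)"
  by (rule tps_eqI) simp

text \<open>
  A series fixed by \<open>\<Sigma>\<close> has coefficients with \<open>a\<^sub>i(n + j) = q\<^sup>-\<^sup>i\<^sup>j a\<^sub>i(n)\<close>. Hence the coefficient of \<open>X\<^sup>k\<close>
  in the product of two such series is the sum of \<open>q\<^sup>-\<^sup>i\<^sup>j a\<^sub>i(n) b\<^sub>j(n)\<close> over \<open>i + j = k\<close>, an expression
  symmetric in the two factors.
\<close>

lemma Sigma_fixed_commute:
  fixes f g :: "ratfun tps"
  assumes q: "q \<noteq> 0" and "tps_Sigma q Cst f = f" "tps_Sigma q Cst g = g"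
  shows "f * g = g * f"
proof (rule tps_eqI)
  have shift: "tps_nth h i (n + int m) = Cst (inverse q ^ (i * m)) * tps_nth h i n"
    if h: "tps_Sigma q Cst h = h" for h :: "ratfun tps" and i n m
  proof (induction m)
    case (Suc m)
    have "Cst (q ^ i) * tps_nth h i (n + int (Suc m)) = tps_nth (tps_Sigma q Cst h) i (n + int m)"
      by (simp add: tps_Sigma_def ac_simps)
    then have "Cst (q ^ i) * tps_nth h i (n + int (Suc m)) = Cst (inverse q ^ (i * m)) * tps_nth h i n"
      by (simp add: h Suc)
    then have "Cst (inverse q ^ i * q ^ i) * tps_nth h i (n + int (Suc m)) =
        Cst (inverse q ^ i * inverse q ^ (i * m)) * tps_nth h i n"
      by (simp only: Cst_mult mult.assoc)
    then show ?case
      using q by (simp add: power_inverse power_add mult.commute)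
  qed simp
  fix k n
  have "tps_nth (f * g) k n = (\<Sum>j=0..k. Cst (inverse q ^ ((k - j) * j)) * tps_nth f (k - j) n * tps_nth g j n)"
    by (simp add: tps_nth_mult shift assms)
  also have "\<dots> = (\<Sum>j=0..k. Cst (inverse q ^ (j * (k - j))) * tps_nth f j n * tps_nth g (k - j) n)"
    by (rule sum.reindex_bij_witness[where i = "(-) k" and j = "(-) k"]) auto
  also have "\<dots> = tps_nth (g * f) k n"
    by (simp add: tps_nth_mult shift assms ac_simps)
  finally show "tps_nth (f * g) k n = tps_nth (g * f) k n" .
qed

lemma tps_Sigma_mult: "tps_Sigma q Cst (f * g) = tps_Sigma q Cst f * tps_Sigma q Cst g"
proof (rule tps_eqI)
  fix k n
  have "Cst (q ^ k) * (x * y) = Cst (q ^ (k - j)) * x * (Cst (q ^ j) * y)" if "j \<le> k" for j x y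
  proof -
    have "Cst (q ^ k) = Cst (q ^ (k - j)) * Cst (q ^ j)"
      using that by (simp flip: Cst_mult power_add)
    then show ?thesis by simp
  qed
  then show "tps_nth (tps_Sigma q Cst (f * g)) k n = tps_nth (tps_Sigma q Cst f * tps_Sigma q Cst g) k n"
    unfolding tps_Sigma_def tps_nth_mult tps_nth_Tps sum_distrib_left
    by (intro sum.cong refl) (simp add: add_ac)
qed

section \<open>The universal Hopf morphism\<close>

locale q_generic =
  fixes q lq \<alpha> :: complex
  assumes log_q: "exp lq = q" and not_root_of_unity: "n > 0 \<Longrightarrow> q ^ n \<noteq> 1"
begin

lemma q_nonzero [simp]: "q \<noteq> 0"
  using log_q by auto

lemma q_neq_1 [simp]: "q \<noteq> 1"
  using not_root_of_unity[of 1] by simp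

lemma qpow_1 [simp]: "qpow lq 1 = q"
  by (simp add: qpow_def log_q)

lemma qpow_of_nat: "qpow lq (of_nat n) = q ^ n"
  by (induction n) (simp_all add: qpow_add)

lemma qint_eq: "qint q n = (q ^ n - 1) / (q - 1)"
proof -
  have "(q - 1) * qint q n = q ^ n - 1"
    by (simp add: qint_def power_diff_1_eq)
  then show ?thesis by (metis nonzero_mult_div_cancel_left right_minus_eq q_neq_1)
qed

lemma qint_Suc_nonzero [simp]: "qint q (Suc n) \<noteq> 0"
  using not_root_of_unity[of "Suc n"] by (simp add: qint_eq del: power_Suc)

lemma qfact_Suc: "qfact q (Suc n) = qfact q n * qint q (Suc n)"
  by (simp add: qfact_def)

lemma qfact_nonzero [simp]: "qfact q n \<noteq> 0"
  by (induction n) (simp_all add: qfact_Suc, simp add: qfact_def)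

lemma qbinom_nat_1: "qbinom_nat q (Suc i) (Suc 0) = qint q (Suc i)"
proof -
  have "qfact q (Suc 0) = 1" by (simp add: qfact_def qint_def)
  then show ?thesis by (simp add: qbinom_nat_def qfact_Suc)
qed

lemma qbinom_0 [simp]: "qbinom q lq \<beta> 0 = 1"
  by (simp add: qbinom_def qfact_def)

lemma qbinom_Suc: "qint q (Suc i) * qbinom q lq \<beta> (Suc i) = qnum q lq (\<beta> - of_nat i) * qbinom q lq \<beta> i"
  by (simp add: qbinom_def qfact_Suc)

abbreviation "\<sigma> \<equiv> sigma q lq \<alpha>"
abbreviation "\<theta>1 \<equiv> theta1 q lq \<alpha>"
abbreviation "\<iota>0 \<equiv> iota0 q lq \<alpha>"
abbreviation "Sig \<equiv> tps_Sigma q Cst"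
abbreviation "The1 \<equiv> tps_Theta q Cst 1"
abbreviation "GH \<equiv> galois_hull q lq \<alpha>"

lemmas sigma_hom = sigma_add[OF q_nonzero] sigma_mult[OF q_nonzero] sigma_Cst[OF q_nonzero]
lemmas sigma_int_hom = sigma_int_add[OF q_nonzero] sigma_int_mult[OF q_nonzero] sigma_int_Cst[OF q_nonzero]

lemma sigma_int_Cst_mult: "sigma_int q lq \<alpha> n (Cst c * a) = Cst c * sigma_int q lq \<alpha> n a"
  by (simp add: sigma_int_hom)

lemma sigma_diff: "\<sigma> (a - b) = \<sigma> a - \<sigma> b"
  using sigma_hom(1)[of lq \<alpha> "a - b" b] by (simp add: algebra_simps)

lemma sigma_divide: "\<sigma> (a / b) = \<sigma> a / \<sigma> b"
proof (cases "b = 0")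
  case False
  then have "\<sigma> b \<noteq> 0"
    using bij_sigma[OF q_nonzero, of lq \<alpha>] by (metis bij_pointE sigma_0)
  with False show ?thesis
    using sigma_hom(2)[of lq \<alpha> "a / b" b] by (simp add: field_simps)
qed simp

lemma theta1_add: "\<theta>1 (a + b) = \<theta>1 a + \<theta>1 b"
  by (simp add: theta1_def sigma_hom flip: add_divide_distrib)

lemma theta1_mult: "\<theta>1 (a * b) = \<sigma> a * \<theta>1 b + \<theta>1 a * b"
  by (simp add: theta1_def sigma_hom algebra_simps diff_divide_distrib)

lemma theta1_Cst [simp]: "\<theta>1 (Cst c) = 0"
  by (simp add: theta1_def sigma_hom)

lemma theta1_Cst_mult: "\<theta>1 (Cst c * a) = Cst c * \<theta>1 a"
  by (simp add: theta1_mult sigma_hom)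

lemma theta1_sigma: "\<theta>1 (\<sigma> a) = Cst q * \<sigma> (\<theta>1 a)"
  by (simp add: theta1_def sigma_divide sigma_diff sigma_hom sigma_t_var)

lemma theta1_pow_add: "(\<theta>1 ^^ i) (a + b) = (\<theta>1 ^^ i) a + (\<theta>1 ^^ i) b"
  by (induction i) (simp_all add: theta1_add)

lemma theta1_pow_sigma: "(\<theta>1 ^^ i) (\<sigma> a) = Cst (q ^ i) * \<sigma> ((\<theta>1 ^^ i) a)"
  by (induction i) (simp_all add: theta1_Cst_mult theta1_sigma Cst_mult)

lemma nth_iota0: "tps_nth (\<iota>0 a) i n = Cst (1 / qfact q i) * sigma_int q lq \<alpha> n ((\<theta>1 ^^ i) a)"
  by (simp add: iota0_def theta_def sigma_int_hom)

lemma iota0_add: "\<iota>0 (a + b) = \<iota>0 a + \<iota>0 b"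
  by (rule tps_eqI) (simp add: nth_iota0 theta1_pow_add sigma_int_hom distrib_left)

lemma Sigma_iota0: "Sig (\<iota>0 a) = \<iota>0 (\<sigma> a)"
  by (rule tps_eqI) (simp add: nth_iota0 tps_Sigma_def theta1_pow_sigma sigma_int_hom sigma_int_Suc)

lemma nth_Theta_1: "tps_nth (tps_Theta q s 1 f) i n = s (qint q (Suc i)) * tps_nth f (Suc i) n"
  by (simp add: tps_Theta_def qbinom_nat_1)

lemma Theta_iota0: "The1 (\<iota>0 a) = \<iota>0 (\<theta>1 a)"
proof (rule tps_eqI)
  fix i n
  have "Cst (qint q (Suc i)) * (Cst (1 / qfact q (Suc i)) * x) = Cst (1 / qfact q i) * x" for x
    by (simp add: qfact_Suc flip: mult.assoc Cst_mult)
  then show "tps_nth (The1 (\<iota>0 a)) i n = tps_nth (\<iota>0 (\<theta>1 a)) i n"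
    unfolding nth_Theta_1 nth_iota0 by (simp add: funpow_swap1)
qed

text \<open>
  \<open>\<Theta>\<^sup>(\<^sup>1\<^sup>)\<close> is a derivation twisted by \<open>\<Sigma>\<close>; this is \<open>[k]\<^sub>q = [k - j]\<^sub>q + q\<^sup>k\<^sup>-\<^sup>j [j]\<^sub>q\<close> in each
  term of the product.
\<close>

lemma Theta_mult: "The1 (f * g) = Sig f * The1 g + The1 f * g"
proof (rule tps_eqI)
  fix k n
  define F where "F j = tps_nth f (Suc k - j) (n + int j)" for j
  define G where "G j = tps_nth g j n" for j
  have split: "qint q (Suc k) = qint q (Suc k - j) + q ^ (Suc k - j) * qint q j" if "j \<le> Suc k" for j
  proof -
    have "q ^ Suc k = q ^ (Suc k - j) * q ^ j"
      using that by (simp flip: power_add del: power_Suc)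
    then show ?thesis
      by (simp add: qint_eq flip: add_divide_distrib del: power_Suc) (simp add: algebra_simps)
  qed
  have "tps_nth (The1 (f * g)) k n = (\<Sum>j=0..Suc k. Cst (qint q (Suc k)) * (F j * G j))"
    unfolding nth_Theta_1 tps_nth_mult F_def G_def sum_distrib_left ..
  also have "\<dots> = (\<Sum>j=0..Suc k. Cst (q ^ (Suc k - j)) * F j * (Cst (qint q j) * G j)) +
      (\<Sum>j=0..Suc k. Cst (qint q (Suc k - j)) * F j * G j)"
    unfolding sum.distrib[symmetric]
    by (intro sum.cong) (auto simp: split Cst_add Cst_mult algebra_simps simp del: power_Suc)
  also have "(\<Sum>j=0..Suc k. Cst (q ^ (Suc k - j)) * F j * (Cst (qint q j) * G j)) =
      (\<Sum>j=0..k. Cst (q ^ (k - j)) * F (Suc j) * (Cst (qint q (Suc j)) * G (Suc j)))"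
    unfolding sum.atLeast0_atMost_Suc_shift by (simp add: qint_def)
  also have "\<dots> = tps_nth (Sig f * The1 g) k n"
    unfolding tps_nth_mult nth_Theta_1 by (simp add: tps_Sigma_def F_def G_def ac_simps)
  also have "(\<Sum>j=0..Suc k. Cst (qint q (Suc k - j)) * F j * G j) =
      (\<Sum>j=0..k. Cst (qint q (Suc (k - j))) * F j * G j)"
    by (simp add: qint_def Suc_diff_le)
  also have "\<dots> = tps_nth (The1 f * g) k n"
    unfolding tps_nth_mult nth_Theta_1 by (simp add: F_def G_def Suc_diff_le)
  finally show "tps_nth (The1 (f * g)) k n = tps_nth (Sig f * The1 g + The1 f * g) k n" by simp
qed

text \<open>
  A series is determined by its coefficient of degree \<open>0\<close> and by its image under \<open>\<Theta>\<^sup>(\<^sup>1\<^sup>)\<close>, as no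
  \<open>[k]\<^sub>q\<close> with \<open>k > 0\<close> vanishes. So multiplicativity in degree \<open>k + 1\<close> follows from that in
  degree \<open>k\<close>, both sides of the identity satisfying the same twisted Leibniz rule.
\<close>

lemma iota0_mult: "\<iota>0 (a * b) = \<iota>0 a * \<iota>0 b"
proof (rule tps_eqI)
  fix k n
  show "tps_nth (\<iota>0 (a * b)) k n = tps_nth (\<iota>0 a * \<iota>0 b) k n"
  proof (induction k arbitrary: a b)
    case 0
    then show ?case by (simp add: nth_iota0 sigma_int_hom qfact_def)
  next
    case (Suc k)
    have "Cst (qint q (Suc k)) * tps_nth (\<iota>0 (a * b)) (Suc k) n = tps_nth (\<iota>0 (\<theta>1 (a * b))) k n"
      by (simp only: nth_Theta_1[symmetric] Theta_iota0)
    also have "\<dots> = tps_nth (\<iota>0 (\<sigma> a) * \<iota>0 (\<theta>1 b) + \<iota>0 (\<theta>1 a) * \<iota>0 b) k n"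
      by (simp add: theta1_mult iota0_add Suc)
    also have "\<dots> = tps_nth (The1 (\<iota>0 a * \<iota>0 b)) k n"
      by (simp add: Theta_mult Theta_iota0 Sigma_iota0 del: One_nat_def)
    finally show ?case
      unfolding nth_Theta_1 by simp
  qed
qed

lemma iota0_Cst: "\<iota>0 (Cst c) = tps_const (Cst c)"
proof (rule tps_eqI)
  fix i n
  have "(\<theta>1 ^^ i) 0 = 0" for i
    using theta1_Cst[of 0] by (induction i) simp_all
  then show "tps_nth (\<iota>0 (Cst c)) i n = tps_nth (tps_const (Cst c)) i n"
    using sigma_int_hom(3)[of lq \<alpha> n 0]
    by (cases i) (simp_all add: nth_iota0 sigma_int_hom qfact_def funpow_swap1)
qed

lemma iota0_1: "\<iota>0 1 = 1"
  using iota0_Cst[of 1] by (simp add: tps_const_1)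

lemma iota0_commute: "\<iota>0 a * \<iota>0 b = \<iota>0 b * \<iota>0 a"
  by (simp add: mult.commute flip: iota0_mult)

lemma theta1_t_var: "\<theta>1 t_var = 1"
proof -
  have "\<sigma> t_var - t_var = Cst (q - 1) * t_var"
    by (simp add: sigma_t_var Cst_diff algebra_simps)
  then show ?thesis by (simp add: theta1_def)
qed

lemma nth_iota0_t: "tps_nth (\<iota>0 t_var) i n =
  (if i = 0 then Cst (qpow lq (of_int n)) * t_var else if i = 1 then 1 else 0)"
proof -
  have *: "(\<theta>1 ^^ i) 0 = 0" "sigma_int q lq \<alpha> n 0 = 0" "sigma_int q lq \<alpha> n 1 = 1" for i
    using theta1_Cst[of 0] sigma_int_hom(3)[of lq \<alpha> n 0] sigma_int_hom(3)[of lq \<alpha> n 1]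
    by (induction i) simp_all
  have "sigma_int q lq \<alpha> n t_var = Cst (qpow lq (of_int n)) * t_var"
    using sigma_int_eigenvector[OF q_nonzero, of lq \<alpha> t_var 1 n] by (simp add: sigma_t_var)
  moreover have "\<theta>1 1 = 0" using theta1_Cst[of 1] by simp
  ultimately show ?thesis
    by (cases i rule: nat.exhaust[case_product nat.exhaust]; cases "i - 1")
       (auto simp: nth_iota0 qfact_def qint_def funpow_swap1 theta1_t_var *)
qed

lemma sigma_y_t: "\<sigma> (inverse t_var ^ i * y_var) = Cst (qpow lq (\<alpha> - of_nat i)) * (inverse t_var ^ i * y_var)"
proof (induction i)
  case 0
  then show ?case by (simp add: sigma_y_var)
next
  case (Suc i)
  have "\<sigma> (inverse t_var ^ Suc i * y_var) = \<sigma> (inverse t_var ^ i * y_var / t_var)"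
    by (simp add: field_simps)
  also have "\<dots> = Cst (qpow lq (\<alpha> - of_nat i) / q) * (inverse t_var ^ i * y_var / t_var)"
    by (simp add: sigma_divide Suc sigma_t_var Cst_divide)
  also have "qpow lq (\<alpha> - of_nat i) / q = qpow lq (\<alpha> - of_nat (Suc i))"
    using qpow_add[of lq "\<alpha> - of_nat (Suc i)" 1] by (simp add: field_simps)
  finally show ?case by (simp add: field_simps)
qed

lemma theta1_y_t: "\<theta>1 (inverse t_var ^ i * y_var) = Cst (qnum q lq (\<alpha> - of_nat i)) * (inverse t_var ^ Suc i * y_var)"
proof -
  have *: "(c * a - a) / (d * b) = ((c - 1) / d) * (inverse b * a)" for a b c d :: ratfun
    by (simp add: divide_inverse algebra_simps)
  have "Cst (qnum q lq (\<alpha> - of_nat i)) = (Cst (qpow lq (\<alpha> - of_nat i)) - 1) / Cst (q - 1)"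
    by (simp add: qnum_def Cst_divide Cst_diff[of _ 1])
  then show ?thesis
    unfolding theta1_def sigma_y_t * by (simp add: mult.assoc)
qed

lemma theta1_pow_y: "(\<theta>1 ^^ i) y_var = Cst (\<Prod>j<i. qnum q lq (\<alpha> - of_nat j)) * (inverse t_var ^ i * y_var)"
proof (induction i)
  case (Suc i)
  then show ?case
    by (simp add: theta1_Cst_mult theta1_y_t del: power_Suc) (simp add: Cst_mult)
qed simp

lemma iota0_y: "\<iota>0 y_var = Y0 q lq \<alpha> * tps_const y_var"
proof (rule tps_eqI)
  fix i n
  show "tps_nth (\<iota>0 y_var) i n = tps_nth (Y0 q lq \<alpha> * tps_const y_var) i n"
    unfolding nth_iota0 theta1_pow_y sigma_int_Cst_mult sigma_int_eigenvector[OF q_nonzero sigma_y_t]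
    by (simp add: Y0_def qbinom_def Cst_divide)
qed

lemma Y0_eq: "Y0 q lq \<alpha> = \<iota>0 y_var * tps_const (inverse y_var)"
  by (simp add: iota0_y mult.assoc tps_const_mult tps_const_1)

lemma Theta_mult_const: "The1 (f * tps_const b) = The1 f * tps_const b"
  by (rule tps_eqI) (simp add: nth_Theta_1 del: One_nat_def)

text \<open>
  The difference equation \<open>t \<theta>\<^sup>(\<^sup>1\<^sup>)(y) = [\<alpha>]\<^sub>q y\<close> of \<open>y = t\<^sup>\<alpha>\<close>, transported by \<open>\<iota>\<^sub>0\<close>. A deformation turns
  it into a recurrence for the coefficients of the image of \<open>Y\<^sub>0\<close>.
\<close>

lemma Theta_Y0: "\<iota>0 t_var * The1 (Y0 q lq \<alpha>) = tps_const (Cst (qnum q lq \<alpha>)) * Y0 q lq \<alpha>"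
proof -
  have "t_var * \<theta>1 y_var = Cst (qnum q lq \<alpha>) * y_var"
    using theta1_y_t[of 0] by simp
  then have "\<iota>0 t_var * \<iota>0 (\<theta>1 y_var) = tps_const (Cst (qnum q lq \<alpha>)) * \<iota>0 y_var"
    by (metis iota0_mult iota0_Cst)
  then show ?thesis
    unfolding Y0_eq Theta_mult_const Theta_iota0 mult.assoc[symmetric] by simp
qed

lemma Sigma_const: "Sig (tps_const b) = tps_const b"
  by (rule tps_eqI) (simp add: tps_Sigma_def)

lemma Sigma_Y0: "Sig (Y0 q lq \<alpha>) = tps_const (Cst (qpow lq \<alpha>)) * Y0 q lq \<alpha>"
  by (simp add: Y0_eq tps_Sigma_mult Sigma_iota0 sigma_y_var Sigma_const iota0_mult iota0_Cst mult.assoc)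

lemma Sigma_iota0_t: "Sig (\<iota>0 t_var) = tps_const (Cst q) * \<iota>0 t_var"
  by (simp add: Sigma_iota0 sigma_t_var iota0_mult iota0_Cst)

lemma iota0_t_Y0_commute: "\<iota>0 t_var * Y0 q lq \<alpha> = Y0 q lq \<alpha> * \<iota>0 t_var"
  unfolding Y0_eq by (simp only: mult.assoc tps_const_mult_commute[of _ "\<iota>0 t_var"])
    (simp only: iota0_commute[of t_var] flip: mult.assoc)

lemma D_y_Y0: "tps_map D_y (Y0 q lq \<alpha>) = 0"
  by (rule tps_eqI) (simp add: Y0_def D_y_mult)

lemma Theta_iota0_t: "The1 (\<iota>0 t_var) = 1"
  by (simp only: Theta_iota0 theta1_t_var iota0_1)

lemma D_y_iota0_t: "tps_map D_y (\<iota>0 t_var) = 0"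
  by (rule tps_eqI) (simp add: nth_iota0_t D_y_mult)

lemma D_t_D_t_iota0_t: "tps_map D_t (tps_map D_t (\<iota>0 t_var)) = 0"
  by (rule tps_eqI) (simp add: nth_iota0_t D_t_mult)

text \<open>
  As \<open>\<partial>\<iota>\<^sub>0(t)/\<partial>t = Q\<close>, the hull contains \<open>X\<close> and \<open>Q\<close>. A deformation sends them to \<open>f Q + X\<close> and \<open>e Q\<close>,
  so their commutation relation is the source of \<open>e f = q f e\<close>.
\<close>

lemma tps_X_eq: "tps_X = \<iota>0 t_var - tps_const t_var * tps_map D_t (\<iota>0 t_var)"
  by (rule tps_eqI) (simp add: nth_iota0_t D_t_mult tps_X_def)

lemma Q_X_commute:
  defines "Q \<equiv> tps_map D_t (\<iota>0 t_var)"
  shows "Q * tps_X = tps_const (Cst q) * (tps_X * Q)"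
proof (rule tps_eqI)
  fix k n
  have Q: "tps_nth Q i m = (if i = 0 then Cst (qpow lq (of_int m)) else 0)" for i m
    by (simp add: Q_def nth_iota0_t D_t_mult)
  have "tps_nth (Q * tps_X) k n = (\<Sum>j=0..k. if j = k then Cst (qpow lq (of_int (n + int j))) * tps_nth tps_X j n else 0)"
    unfolding tps_nth_mult by (intro sum.cong) (auto simp: Q)
  moreover have "tps_nth (tps_X * Q) k n = (\<Sum>j=0..k. if j = 0 then tps_nth tps_X k n * Cst (qpow lq (of_int n)) else 0)"
    unfolding tps_nth_mult by (intro sum.cong) (auto simp: Q tps_X_def)
  ultimately show "tps_nth (Q * tps_X) k n = tps_nth (tps_const (Cst q) * (tps_X * Q)) k n"
    by (auto simp: tps_X_def qpow_add Cst_mult)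
qed

lemma iota0_inverse_t: "\<iota>0 t_var * \<iota>0 (inverse t_var) = 1" "\<iota>0 (inverse t_var) * \<iota>0 t_var = 1"
  by (simp_all add: iota0_1 flip: iota0_mult)

section \<open>Elements of the Galois hull\<close>

lemma hull_1: "1 \<in> GH"
  using galois_hull.const[of 1] by (simp add: tps_const_1)

lemma hull_Y0: "Y0 q lq \<alpha> \<in> GH"
  unfolding Y0_eq by (intro galois_hull.intros)

lemma hull_X: "tps_X \<in> GH"
  unfolding tps_X_eq by (intro galois_hull.intros)

text \<open>
  The logarithmic derivative \<open>\<partial>Y\<^sub>0/\<partial>t \<cdot> Y\<^sub>0\<^sup>-\<^sup>1\<close>, where \<open>Y\<^sub>0\<^sup>-\<^sup>1 = \<iota>\<^sub>0(1/y) y\<close>. As \<open>\<Sigma>\<close> multiplies \<open>Y\<^sub>0\<close> by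
  \<open>q\<^sup>\<alpha>\<close> and \<open>Y\<^sub>0\<^sup>-\<^sup>1\<close> by \<open>q\<^sup>-\<^sup>\<alpha>\<close>, it is fixed by \<open>\<Sigma>\<close>.
\<close>

definition logder :: "ratfun tps" where
  "logder = tps_map D_t (Y0 q lq \<alpha>) * (\<iota>0 (inverse y_var) * tps_const y_var)"

lemma hull_logder: "logder \<in> GH"
  unfolding logder_def by (intro galois_hull.intros hull_Y0)

lemma Sigma_D_t: "Sig (tps_map D_t f) = tps_map D_t (Sig f)"
  by (rule tps_eqI) (simp add: tps_Sigma_def D_t_mult)

lemma Sigma_logder: "Sig logder = logder"
proof -
  have D: "tps_map D_t (tps_const (Cst c) * f) = tps_const (Cst c) * tps_map D_t f" for c f
    by (rule tps_eqI) (simp add: D_t_mult)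
  have "\<sigma> (inverse y_var) = Cst (inverse (qpow lq \<alpha>)) * inverse y_var"
    using sigma_divide[of 1 y_var] by (simp add: sigma_y_var Cst_divide inverse_eq_divide)
  then have y: "\<iota>0 (\<sigma> (inverse y_var)) = tps_const (Cst (inverse (qpow lq \<alpha>))) * \<iota>0 (inverse y_var)"
    by (simp add: iota0_mult iota0_Cst)
  have c: "tps_const (Cst c) * f * (tps_const (Cst (inverse c)) * g) = f * g" if "c \<noteq> 0" for c f g
  proof -
    have "tps_const (Cst c) * f * (tps_const (Cst (inverse c)) * g) =
        tps_const (Cst c) * tps_const (Cst (inverse c)) * (f * g)"
      unfolding mult.assoc by (simp only: mult.assoc[symmetric] tps_const_mult_commute[of _ f])
    with that show ?thesis by (simp add: tps_const_mult tps_const_1 flip: Cst_mult)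
  qed
  show ?thesis
    unfolding logder_def tps_Sigma_mult Sigma_D_t Sigma_Y0 D Sigma_iota0 Sigma_const y mult.assoc[of _ _ "tps_const y_var"]
    by (rule c) simp
qed

lemma logder_commute: "logder * tps_map D_t logder = tps_map D_t logder * logder"
  by (rule Sigma_fixed_commute[OF q_nonzero]) (simp_all add: Sigma_D_t Sigma_logder)

end

section \<open>Power series over an algebra\<close>

lemma fps_map_nth [simp]: "fps_map h f $ n = h (f $ n)"
  by (simp add: fps_map_def)

lemma map_W_nth [simp]: "map_W h F $ m $ n = h (F $ m $ n)"
  by (simp add: map_W_def)

lemma fps2_eqI: "(\<And>m n. F $ m $ n = G $ m $ n) \<Longrightarrow> F = G"
  by (intro fps_ext)

lemma fps_diff_nth: "fps_diff f $ n = (\<Sum>_<n + 1. f $ (n + 1))"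
  by (simp add: fps_diff_def)

lemma D_W1_nth: "D_W1 F $ m $ n = (\<Sum>_<n + 1. F $ m $ (n + 1))"
  by (simp add: D_W1_def fps_diff_nth)

lemma D_W2_nth: "D_W2 F $ m $ n = (\<Sum>_<m + 1. F $ (m + 1) $ n)"
  by (simp add: D_W2_def fps_diff_nth fps_sum_nth)

lemma const_W_nth [simp]: "const_W a $ m $ n = (if m = 0 \<and> n = 0 then a else 0)"
  by (simp add: const_W_def)

lemma const_W_mult_nth [simp]: "(const_W (a::'a::ring) * F) $ m $ n = a * F $ m $ n"
  by (simp add: const_W_def)

lemma mult_const_W_nth [simp]: "(F * const_W (a::'a::ring)) $ m $ n = F $ m $ n * a"
  by (simp add: const_W_def)

lemma W1_nth [simp]: "W1 $ m $ n = (if m = 0 \<and> n = 1 then 1 else 0)"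
  by (simp add: W1_def)

definition is_ring_hom :: "('c::{ring, monoid_mult} \<Rightarrow> 'd::{ring, monoid_mult}) \<Rightarrow> bool" where
  "is_ring_hom h \<longleftrightarrow> (\<forall>x y. h (x + y) = h x + h y) \<and> (\<forall>x y. h (x * y) = h x * h y) \<and> h 1 = 1"

lemma is_ring_homD:
  assumes "is_ring_hom h"
  shows "h (x + y) = h x + h y" "h (x * y) = h x * h y" "h 1 = 1" "h 0 = 0" "h (x - y) = h x - h y"
    "h (x ^ n) = h x ^ n" "h (sum f S) = (\<Sum>i\<in>S. h (f i))"
proof -
  show a: "h (x + y) = h x + h y" "h (x * y) = h x * h y" "h 1 = 1" for x y
    using assms by (auto simp: is_ring_hom_def)
  show 0: "h 0 = 0"
    using a(1)[of 0 0] by simp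
  show "h (x - y) = h x - h y"
    using a(1)[of "x - y" y] by (simp add: algebra_simps)
  show "h (x ^ n) = h x ^ n"
    by (induction n) (simp_all add: a)
  show "h (sum f S) = (\<Sum>i\<in>S. h (f i))"
    by (induction S rule: infinite_finite_induct) (simp_all add: a 0)
qed

lemma is_ring_hom_fps_map:
  assumes "is_ring_hom h"
  shows "is_ring_hom (fps_map h)"
  unfolding is_ring_hom_def
  by (auto simp: fps_eq_iff fps_mult_nth is_ring_homD[OF assms])

lemma is_ring_hom_map_W: "is_ring_hom h \<Longrightarrow> is_ring_hom (map_W h)"
  unfolding map_W_def by (intro is_ring_hom_fps_map)

lemma is_ring_hom_tps_map:
  assumes "is_ring_hom h"
  shows "is_ring_hom (tps_map h)"
  unfolding is_ring_hom_def
  by (auto intro!: tps_eqI simp: tps_nth_mult is_ring_homD[OF assms])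

lemma nilpotent_hom:
  assumes "is_ring_hom h" "nilpotent x"
  shows "nilpotent (h x)"
proof -
  obtain k where "x ^ k = 0" using assms(2) by (auto simp: nilpotent_def)
  then have "h x ^ k = 0" using is_ring_homD(4,6)[OF assms(1)] by metis
  then show ?thesis by (auto simp: nilpotent_def)
qed

lemma two_sided_inverse_eq:
  assumes "x * z = 1" "z * x = 1"
  shows "two_sided_inverse x = z"
  unfolding two_sided_inverse_def
proof (rule the_equality)
  fix z' assume z': "x * z' = 1 \<and> z' * x = 1"
  have "z' = z * x * z'" using assms by simp
  also have "\<dots> = z" using z' by (simp add: mult.assoc)
  finally show "z' = z" .
qed (use assms in simp)

locale nc_alg =
  fixes \<eta> :: "ratfun \<Rightarrow> 'a::{ring, monoid_mult}"
  assumes nc: "nc_algebra \<eta>"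
begin

lemma hom_eta: "is_ring_hom \<eta>"
  using nc unfolding nc_algebra_def is_ring_hom_def by (intro conjI) (elim conjE, assumption)+

lemma eta_central: "\<eta> a * x = x * \<eta> a"
  using nc unfolding nc_algebra_def by blast

lemma eta_left_commute: "x * (\<eta> a * y) = \<eta> a * (x * y)"
  unfolding mult.assoc[symmetric] eta_central[of a x] ..

lemmas eta_hom = is_ring_homD[OF hom_eta]

lemma eta_Cst_cancel:
  assumes "c \<noteq> 0" "\<eta> (Cst c) * x = \<eta> (Cst c) * y"
  shows "x = y"
proof -
  have "\<eta> (Cst (inverse c)) * (\<eta> (Cst c) * x) = \<eta> (Cst (inverse c)) * (\<eta> (Cst c) * y)"
    using assms by simp
  then show ?thesis
    using assms(1) by (simp add: eta_hom(3) flip: mult.assoc eta_hom(2) Cst_mult)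
qed

lemma sum_const_eta: "(\<Sum>_<(n::nat). x) = \<eta> (Cst (of_nat n)) * x"
  by (induction n) (simp_all add: eta_hom Cst_add algebra_simps)

text \<open>\<open>A\<close> has no torsion, being an algebra over \<open>\<complex>\<close>; so vanishing derivatives annihilate coefficients.\<close>

lemma sum_const_cancel:
  fixes x y :: 'a
  assumes "(\<Sum>_<n + 1. x) = (\<Sum>_<(n::nat) + 1. y)"
  shows "x = y"
proof -
  have "(of_nat (n + 1) :: complex) \<noteq> 0" by (simp only: of_nat_eq_0_iff)
  with assms show ?thesis
    unfolding sum_const_eta by (rule eta_Cst_cancel[rotated])
qed

abbreviation "s \<equiv> scalar_W \<eta>"

lemma s_nth [simp]: "(s c * F) $ m $ n = \<eta> (Cst c) * F $ m $ n"
  by (simp add: scalar_W_def)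

lemma s_mult: "s (c * d) = s c * s d" and s_1 [simp]: "s 1 = 1"
  by (rule fps2_eqI, simp add: scalar_W_def eta_hom Cst_mult)
     (rule fps2_eqI, simp add: scalar_W_def eta_hom)

lemma s_central: "s c * F = F * s c"
  by (rule fps2_eqI) (simp add: scalar_W_def eta_central)

lemma s_left_commute: "F * (s c * G) = s c * (F * G)"
  unfolding mult.assoc[symmetric] s_central[of c F] ..

lemma s_cancel:
  assumes "c \<noteq> 0" "s c * F = s c * G"
  shows "F = G"
proof -
  have "s (inverse c * c) * F = s (inverse c * c) * G"
    using assms by (simp only: s_mult mult.assoc)
  then show ?thesis using assms(1) by simp
qed

text \<open>
  By this, compatibility with \<open>\<Sigma>\<close> leaves only the value at \<open>n = 0\<close> of a coefficient function free.
\<close>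

lemma Sigma_recurrence:
  assumes "\<And>n. F (n + 1) = s (qpow lq \<beta>) * F n"
  shows "F n = s (qpow lq (of_int n * \<beta>)) * F 0"
proof (induction n rule: int_induct[where k = 0])
  case (step1 n)
  have "of_int (n + 1) * \<beta> = \<beta> + of_int n * \<beta>"
    by (simp add: algebra_simps)
  then show ?case by (simp only: assms step1 qpow_add s_mult mult.assoc)
next
  case (step2 n)
  have "s (qpow lq \<beta>) * F (n - 1) = s (qpow lq (\<beta> + of_int (n - 1) * \<beta>)) * F 0"
    using assms[of "n - 1"] step2(2) by (simp add: algebra_simps)
  then show ?case
    unfolding qpow_add s_mult mult.assoc by (rule s_cancel[rotated]) simp
qed simp

lemma affine_t_nth: "affine_t \<eta> e f $ n = (if n = 0 then e * \<eta> t_var + f else if n = 1 then e else 0)"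
  by (simp add: affine_t_def)

lemma affine_t_inject: "affine_t \<eta> e f = affine_t \<eta> h k \<longleftrightarrow> e = h \<and> f = k"
proof
  assume *: "affine_t \<eta> e f = affine_t \<eta> h k"
  show "e = h \<and> f = k"
    using arg_cong[OF *, of "\<lambda>x. x $ 1"] arg_cong[OF *, of "\<lambda>x. x $ 0"] by (simp add: affine_t_nth)
qed simp

end

section \<open>The Taylor morphism on generators\<close>

lemma D_pow_0 [simp]: "(D_t ^^ n) 0 = 0" "(D_y ^^ n) 0 = 0"
  by (induction n) simp_all

lemma taylor_0: "taylor 0 = 0"
  by (rule fps2_eqI) (simp add: taylor_def)

lemma taylor_1: "taylor 1 = 1"
proof (rule fps2_eqI)
  fix m n
  show "taylor 1 $ m $ n = 1 $ m $ n"
    by (cases m; cases n) (simp_all add: taylor_def funpow_swap1)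
qed

lemma taylor_t_var: "taylor t_var = const_W t_var + W1"
proof (rule fps2_eqI)
  fix m n
  show "taylor t_var $ m $ n = (const_W t_var + W1) $ m $ n"
    by (cases m; cases n; cases "n - 1") (auto simp: taylor_def funpow_swap1)
qed

section \<open>The parameters of a deformation\<close>

locale deformation = q_generic q lq \<alpha> + nc_alg \<eta>
  for q lq \<alpha> :: complex and \<eta> :: "ratfun \<Rightarrow> 'a::{ring, monoid_mult}" +
  fixes \<phi> :: "ratfun tps \<Rightarrow> 'a fps fps tps"
  assumes phi: "\<phi> \<in> NCF q lq \<alpha> \<eta>"
begin

lemma phi_1: "\<phi> 1 = 1"
  and phi_add: "x \<in> GH \<Longrightarrow> x' \<in> GH \<Longrightarrow> \<phi> (x + x') = \<phi> x + \<phi> x'"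
  and phi_mult: "x \<in> GH \<Longrightarrow> x' \<in> GH \<Longrightarrow> \<phi> (x * x') = \<phi> x * \<phi> x'"
  and phi_scalar: "x \<in> GH \<Longrightarrow> \<phi> (tps_const (Cst c) * x) = tps_const (s c) * \<phi> x"
  and phi_Sigma: "x \<in> GH \<Longrightarrow> \<phi> (Sig x) = tps_Sigma q s (\<phi> x)"
  and phi_Theta: "x \<in> GH \<Longrightarrow> \<phi> (tps_Theta q Cst l x) = tps_Theta q s l (\<phi> x)"
  and phi_D_t: "x \<in> GH \<Longrightarrow> \<phi> (tps_map D_t x) = tps_map D_W1 (\<phi> x)"
  and phi_D_y: "x \<in> GH \<Longrightarrow> \<phi> (tps_map D_y x) = tps_map D_W2 (\<phi> x)"
  and phi_const: "\<phi> (tps_const a) = canonical \<eta> (tps_const a)"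
  and phi_extensional: "\<phi> \<in> extensional GH"
  using phi unfolding NCF_def by simp_all

lemma phi_nilpotent:
  assumes "x \<in> GH"
  shows "nilpotent ((tps_nth (\<phi> x) i n - map_W \<eta> (taylor (tps_nth x i n))) $ m $ k)"
proof -
  have "\<forall>c \<in> fps2_coeffs (tps_nth (\<phi> x - canonical \<eta> x) i n). nilpotent c"
    using phi assms unfolding NCF_def by simp
  moreover have "F $ m $ k \<in> fps2_coeffs F" for F :: "'a fps fps"
    by (auto simp: fps2_coeffs_def)
  ultimately have "nilpotent (tps_nth (\<phi> x - canonical \<eta> x) i n $ m $ k)"
    by blast
  then show ?thesis
    by (simp add: canonical_def)
qed

lemma phi_diff: "x \<in> GH \<Longrightarrow> x' \<in> GH \<Longrightarrow> \<phi> (x - x') = \<phi> x - \<phi> x'"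
  using phi_add[of "x - x'" x'] galois_hull.diff[of x q lq \<alpha> x'] by (simp add: algebra_simps)

lemma phi_0: "\<phi> 0 = 0"
  using phi_diff[OF hull_1 hull_1] by simp

text \<open>
  Evaluation at \<open>X = 0\<close>, \<open>n = 0\<close> and \<open>W\<^sub>2 = 0\<close> is compatible with sums, products and \<open>\<partial>/\<partial>W\<^sub>1\<close>, so that
  relations in the hull turn into relations in \<open>A[[W\<^sub>1]]\<close>. The images of \<open>\<iota>\<^sub>0(t)\<close> and \<open>Y\<^sub>0\<close> can be
  recovered from their values under it.
\<close>

definition base :: "ratfun tps \<Rightarrow> 'a fps" where
  "base x = tps_nth (\<phi> x) 0 0 $ 0"

lemma base_mult: "x \<in> GH \<Longrightarrow> x' \<in> GH \<Longrightarrow> base (x * x') = base x * base x'"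
  and base_diff: "x \<in> GH \<Longrightarrow> x' \<in> GH \<Longrightarrow> base (x - x') = base x - base x'"
  and base_1: "base 1 = 1"
  and base_D_t: "x \<in> GH \<Longrightarrow> base (tps_map D_t x) = fps_diff (base x)"
  by (simp_all add: base_def phi_mult phi_diff phi_1 phi_D_t D_W1_def)

lemma base_t_var: "base (tps_const t_var) = fps_const (\<eta> t_var) + fps_X"
  by (rule fps_ext) (simp add: base_def phi_const canonical_def taylor_t_var eta_hom)

lemma base_scalar: "x \<in> GH \<Longrightarrow> base (tps_const (Cst c) * x) = fps_const (\<eta> (Cst c)) * base x"
  by (rule fps_ext) (simp add: base_def phi_scalar scalar_W_def const_W_def)

lemma base_Cst: "base (tps_const (Cst c)) = fps_const (\<eta> (Cst c))"
  using base_scalar[OF hull_1, of c] by (simp add: base_1)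

definition "par_e = base (\<iota>0 t_var) $ 1"
definition "par_f = base (\<iota>0 t_var) $ 0 - par_e * \<eta> t_var"
definition "par_b = base (Y0 q lq \<alpha>)"

abbreviation "aff \<equiv> affine_t \<eta> par_e par_f"

lemma phi_D_W2_constant:
  assumes x: "x \<in> GH" "tps_map D_y x = 0"
  shows "tps_nth (\<phi> x) 0 0 = fps_const (base x)"
proof (rule fps2_eqI)
  fix m n
  have "tps_map D_W2 (\<phi> x) = 0"
    using phi_D_y[OF x(1)] x(2) by (simp add: phi_0)
  then have "D_W2 (tps_nth (\<phi> x) 0 0) = 0"
    using tps_nth_simps(6)[of D_W2 "\<phi> x" 0 0] by simp
  then have "(\<Sum>_<m' + 1. tps_nth (\<phi> x) 0 0 $ (m' + 1) $ n) = (\<Sum>_<m' + 1. 0)" for m'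
    unfolding D_W2_nth[symmetric] by simp
  then have "tps_nth (\<phi> x) 0 0 $ (m' + 1) $ n = 0" for m'
    by (rule sum_const_cancel)
  then show "tps_nth (\<phi> x) 0 0 $ m $ n = fps_const (base x) $ m $ n"
    by (cases m) (simp_all add: base_def)
qed

text \<open>
  The second derivative of \<open>\<iota>\<^sub>0(t) = t Q + X\<close> in \<open>t\<close> vanishes, so its image is affine in \<open>W\<^sub>1\<close>.
\<close>

lemma base_iota0_t: "base (\<iota>0 t_var) = aff"
proof (rule fps_ext)
  fix n
  have "base (tps_map D_t (tps_map D_t (\<iota>0 t_var))) = base 0"
    by (simp only: D_t_D_t_iota0_t)
  then have "fps_diff (fps_diff (base (\<iota>0 t_var))) = 0"
    by (simp add: base_D_t galois_hull.intros) (simp add: base_def phi_0)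
  then have "(\<Sum>_<m + 1. fps_diff (base (\<iota>0 t_var)) $ (m + 1)) = (\<Sum>_<m + 1. 0)" for m
    unfolding fps_diff_nth[symmetric] by simp
  then have "fps_diff (base (\<iota>0 t_var)) $ (m + 1) = 0" for m
    by (rule sum_const_cancel)
  then have "(\<Sum>_<m + 1 + 1. base (\<iota>0 t_var) $ (m + 1 + 1)) = (\<Sum>_<m + 1 + 1. 0)" for m
    unfolding fps_diff_nth[symmetric] by simp
  then have "base (\<iota>0 t_var) $ (m + 1 + 1) = 0" for m
    by (rule sum_const_cancel)
  then show "base (\<iota>0 t_var) $ n = aff $ n"
    by (cases n; cases "n - 1") (auto simp: affine_t_nth par_e_def par_f_def)
qed

text \<open>\<open>\<Theta>\<^sup>(\<^sup>1\<^sup>)\<close> fixes the coefficients in positive degree, \<open>\<Sigma>\<close> the dependence on \<open>n\<close> in degree \<open>0\<close>.\<close>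

lemma nth_phi_iota0_t:
  "tps_nth (\<phi> (\<iota>0 t_var)) i n =
    (if i = 0 then s (qpow lq (of_int n)) * fps_const aff else if i = 1 then 1 else 0)"
proof -
  note mem = galois_hull.iota0[of q lq \<alpha> t_var]
  have "tps_Theta q s 1 (\<phi> (\<iota>0 t_var)) = 1"
    using phi_Theta[OF mem, of 1] by (simp only: Theta_iota0_t phi_1)
  then have "tps_nth (tps_Theta q s 1 (\<phi> (\<iota>0 t_var))) i n = (if i = 0 then 1 else 0)" for i n
    by (simp only: tps_nth_simps)
  then have *: "s (qint q (Suc i)) * tps_nth (\<phi> (\<iota>0 t_var)) (Suc i) n = (if i = 0 then 1 else 0)" for i n
    by (simp only: nth_Theta_1)
  have 1: "tps_nth (\<phi> (\<iota>0 t_var)) 1 n = 1"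
    using *[of 0 n] by (simp add: qint_def)
  have 2: "tps_nth (\<phi> (\<iota>0 t_var)) (Suc (Suc i)) n = 0" for i
    by (rule s_cancel[OF qint_Suc_nonzero[of "Suc i"]]) (simp add: *)
  have "\<phi> (Sig (\<iota>0 t_var)) = tps_const (s q) * \<phi> (\<iota>0 t_var)"
    by (simp add: Sigma_iota0_t phi_scalar mem)
  then have "tps_nth (tps_Sigma q s (\<phi> (\<iota>0 t_var))) 0 m = s q * tps_nth (\<phi> (\<iota>0 t_var)) 0 m" for m
    by (simp add: phi_Sigma mem)
  then have "tps_nth (\<phi> (\<iota>0 t_var)) 0 (m + 1) = s (qpow lq 1) * tps_nth (\<phi> (\<iota>0 t_var)) 0 m" for m
    by (simp add: tps_Sigma_def)
  from Sigma_recurrence[of "tps_nth (\<phi> (\<iota>0 t_var)) 0", OF this, of n]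
  have 0: "tps_nth (\<phi> (\<iota>0 t_var)) 0 n = s (qpow lq (of_int n)) * fps_const aff"
    by (simp add: phi_D_W2_constant[OF mem D_y_iota0_t] base_iota0_t)
  show ?thesis
    using 0 1 2[of "i - 2"] by (cases i rule: nat.exhaust; cases "i - 1") auto
qed

text \<open>The inverse is supplied by the image of \<open>\<iota>\<^sub>0(1/t)\<close>.\<close>

lemma aff_inverse:
  obtains w where "aff * w = 1" "w * aff = 1" "two_sided_inverse aff = w"
proof -
  let ?w = "base (\<iota>0 (inverse t_var))"
  have "aff * ?w = 1" "?w * aff = 1"
    unfolding base_iota0_t[symmetric]
    by (simp_all add: galois_hull.intros iota0_inverse_t base_1 flip: base_mult)
  then show ?thesis
    using two_sided_inverse_eq that by blast
qed

lemma nth_phi_Y0: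
  "tps_nth (\<phi> (Y0 q lq \<alpha>)) k n = s (qbinom q lq \<alpha> k) * fps_const (two_sided_inverse aff ^ k)
    * s (qpow lq (of_int n * (\<alpha> - of_nat k))) * fps_const par_b"
proof -
  define V where "V = tps_nth (\<phi> (Y0 q lq \<alpha>))"
  obtain w where w: "aff * w = 1" "w * aff = 1" "two_sided_inverse aff = w"
    by (rule aff_inverse)
  note mem = hull_Y0 galois_hull.iota0[of q lq \<alpha> t_var]
  have "\<phi> (Sig (Y0 q lq \<alpha>)) = tps_const (s (qpow lq \<alpha>)) * \<phi> (Y0 q lq \<alpha>)"
    by (simp add: Sigma_Y0 phi_scalar mem)
  then have "tps_nth (tps_Sigma q s (\<phi> (Y0 q lq \<alpha>))) 0 m = s (qpow lq \<alpha>) * V 0 m" for m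
    by (simp add: phi_Sigma mem V_def)
  then have "V 0 (m + 1) = s (qpow lq \<alpha>) * V 0 m" for m
    by (simp add: tps_Sigma_def V_def)
  from Sigma_recurrence[of "V 0", OF this, of n]
  have V0: "V 0 n = s (qpow lq (of_int n * \<alpha>)) * fps_const par_b"
    by (simp add: phi_D_W2_constant[OF hull_Y0 D_y_Y0] V_def par_b_def)
  \<comment> \<open>comparison of the coefficients of \<open>X\<^sup>k\<close> in the difference equation; \<open>[\<alpha>] - [k] = q\<^sup>k [\<alpha> - k]\<close>\<close>
  have step: "s (q ^ k * qpow lq (of_int n)) * fps_const aff * (s (qint q (Suc k)) * V (Suc k) n) =
      s (q ^ k * qnum q lq (\<alpha> - of_nat k)) * V k n" for k
  proof -
    have "\<phi> (\<iota>0 t_var) * tps_Theta q s 1 (\<phi> (Y0 q lq \<alpha>)) = tps_const (s (qnum q lq \<alpha>)) * \<phi> (Y0 q lq \<alpha>)"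
      using arg_cong[OF Theta_Y0, of \<phi>] mem
      by (simp only: phi_mult phi_Theta phi_scalar galois_hull.Theta)
    then have A: "tps_nth (\<phi> (\<iota>0 t_var) * tps_Theta q s 1 (\<phi> (Y0 q lq \<alpha>))) k n = s (qnum q lq \<alpha>) * V k n"
      by (simp only: V_def tps_nth_const_mult)
    have B: "tps_nth (\<phi> (\<iota>0 t_var) * tps_Theta q s 1 (\<phi> (Y0 q lq \<alpha>))) k n =
        s (q ^ k * qpow lq (of_int n)) * fps_const aff * (s (qint q (Suc k)) * V (Suc k) n) + s (qint q k) * V k n"
    proof -
      let ?T = "\<lambda>j. tps_nth (\<phi> (\<iota>0 t_var)) (k - j) (n + int j) * (s (qint q (Suc j)) * V (Suc j) n)"
      have e: "tps_nth (\<phi> (\<iota>0 t_var) * tps_Theta q s 1 (\<phi> (Y0 q lq \<alpha>))) k n = (\<Sum>j=0..k. ?T j)"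
        unfolding tps_nth_mult nth_Theta_1 V_def ..
      have last: "?T k = s (q ^ k * qpow lq (of_int n)) * fps_const aff * (s (qint q (Suc k)) * V (Suc k) n)"
        by (simp add: nth_phi_iota0_t qpow_add qpow_of_nat mult.commute)
      show ?thesis
      proof (cases k)
        case 0
        then show ?thesis unfolding e using last by (simp add: qint_def scalar_W_def const_W_def eta_hom)
      next
        case (Suc k')
        have "(\<Sum>j=0..k. ?T j) = (\<Sum>j=0..k'. ?T j) + ?T k"
          by (simp add: Suc)
        also have "(\<Sum>j=0..k'. ?T j) = (\<Sum>j=0..k'. if j = k' then s (qint q k) * V k n else 0)"
          by (rule sum.cong) (auto simp: nth_phi_iota0_t Suc)
        finally show ?thesis unfolding e last by simp
      qed
    qed
    have C: "q ^ k * qnum q lq (\<alpha> - of_nat k) = qnum q lq \<alpha> - qint q k"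
    proof -
      have "q ^ k * qpow lq (\<alpha> - of_nat k) = qpow lq \<alpha>"
        by (simp add: qpow_add[symmetric] flip: qpow_of_nat)
      then show ?thesis
        by (simp add: qnum_def qint_eq right_diff_distrib flip: diff_divide_distrib)
    qed
    have D: "s (c - d) * F = s c * F - s d * F" for c d F
      by (rule fps2_eqI) (simp add: eta_hom Cst_diff left_diff_distrib)
    show ?thesis
      unfolding C D A[symmetric] B by simp
  qed
  have wa: "fps_const w * (fps_const aff * F) = F" for F
    using w by (simp flip: mult.assoc)
  note sc = s_left_commute[of "fps_const w"] s_left_commute[of "fps_const aff"]
    s_left_commute[of "fps_const (w ^ i)" for i]
  have "V k n = s (qbinom q lq \<alpha> k * qpow lq (of_int n * (\<alpha> - of_nat k))) * (fps_const (w ^ k) * fps_const par_b)"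
  proof (induction k)
    case 0
    then show ?case using V0 by simp
  next
    case (Suc k)
    let ?c = "q ^ k * qpow lq (of_int n) * qint q (Suc k)"
    have "s ?c * V (Suc k) n = fps_const w * (s (q ^ k * qpow lq (of_int n)) * fps_const aff * (s (qint q (Suc k)) * V (Suc k) n))"
      by (simp only: s_mult mult.assoc sc wa)
    also have "\<dots> = fps_const w * (s (q ^ k * qnum q lq (\<alpha> - of_nat k)) * V k n)"
      by (simp only: step)
    also have "\<dots> = s (q ^ k * qnum q lq (\<alpha> - of_nat k) * (qbinom q lq \<alpha> k * qpow lq (of_int n * (\<alpha> - of_nat k)))) *
        (fps_const (w ^ Suc k) * fps_const par_b)"
      by (simp only: Suc s_mult mult.assoc sc power_Suc fps_const_mult[symmetric])
    also have "q ^ k * qnum q lq (\<alpha> - of_nat k) * (qbinom q lq \<alpha> k * qpow lq (of_int n * (\<alpha> - of_nat k))) =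
        ?c * (qbinom q lq \<alpha> (Suc k) * qpow lq (of_int n * (\<alpha> - of_nat (Suc k))))"
    proof -
      have "of_int n * (\<alpha> - of_nat k) = of_int n + of_int n * (\<alpha> - of_nat (Suc k))"
        by (simp add: algebra_simps)
      then have e: "qpow lq (of_int n * (\<alpha> - of_nat k)) = qpow lq (of_int n) * qpow lq (of_int n * (\<alpha> - of_nat (Suc k)))"
        by (simp only: qpow_add)
      show ?thesis unfolding e using qbinom_Suc[of k \<alpha>] by (simp add: mult_ac)
    qed
    finally show ?case
      unfolding s_mult[of ?c] mult.assoc[of "s ?c"] by (rule s_cancel[rotated]) simp
  qed
  then show ?thesis
    unfolding w(3) V_def by (simp only: s_mult mult.assoc sc)
qed

lemma NCF_data_par: "NCF_data q lq \<alpha> \<eta> \<phi> par_e par_f par_b"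
  unfolding NCF_data_def
proof
  show "\<phi> (\<iota>0 t_var) = tps_const (fps_const aff) * tps_Q lq s 1 + tps_X"
    by (rule tps_eqI) (simp add: nth_phi_iota0_t tps_Q_def tps_X_def s_central)
  show "\<phi> (Y0 q lq \<alpha>) = Tps (\<lambda>i n. s (qbinom q lq \<alpha> i) * fps_const (two_sided_inverse aff ^ i)
        * s (qpow lq (of_int n * (\<alpha> - of_nat i))) * fps_const par_b)"
    by (rule tps_eqI) (simp add: nth_phi_Y0)
qed

lemma base_Q: "base (tps_map D_t (\<iota>0 t_var)) = fps_const par_e"
  by (rule fps_ext) (simp add: base_D_t galois_hull.intros base_iota0_t fps_diff_nth affine_t_nth)

lemma base_X_0: "base tps_X $ 0 = par_f"
  unfolding tps_X_eq
  by (simp add: base_diff base_mult base_Q base_t_var base_iota0_t galois_hull.intros affine_t_nth eta_central)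

lemma par_q_commute: "par_e * par_f = \<eta> (Cst q) * par_f * par_e"
proof -
  have "base (tps_map D_t (\<iota>0 t_var) * tps_X) = base (tps_const (Cst q) * (tps_X * tps_map D_t (\<iota>0 t_var)))"
    by (simp only: Q_X_commute)
  then have "fps_const par_e * base tps_X = fps_const (\<eta> (Cst q)) * (base tps_X * fps_const par_e)"
    by (simp add: base_mult base_Cst base_Q galois_hull.intros hull_X)
  from arg_cong[OF this, of "\<lambda>x. x $ 0"] show ?thesis
    by (simp add: base_X_0 mult.assoc)
qed

lemma par_b_commute: "aff * par_b = par_b * aff"
  using arg_cong[OF iota0_t_Y0_commute, of base]
  by (simp add: base_mult galois_hull.iota0 hull_Y0 base_iota0_t flip: par_b_def)

text \<open>
  The parameters \<open>e\<close>, \<open>f\<close>, \<open>b\<close> are read off from the images of \<open>Q\<close>, \<open>X\<close>, \<open>Y\<^sub>0\<close>, and there \<open>\<iota>\<close> has the values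
  \<open>1\<close>, \<open>0\<close>, \<open>1\<close>. In particular \<open>f\<close> is nilpotent by itself, and not only \<open>(e - 1) t + f\<close>.
\<close>

lemma par_nilpotent: "nilpotent (par_e - 1)" "nilpotent par_f" "nilpotent ((par_b - 1) $ k)"
proof -
  have m1: "map_W \<eta> 1 = 1" and m0: "map_W \<eta> 0 = 0"
    by (rule fps2_eqI, simp add: eta_hom)+
  have "tps_nth (tps_map D_t (\<iota>0 t_var)) 0 0 = 1"
    by (simp add: nth_iota0_t)
  then show "nilpotent (par_e - 1)"
    using phi_nilpotent[OF galois_hull.D_t[OF galois_hull.iota0[of q lq \<alpha> t_var]], of 0 0 0 0] base_Q
    by (simp add: taylor_1 m1 base_def)
  show "nilpotent par_f"
    using phi_nilpotent[OF hull_X, of 0 0 0 0] base_X_0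
    by (simp add: taylor_0 m0 base_def tps_X_def)
  have "tps_nth (Y0 q lq \<alpha>) 0 0 = 1"
    by (simp add: Y0_def)
  then show "nilpotent ((par_b - 1) $ k)"
    using phi_nilpotent[OF hull_Y0, of 0 0 0 k]
    by (simp add: taylor_1 m1 base_def par_b_def)
qed

lemma NCF_data_unique:
  assumes "NCF_data q lq \<alpha> \<eta> \<phi> e f b"
  shows "e = par_e" "f = par_f" "b = par_b"
proof -
  have "base (\<iota>0 t_var) = affine_t \<eta> e f"
    using assms by (simp add: NCF_data_def base_def tps_Q_def tps_X_def)
  then show "e = par_e" "f = par_f"
    by (simp_all add: base_iota0_t affine_t_inject)
  show "b = par_b"
    using assms by (simp add: NCF_data_def base_def par_b_def)
qed

text \<open>
  The logarithmic derivative \<open>\<lambda> = b'(W\<^sub>1) b(W\<^sub>1)\<^sup>-\<^sup>1\<close> has to commute with \<open>\<lambda>'\<close>, since \<open>\<partial>Y\<^sub>0/\<partial>t \<cdot> Y\<^sub>0\<^sup>-\<^sup>1\<close>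
  and its derivative commute in the hull. For \<open>b\<^sub>0 = 1\<close> the values at \<open>W\<^sub>1 = 0\<close> are \<open>b\<^sub>1\<close> and
  \<open>2 b\<^sub>2 - b\<^sub>1\<^sup>2\<close>.
\<close>

lemma par_b_coeffs_commute:
  assumes "par_b $ 0 = 1"
  shows "par_b $ 1 * par_b $ 2 = par_b $ 2 * par_b $ 1"
proof -
  let ?i = "\<iota>0 (inverse y_var) * tps_const y_var"
  define w where "w = base ?i"
  have mem: "?i \<in> GH" by (intro galois_hull.intros)
  have "Y0 q lq \<alpha> * ?i = 1"
  proof -
    have "Y0 q lq \<alpha> * ?i = \<iota>0 y_var * \<iota>0 (inverse y_var) * (tps_const (inverse y_var) * tps_const y_var)"
      unfolding Y0_eq mult.assoc
      by (simp only: mult.assoc[symmetric] tps_const_mult_commute[of "inverse y_var" "\<iota>0 (inverse y_var)"])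
    then show ?thesis by (simp add: tps_const_mult tps_const_1 iota0_1 flip: iota0_mult)
  qed
  then have "par_b * w = 1"
    by (simp add: par_b_def w_def base_1 hull_Y0 mem flip: base_mult)
  from arg_cong[OF this, of "\<lambda>x. x $ 0"] arg_cong[OF this, of "\<lambda>x. x $ 1"] assms
  have w: "w $ 0 = 1" "w $ 1 = - par_b $ 1"
    by (simp_all add: eq_neg_iff_add_eq_0)
  have l: "base logder = fps_diff par_b * w"
    unfolding logder_def
    by (simp add: base_mult base_D_t mem galois_hull.D_t hull_Y0 flip: w_def par_b_def)
  have "base logder * fps_diff (base logder) = fps_diff (base logder) * base logder"
    using arg_cong[OF logder_commute, of base]
    by (simp add: base_mult base_D_t hull_logder galois_hull.D_t)
  from arg_cong[OF this, of "\<lambda>x. x $ 0"]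
  have *: "base logder $ 0 * base logder $ 1 = base logder $ 1 * base logder $ 0"
    by (simp add: fps_diff_nth)
  have l0: "base logder $ 0 = par_b $ 1"
    unfolding l by (simp add: w fps_diff_nth)
  have l1: "base logder $ 1 = par_b $ 2 + par_b $ 2 - par_b $ 1 * par_b $ 1"
    unfolding l using w by (simp add: fps_diff_nth numeral_2_eq_2)
  have "(\<Sum>_<(1::nat) + 1. par_b $ 1 * par_b $ 2) = (\<Sum>_<(1::nat) + 1. par_b $ 2 * par_b $ 1)"
    using * unfolding l0 l1 by (simp add: algebra_simps numeral_2_eq_2 lessThan_Suc)
  then show ?thesis
    by (rule sum_const_cancel)
qed

end

section \<open>Nilpotent elements\<close>

lemma nilpotent_mult_commuting:
  assumes "nilpotent x" "x * y = y * x"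
  shows "nilpotent (x * y)"
proof -
  obtain k where k: "x ^ k = 0" using assms(1) by (auto simp: nilpotent_def)
  have "(x * y) ^ i = x ^ i * y ^ i" for i
  proof (induction i)
    case (Suc i)
    have "x ^ i * y = y * x ^ i"
      using assms(2) by (rule power_commuting_commutes)
    then have "x * y * (x ^ i * y ^ i) = x * x ^ i * (y * y ^ i)"
      by (metis mult.assoc)
    with Suc show ?case by simp
  qed simp
  from this[of k] k show ?thesis unfolding nilpotent_def by (intro exI[of _ k]) simp
qed

text \<open>
  Descending induction on the exponent of \<open>x\<close>: if \<open>(x + y)\<^sup>n x\<^sup>i\<^sup>+\<^sup>1 = 0\<close>, then
  \<open>(x + y)\<^sup>n x\<^sup>i (x + y)\<^sup>j = (x + y)\<^sup>n x\<^sup>i y\<^sup>j\<close>, which vanishes for large \<open>j\<close>.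
\<close>

lemma nilpotent_add_commuting:
  assumes "nilpotent x" "nilpotent y" and c: "x * y = y * x"
  shows "nilpotent (x + y)"
proof -
  obtain k l where k: "x ^ k = 0" and l: "y ^ l = 0"
    using assms by (auto simp: nilpotent_def)
  have "\<exists>n. (x + y) ^ n * x ^ (k - i) = 0" if "i \<le> k" for i
    using that
  proof (induction i)
    case 0
    then show ?case using k by simp
  next
    case (Suc i)
    then obtain n where n: "(x + y) ^ n * x ^ Suc (k - Suc i) = 0"
      by (auto simp: Suc_diff_Suc)
    then have n': "(x + y) ^ n * (x ^ (k - Suc i) * (x * z)) = 0" for z
      by (simp add: power_Suc2 flip: mult.assoc del: power_Suc)
    have "(x + y) ^ n * x ^ (k - Suc i) * (x + y) ^ j = (x + y) ^ n * x ^ (k - Suc i) * y ^ j" for j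
    proof (induction j)
      case (Suc j)
      have "(x + y) ^ n * x ^ (k - Suc i) * (x + y) ^ Suc j = (x + y) ^ n * x ^ (k - Suc i) * y ^ j * (x + y)"
        unfolding power_Suc2 mult.assoc[symmetric] Suc ..
      also have "y ^ j * x = x * y ^ j"
        using power_commuting_commutes[OF c[symmetric], of j] .
      then have "(x + y) ^ n * x ^ (k - Suc i) * y ^ j * x = (x + y) ^ n * x ^ Suc (k - Suc i) * y ^ j"
        by (simp add: mult.assoc power_Suc2 del: power_Suc)
      then have "(x + y) ^ n * x ^ (k - Suc i) * y ^ j * (x + y) = (x + y) ^ n * x ^ (k - Suc i) * y ^ Suc j"
        using n' by (simp add: distrib_left mult.assoc power_Suc2 del: power_Suc)
      finally show ?case .
    qed simp
    from this[of l] have "(x + y) ^ n * x ^ (k - Suc i) * (x + y) ^ l = 0"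
      using l by simp
    moreover have "x ^ (k - Suc i) * (x + y) ^ l = (x + y) ^ l * x ^ (k - Suc i)"
    proof -
      have "x * (x + y) = (x + y) * x" using c by (simp add: algebra_simps)
      then have "x ^ (k - Suc i) * (x + y) = (x + y) * x ^ (k - Suc i)"
        by (rule power_commuting_commutes)
      from power_commuting_commutes[OF this[symmetric], of l] show ?thesis by simp
    qed
    ultimately have "(x + y) ^ (n + l) * x ^ (k - Suc i) = 0"
      by (simp add: power_add mult.assoc)
    then show ?case ..
  qed
  from this[of k] show ?thesis by (auto simp: nilpotent_def)
qed

lemma nilpotent_0 [simp]: "nilpotent 0"
  unfolding nilpotent_def by (intro exI[of _ 1]) simp

section \<open>The dilation \<open>t + W\<^sub>1 \<mapsto> h (t + W\<^sub>1)\<close>\<close>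

lemma fps_const_pow: "fps_const (c :: 'a::{ring, monoid_mult}) ^ n = fps_const (c ^ n)"
  by (induction n) simp_all

lemma fps_const_commutes_iff:
  "fps_const (x::'a::ring) * F = F * fps_const x \<longleftrightarrow> (\<forall>n. x * F $ n = F $ n * x)"
  by (simp add: fps_eq_iff)

lemma commutes_mult:
  fixes x :: "'a::{ring, monoid_mult}"
  assumes "x * F = F * x" "x * G = G * x"
  shows "x * (F * G) = F * G * x"
  using assms by (metis mult.assoc)

lemma commutes_power:
  fixes x :: "'a::{ring, monoid_mult}"
  assumes "x * F = F * x"
  shows "x * F ^ n = F ^ n * x"
  using power_commuting_commutes[OF assms[symmetric]] by simp

context nc_alg
begin

text \<open>The image of \<open>W\<^sub>1\<close> under \<open>t + W\<^sub>1 \<mapsto> h (t + W\<^sub>1)\<close>.\<close>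

definition shift :: "'a \<Rightarrow> 'a fps" where
  "shift h = fps_const ((h - 1) * \<eta> t_var) + fps_const h * fps_X"

text \<open>
  The substitution \<open>b((h - 1) t + h W\<^sub>1)\<close>, with coefficients on the left. For nilpotent \<open>h - 1\<close> each of
  the sums has finitely many nonzero terms.
\<close>

definition dilate :: "'a \<Rightarrow> 'a fps \<Rightarrow> 'a fps" where
  "dilate h b = Abs_fps (\<lambda>N. Sum_any (\<lambda>n. b $ n * (shift h ^ n) $ N))"

lemma shift_nth: "shift h $ n = (if n = 0 then (h - 1) * \<eta> t_var else if n = 1 then h else 0)"
  by (simp add: shift_def)

lemma shift_commutes:
  assumes "x * h = h * x"
  shows "x * (shift h ^ n) $ N = (shift h ^ n) $ N * x"
proof -
  have "x * (h - 1) = (h - 1) * x"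
    using assms by (simp add: algebra_simps)
  then have "x * ((h - 1) * \<eta> t_var) = (h - 1) * \<eta> t_var * x"
    by (intro commutes_mult eta_central[symmetric])
  then have "fps_const x * shift h = shift h * fps_const x"
    using assms by (auto simp: fps_const_commutes_iff shift_nth)
  from commutes_power[OF this] show ?thesis
    by (simp add: fps_const_commutes_iff)
qed

text \<open>
  Put \<open>p = (h - 1) t\<close>, which commutes with \<open>h\<close>. The coefficient of \<open>W\<^sub>1\<^sup>N\<close> in \<open>(p + h W\<^sub>1)\<^sup>n\<close> is
  divisible by \<open>p\<^sup>n\<^sup>-\<^sup>N\<close>, and \<open>p\<close> is nilpotent with \<open>h - 1\<close>.
\<close>

lemma shift_power_vanishes:
  assumes "nilpotent (h - 1)"
  shows "\<exists>M. \<forall>n N. n \<ge> N + M \<longrightarrow> (shift h ^ n) $ N = 0"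
proof -
  define p where "p = (h - 1) * \<eta> t_var"
  have hp: "h * p = p * h"
    unfolding p_def by (intro commutes_mult eta_central[symmetric]) (simp add: algebra_simps)
  have hpp: "h * p ^ i = p ^ i * h" for i
    by (rule commutes_power[OF hp])
  have div: "\<exists>r. (shift h ^ n) $ N = p ^ (n - N) * r" for n N
  proof (induction n arbitrary: N)
    case (Suc n)
    have s: "(shift h ^ Suc n) $ N = p * (shift h ^ n) $ N + h * (if N = 0 then 0 else (shift h ^ n) $ (N - 1))"
      by (simp add: shift_def p_def distrib_right mult.assoc)
    obtain r where r: "(shift h ^ n) $ N = p ^ (n - N) * r" using Suc by blast
    obtain r' where r': "(shift h ^ n) $ (N - 1) = p ^ (n - (N - 1)) * r'" using Suc by blast
    show ?case
    proof (cases "N > n")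
      case True
      then show ?thesis by simp
    next
      case False
      then have idx: "N \<noteq> 0 \<Longrightarrow> n - (N - 1) = Suc n - N" by simp
      from False have "p ^ (Suc n - N) = p * p ^ (n - N)" by (simp add: Suc_diff_le)
      then have "p * (shift h ^ n) $ N = p ^ (Suc n - N) * r"
        by (simp add: r mult.assoc)
      moreover have "h * (if N = 0 then 0 else (shift h ^ n) $ (N - 1)) = p ^ (Suc n - N) * (if N = 0 then 0 else h * r')"
      proof (cases "N = 0")
        case False
        have "h * (shift h ^ n) $ (N - 1) = p ^ (Suc n - N) * (h * r')"
          by (simp only: r' idx[OF False] hpp flip: mult.assoc)
        with False show ?thesis by simp
      qed simp
      ultimately have "(shift h ^ Suc n) $ N = p ^ (Suc n - N) * (r + (if N = 0 then 0 else h * r'))"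
        by (simp only: s distrib_left)
      then show ?thesis ..
    qed
  qed (auto intro: exI[of _ 1])
  have "nilpotent p"
    unfolding p_def by (intro nilpotent_mult_commuting assms eta_central[symmetric])
  then obtain M where M: "p ^ M = 0" by (auto simp: nilpotent_def)
  have "(shift h ^ n) $ N = 0" if "n \<ge> N + M" for n N
  proof -
    have "p ^ (n - N) = p ^ M * p ^ (n - N - M)"
      using that by (simp flip: power_add)
    with div[of n N] M show ?thesis by auto
  qed
  then show ?thesis by blast
qed

text \<open>
  The cut-off \<open>K\<close> is arbitrary, so that sums belonging to different \<open>N\<close> and \<open>h\<close> can be given a common range.
\<close>

lemma dilate_nth_eq_sum:
  assumes "\<And>n. n \<ge> K \<Longrightarrow> b $ n * (shift h ^ n) $ N = 0"
  shows "dilate h b $ N = (\<Sum>n<K. b $ n * (shift h ^ n) $ N)"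
  unfolding dilate_def fps_nth_Abs_fps
  by (rule Sum_any.expand_superset) (use assms in \<open>auto simp: not_less[symmetric]\<close>)

lemma dilate_0 [simp]: "dilate h 0 = 0"
  by (rule fps_ext) (simp add: dilate_nth_eq_sum[where K = 0])

lemma dilate_1 [simp]: "dilate h 1 = 1"
  by (rule fps_ext) (simp add: dilate_nth_eq_sum[where K = 1])

lemma dilate_linear: "dilate h (fps_const a + fps_const c * fps_X) = fps_const a + fps_const c * shift h"
proof (rule fps_ext)
  fix N
  have "dilate h (fps_const a + fps_const c * fps_X) $ N =
      (\<Sum>n<2. (fps_const a + fps_const c * fps_X) $ n * (shift h ^ n) $ N)"
    by (rule dilate_nth_eq_sum) auto
  then show "dilate h (fps_const a + fps_const c * fps_X) $ N = (fps_const a + fps_const c * shift h) $ N"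
    by (simp add: numeral_2_eq_2 lessThan_Suc)
qed

context
  fixes h M
  assumes vanish: "\<And>n N. n \<ge> N + M \<Longrightarrow> (shift h ^ n) $ N = 0"
begin

lemma dilate_nth: "N + M \<le> K \<Longrightarrow> dilate h b $ N = (\<Sum>n<K. b $ n * (shift h ^ n) $ N)"
  using vanish by (intro dilate_nth_eq_sum) simp

lemma dilate_diff: "dilate h (b - c) = dilate h b - dilate h c"
  by (rule fps_ext) (simp add: dilate_nth[OF order_refl] left_diff_distrib sum_subtractf)

lemma dilate_mult_eta: "dilate h (b * fps_const (\<eta> a)) = dilate h b * fps_const (\<eta> a)"
  by (rule fps_ext) (simp add: dilate_nth[OF order_refl] sum_distrib_right mult.assoc eta_central)

text \<open>
  Moving the coefficients of \<open>c\<close> to the left past the powers of \<open>(h - 1) t + h W\<^sub>1\<close> is all that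
  multiplicativity needs; the rest is a comparison of two ranges of summation.
\<close>

lemma dilate_mult:
  assumes c: "\<And>n. h * c $ n = c $ n * h"
  shows "dilate h (b * c) = dilate h b * dilate h c"
proof (rule fps_ext)
  fix N
  define K where "K = N + M"
  let ?S = "\<lambda>i N. (shift h ^ i) $ N"
  have comm: "?S i j * c $ k = c $ k * ?S i j" for i j k
    using shift_commutes[of "c $ k" h i j] c[of k] by simp
  have zero: "?S n N = 0" if "\<not> n < K" for n
    using that by (simp add: K_def vanish)
  have comm': "?S i j * (c $ k * z) = c $ k * (?S i j * z)" for i j k z
    using comm by (simp flip: mult.assoc)
  have "(dilate h b * dilate h c) $ N = (\<Sum>j=0..N. (\<Sum>i<K. b $ i * ?S i j) * (\<Sum>k<K. c $ k * ?S k (N - j)))"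
    unfolding fps_mult_nth by (intro sum.cong refl arg_cong2[where f = "(*)"] dilate_nth) (auto simp: K_def)
  also have "\<dots> = (\<Sum>j=0..N. \<Sum>i<K. \<Sum>k<K. b $ i * c $ k * (?S i j * ?S k (N - j)))"
    unfolding sum_product by (simp add: mult.assoc comm')
  also have "\<dots> = (\<Sum>i<K. \<Sum>j=0..N. \<Sum>k<K. b $ i * c $ k * (?S i j * ?S k (N - j)))"
    by (rule sum.swap)
  also have "\<dots> = (\<Sum>i<K. \<Sum>k<K. \<Sum>j=0..N. b $ i * c $ k * (?S i j * ?S k (N - j)))"
    by (intro sum.cong refl sum.swap)
  also have "\<dots> = (\<Sum>i<K. \<Sum>k<K. b $ i * c $ k * ?S (i + k) N)"
    by (simp add: power_add fps_mult_nth sum_distrib_left)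
  also have "\<dots> = (\<Sum>(i, k)\<in>{..<K} \<times> {..<K}. b $ i * c $ k * ?S (i + k) N)"
    by (rule sum.cartesian_product)
  also have "\<dots> = (\<Sum>(i, k)\<in>{(i, k). i + k < K}. b $ i * c $ k * ?S (i + k) N)"
    by (rule sum.mono_neutral_right) (auto, metis zero mult_zero_right)
  also have "\<dots> = (\<Sum>n<K. \<Sum>i\<le>n. b $ i * c $ (n - i) * ?S (i + (n - i)) N)"
    by (rule sum.triangle_reindex)
  also have "\<dots> = (\<Sum>n<K. (b * c) $ n * ?S n N)"
    by (simp add: fps_mult_nth sum_distrib_right atLeast0AtMost)
  also have "\<dots> = dilate h (b * c) $ N"
    by (simp add: dilate_nth[of N K] K_def)
  finally show "dilate h (b * c) $ N = (dilate h b * dilate h c) $ N" by simp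
qed

end

lemma dilate_shift: "dilate l (shift h) = shift (h * l)"
  unfolding shift_def[of h] dilate_linear
  by (rule fps_ext) (simp add: shift_nth algebra_simps)

text \<open>Both sides are linear in \<open>b\<close>, and for powers of \<open>W\<^sub>1\<close> they agree by multiplicativity.\<close>

lemma dilate_dilate:
  assumes "nilpotent (h - 1)" "nilpotent (l - 1)" "nilpotent (h * l - 1)" and hl: "h * l = l * h"
  shows "dilate l (dilate h b) = dilate (h * l) b"
proof (rule fps_ext)
  fix N
  obtain M1 where M1: "\<And>n N. n \<ge> N + M1 \<Longrightarrow> (shift h ^ n) $ N = 0"
    using shift_power_vanishes[OF assms(1)] by blast
  obtain M2 where M2: "\<And>n N. n \<ge> N + M2 \<Longrightarrow> (shift l ^ n) $ N = 0"
    using shift_power_vanishes[OF assms(2)] by blast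
  obtain M3 where M3: "\<And>n N. n \<ge> N + M3 \<Longrightarrow> (shift (h * l) ^ n) $ N = 0"
    using shift_power_vanishes[OF assms(3)] by blast
  define K where "K = N + M2 + M1 + M3"
  have K3: "N + M3 \<le> K" unfolding K_def by linarith
  have "dilate l (shift h ^ n) = shift (h * l) ^ n" for n
  proof (induction n)
    case (Suc n)
    have "dilate l (shift h ^ n * shift h) = dilate l (shift h ^ n) * dilate l (shift h)"
    proof (rule dilate_mult[OF M2])
      show "l * shift h $ m = shift h $ m * l" for m
        using shift_commutes[OF hl[symmetric], of 1 m] by simp
    qed
    then show ?case by (simp only: power_Suc2 Suc dilate_shift)
  qed simp
  then have pow: "(\<Sum>i<N + M2. (shift h ^ n) $ i * (shift l ^ i) $ N) = (shift (h * l) ^ n) $ N" for n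
    by (metis dilate_nth[OF M2 order_refl])
  have "dilate l (dilate h b) $ N = (\<Sum>i<N + M2. dilate h b $ i * (shift l ^ i) $ N)"
    by (rule dilate_nth[OF M2 order_refl])
  also have "\<dots> = (\<Sum>i<N + M2. (\<Sum>n<K. b $ n * (shift h ^ n) $ i) * (shift l ^ i) $ N)"
    by (intro sum.cong refl arg_cong2[where f = "(*)"] dilate_nth[OF M1]) (auto simp: K_def)
  also have "\<dots> = (\<Sum>i<N + M2. \<Sum>n<K. b $ n * ((shift h ^ n) $ i * (shift l ^ i) $ N))"
    by (simp add: sum_distrib_right mult.assoc)
  also have "\<dots> = (\<Sum>n<K. b $ n * (\<Sum>i<N + M2. (shift h ^ n) $ i * (shift l ^ i) $ N))"
    unfolding sum_distrib_left by (rule sum.swap)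
  also have "\<dots> = dilate (h * l) b $ N"
    unfolding pow by (rule dilate_nth[OF M3 K3, symmetric])
  finally show "dilate l (dilate h b) $ N = dilate (h * l) b $ N" .
qed

text \<open>
  Both components of an element of \<open>QG\<^sub>I\<^sub>I\<close> are of degree at most \<open>1\<close> in \<open>W\<^sub>2\<close>. For such series the
  substitution is a dilation of the two coefficients, whatever is substituted for \<open>W\<^sub>2\<close>.
\<close>

lemma subst_W_dilate:
  assumes h: "nilpotent (h - 1)" and F: "\<And>m. m \<ge> 2 \<Longrightarrow> F $ m = 0"
  shows "subst_W F (fps_const (shift h), w) = fps_const (dilate h (F $ 0)) + fps_const (dilate h (F $ 1)) * w"
proof (rule fps2_eqI)
  fix k N
  obtain M where M: "\<And>n N. n \<ge> N + M \<Longrightarrow> (shift h ^ n) $ N = 0"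
    using shift_power_vanishes[OF h] by blast
  define K where "K = N + M"
  define T where "T = (\<lambda>(m, n). (const_W (F $ m $ n) * fps_const (shift h) ^ n * w ^ m) $ k $ N)"
  have T: "T (m, n) = (\<Sum>i=0..N. F $ m $ n * (shift h ^ n) $ i * (w ^ m) $ k $ (N - i))" for m n
  proof -
    have "const_W (F $ m $ n) * fps_const (shift h) ^ n = fps_const (fps_const (F $ m $ n) * shift h ^ n)"
      by (simp add: const_W_def fps_const_pow)
    then have "T (m, n) = ((fps_const (F $ m $ n) * shift h ^ n) * (w ^ m) $ k) $ N"
      by (simp add: T_def)
    then show ?thesis by (simp add: fps_mult_nth[of "fps_const (F $ m $ n) * shift h ^ n"])
  qed
  have "T (m, n) = 0" if "n \<ge> K" for m n
    unfolding T by (rule sum.neutral) (use that M in \<open>auto simp: K_def\<close>)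
  moreover have "T (m, n) = 0" if "m \<ge> 2" for m n
    unfolding T using F[OF that] by simp
  ultimately have supp: "{x. T x \<noteq> 0} \<subseteq> {..<2} \<times> {..<K}"
    by (auto simp: not_less[symmetric])
  have S: "(\<Sum>n<K. T (m, n)) = (fps_const (dilate h (F $ m)) * w ^ m) $ k $ N" for m
  proof -
    have "(\<Sum>n<K. T (m, n)) = (\<Sum>i=0..N. \<Sum>n<K. F $ m $ n * (shift h ^ n) $ i * (w ^ m) $ k $ (N - i))"
      unfolding T by (rule sum.swap)
    also have "\<dots> = (\<Sum>i=0..N. dilate h (F $ m) $ i * (w ^ m) $ k $ (N - i))"
      unfolding sum_distrib_right[symmetric]
      by (intro sum.cong refl arg_cong2[where f = "(*)"] dilate_nth[OF M, symmetric]) (auto simp: K_def)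
    finally show ?thesis by (simp add: fps_mult_nth[of "dilate h (F $ m)"])
  qed
  have "subst_W F (fps_const (shift h), w) $ k $ N = Sum_any T"
    by (simp add: subst_W_def T_def)
  also have "\<dots> = sum T ({..<2} \<times> {..<K})"
    by (rule Sum_any.expand_superset[OF _ supp]) simp
  also have "\<dots> = (\<Sum>m<2. \<Sum>n<K. T (m, n))"
    by (simp add: sum.cartesian_product)
  also have "\<dots> = (\<Sum>n<K. T (0, n)) + (\<Sum>n<K. T (1, n))"
    by (simp add: numeral_2_eq_2 lessThan_Suc add.commute)
  finally show "subst_W F (fps_const (shift h), w) $ k $ N =
      (fps_const (dilate h (F $ 0)) + fps_const (dilate h (F $ 1)) * w) $ k $ N"
    unfolding S by simp
qed

section \<open>The quantum formal group \<open>QG\<^sub>I\<^sub>I\<close>\<close>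

lemma II_pair_nth:
  "fst (II_pair \<eta> e f b) $ m = (if m = 0 then fps_const ((e - 1) * \<eta> t_var + f) + fps_const e * fps_X else 0)"
  "snd (II_pair \<eta> e f b) $ m = (if m = 0 then (b - 1) * fps_const (\<eta> y_var) else if m = 1 then b else 0)"
  by (auto simp: II_pair_def const_W_def W1_def W2_def)

lemma II_pair_inject: "II_pair \<eta> e f b = II_pair \<eta> h k c \<longleftrightarrow> e = h \<and> f = k \<and> b = c"
proof
  assume eq: "II_pair \<eta> e f b = II_pair \<eta> h k c"
  have "b = c"
    using arg_cong[OF eq, of "\<lambda>u. snd u $ 1"] by (simp add: II_pair_nth)
  moreover have "e = h"
    using arg_cong[OF eq, of "\<lambda>u. fst u $ 0 $ 1"] by (simp add: II_pair_nth)
  moreover have "f = k"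
    using arg_cong[OF eq, of "\<lambda>u. fst u $ 0 $ 0"] \<open>e = h\<close> by (simp add: II_pair_nth)
  ultimately show "e = h \<and> f = k \<and> b = c" by simp
qed simp

text \<open>
  The two commutation conditions agree, since the first component is \<open>e (t + W\<^sub>1) + f - t\<close> with \<open>t\<close>
  central, while \<open>b\<close> is the coefficient of \<open>W\<^sub>2\<close> in the second one.
\<close>

lemma II_pair_commute_iff:
  fixes e f :: 'a and b :: "'a fps"
  defines "u \<equiv> II_pair \<eta> e f b"
  shows "fst u * snd u = snd u * fst u \<longleftrightarrow> affine_t \<eta> e f * b = b * affine_t \<eta> e f"
proof -
  define p where "p = fps_const ((e - 1) * \<eta> t_var + f) + fps_const e * fps_X"
  define \<tau> where "\<tau> = fps_const (\<eta> t_var)"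
  have p: "affine_t \<eta> e f = p + \<tau>"
    by (rule fps_ext) (simp add: affine_t_nth p_def \<tau>_def algebra_simps)
  have \<tau>: "\<tau> * b = b * \<tau>"
    by (rule fps_ext) (simp add: \<tau>_def distrib_left distrib_right eta_central)
  have y: "fps_const (\<eta> y_var) * x = x * fps_const (\<eta> y_var)" for x
    by (rule fps_ext) (simp add: eta_central)
  have fst: "fst u = fps_const p"
    by (rule fps_ext) (simp add: u_def II_pair_nth p_def)
  have "fst u * snd u = snd u * fst u \<longleftrightarrow> p * b = b * p"
  proof
    assume "fst u * snd u = snd u * fst u"
    from arg_cong[OF this, of "\<lambda>x. x $ 1"] show "p * b = b * p"
      by (simp add: fst) (simp add: u_def II_pair_nth)
  next
    assume pb: "p * b = b * p"
    have "p * ((b - 1) * fps_const (\<eta> y_var)) = (b - 1) * fps_const (\<eta> y_var) * p"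
      using pb by (intro commutes_mult y[symmetric]) (simp add: algebra_simps)
    with pb show "fst u * snd u = snd u * fst u"
      by (intro fps_ext) (simp add: fst, simp add: u_def II_pair_nth)
  qed
  also have "\<dots> \<longleftrightarrow> affine_t \<eta> e f * b = b * affine_t \<eta> e f"
    by (simp add: p \<tau> distrib_left distrib_right)
  finally show ?thesis .
qed

definition params :: "complex \<Rightarrow> 'a \<Rightarrow> 'a \<Rightarrow> 'a fps \<Rightarrow> bool" where
  "params q e f b \<longleftrightarrow> e * f = \<eta> (Cst q) * f * e \<and> affine_t \<eta> e f * b = b * affine_t \<eta> e f \<and>
     nilpotent (e - 1) \<and> nilpotent f \<and> (\<forall>k. nilpotent ((b - 1) $ k))"

lemma II_pair_in_QGII_iff: "II_pair \<eta> e f b \<in> QGII q \<eta> \<longleftrightarrow> params q e f b"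
  unfolding QGII_def params_def using II_pair_commute_iff by (auto simp: II_pair_inject)

lemma QGII_cases:
  assumes "u \<in> QGII q \<eta>"
  obtains e f b where "u = II_pair \<eta> e f b" "params q e f b"
proof -
  obtain e f b where "u = II_pair \<eta> e f b"
    using assms unfolding QGII_def by blast
  with assms II_pair_in_QGII_iff that show ?thesis by blast
qed

text \<open>
  From \<open>e f = q f e\<close> follows \<open>(e - 1)\<^sup>m f = f (q e - 1)\<^sup>m\<close>. The left-hand side vanishes for large
  \<open>m\<close>, while \<open>q e - 1 = (q - 1) + q (e - 1)\<close> is a unit plus a nilpotent; so \<open>f = 0\<close>.
\<close>

lemma q_commuting_unipotent_zero:
  assumes "q \<noteq> 1" "e * f = \<eta> (Cst q) * f * e" "nilpotent (e - 1)"
  shows "f = 0"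
proof -
  define N where "N = e - 1"
  define r where "r = \<eta> (Cst q) * e - 1"
  obtain m where m: "N ^ m = 0" using assms(3) by (auto simp: nilpotent_def N_def)
  have Nf: "N * f = f * r"
    using assms(2) eta_central[of "Cst q" f]
    by (simp add: N_def r_def left_diff_distrib right_diff_distrib flip: mult.assoc)
  have Nif: "N ^ i * f = f * r ^ i" for i
  proof (induction i)
    case (Suc i)
    have "N ^ Suc i * f = N * f * r ^ i"
      by (simp add: mult.assoc Suc)
    then show ?case by (simp add: Nf mult.assoc)
  qed simp
  have fr: "f * r ^ m = 0"
    unfolding Nif[symmetric] m by simp
  have cancel: "g = 0" if "g * r = 0" for g
  proof -
    define c where "c = Cst (q / (1 - q))"
    have "\<eta> (Cst (1 - q)) * g = \<eta> (Cst q) * (g * N)"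
      using that eta_left_commute[of g "Cst q" e] eta_central[of "Cst q" g]
      by (simp add: N_def r_def eta_hom Cst_diff algebra_simps)
    then have "\<eta> (Cst (1 / (1 - q))) * (\<eta> (Cst (1 - q)) * g) = \<eta> (Cst (1 / (1 - q))) * (\<eta> (Cst q) * (g * N))"
      by simp
    then have g: "g = \<eta> c * (g * N)"
      using assms(1) by (simp add: c_def eta_hom(3) flip: mult.assoc eta_hom(2) Cst_mult)
    have "g = \<eta> c ^ i * (g * N ^ i)" for i
    proof (induction i)
      case (Suc i)
      note Suc
      also have "\<eta> c ^ i * (g * N ^ i) = \<eta> c ^ i * (\<eta> c * (g * N) * N ^ i)"
        by (subst g) (rule refl)
      also have "\<dots> = \<eta> c ^ Suc i * (g * N ^ Suc i)"
        by (simp only: mult.assoc power_Suc[of N] power_Suc2[of "\<eta> c"])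
      finally show ?case .
    qed simp
    from this[of m] m show "g = 0" by simp
  qed
  have "f * r ^ i = 0 \<Longrightarrow> f = 0" for i
    by (induction i) (auto simp: power_Suc2 mult.assoc[symmetric] simp del: power_Suc intro: cancel)
  with fr show ?thesis by blast
qed

text \<open>
  For \<open>f = 0\<close> the coefficients of \<open>e (t + W\<^sub>1) b = b e (t + W\<^sub>1)\<close> give \<open>e b\<^sub>n = b\<^sub>n e\<close> by induction on \<open>n\<close>,
  as \<open>t\<close> is a central unit.
\<close>

lemma params_commute:
  assumes "params q e 0 b"
  shows "e * b $ n = b $ n * e"
proof -
  have c: "affine_t \<eta> e 0 * b = b * affine_t \<eta> e 0"
    using assms by (simp add: params_def)
  have aff: "affine_t \<eta> e 0 = fps_const (e * \<eta> t_var) + fps_const e * fps_X"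
    by (rule fps_ext) (simp add: affine_t_nth)
  have cancel: "x = y" if "\<eta> t_var * x = \<eta> t_var * y" for x y
  proof -
    have "\<eta> (inverse t_var) * (\<eta> t_var * x) = \<eta> (inverse t_var) * (\<eta> t_var * y)"
      using that by simp
    then show ?thesis by (simp add: eta_hom(3) flip: mult.assoc eta_hom(2))
  qed
  have move: "e * \<eta> t_var * x = \<eta> t_var * (e * x)" "x * (e * \<eta> t_var) = \<eta> t_var * (x * e)" for x
    by (simp only: mult.assoc[symmetric] eta_central[of t_var e])
       (simp only: eta_central[of t_var "x * e"] mult.assoc)
  show ?thesis
  proof (induction n)
    case 0
    have "e * \<eta> t_var * b $ 0 = b $ 0 * (e * \<eta> t_var)"
      using arg_cong[OF c, of "\<lambda>x. x $ 0"] by (simp add: aff)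
    then show ?case
      unfolding move by (rule cancel)
  next
    case (Suc n)
    have "(fps_const e * fps_X * b) $ Suc n = e * b $ n"
      by (simp add: mult.assoc)
    moreover have "(b * (fps_const e * fps_X)) $ Suc n = b $ n * e"
      by (simp flip: mult.assoc)
    ultimately have "e * \<eta> t_var * b $ Suc n + e * b $ n = b $ Suc n * (e * \<eta> t_var) + b $ n * e"
      using arg_cong[OF c, of "\<lambda>x. x $ Suc n"]
      by (simp only: aff distrib_left distrib_right fps_add_nth fps_mult_left_const_nth fps_mult_right_const_nth)
    then have "e * \<eta> t_var * b $ Suc n = b $ Suc n * (e * \<eta> t_var)"
      using Suc by simp
    then show ?case
      unfolding move by (rule cancel)
  qed
qed

lemma params_commuteI:
  assumes "\<And>n. e * b $ n = b $ n * e"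
  shows "affine_t \<eta> e 0 * b = b * affine_t \<eta> e 0"
proof -
  have aff: "affine_t \<eta> e 0 = fps_const e * (fps_const (\<eta> t_var) + fps_X)"
    by (simp add: affine_t_def)
  have e: "b * fps_const e = fps_const e * b"
    using assms by (simp add: fps_eq_iff)
  have "b * (fps_const (\<eta> t_var) + fps_X) = (fps_const (\<eta> t_var) + fps_X) * b"
    by (rule fps_ext) (simp add: distrib_left distrib_right eta_central)
  with e show ?thesis
    unfolding aff by (rule commutes_mult[symmetric])
qed

lemma QGII_mult_II_pair:
  assumes h: "nilpotent (h - 1)"
  shows "QGII_mult (II_pair \<eta> e f b) (II_pair \<eta> h 0 c) = II_pair \<eta> (e * h) f (dilate h b * c)"
proof -
  obtain M where M: "\<And>n N. n \<ge> N + M \<Longrightarrow> (shift h ^ n) $ N = 0"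
    using shift_power_vanishes[OF h] by blast
  define w where "w = snd (II_pair \<eta> h 0 c)"
  have v: "II_pair \<eta> h 0 c = (fps_const (shift h), w)"
    by (intro prod_eqI fps_ext) (auto simp: II_pair_nth shift_def w_def)
  have 1: "fst (QGII_mult (II_pair \<eta> e f b) (II_pair \<eta> h 0 c)) = fst (II_pair \<eta> (e * h) f (dilate h b * c))"
  proof (rule fps_ext)
    fix m
    show "fst (QGII_mult (II_pair \<eta> e f b) (II_pair \<eta> h 0 c)) $ m = fst (II_pair \<eta> (e * h) f (dilate h b * c)) $ m"
      unfolding QGII_mult_def v fst_conv
      by (subst subst_W_dilate[OF h])
         (simp_all add: II_pair_nth dilate_linear, auto simp: fps_eq_iff shift_nth algebra_simps)
  qed
  have 2: "snd (QGII_mult (II_pair \<eta> e f b) (II_pair \<eta> h 0 c)) = snd (II_pair \<eta> (e * h) f (dilate h b * c))"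
  proof (rule fps_ext)
    fix m
    have "dilate h ((b - 1) * fps_const (\<eta> y_var)) = (dilate h b - 1) * fps_const (\<eta> y_var)"
      by (simp add: dilate_mult_eta[OF M] dilate_diff[OF M])
    then show "snd (QGII_mult (II_pair \<eta> e f b) (II_pair \<eta> h 0 c)) $ m = snd (II_pair \<eta> (e * h) f (dilate h b * c)) $ m"
      unfolding QGII_mult_def v snd_conv
      by (subst subst_W_dilate[OF h]) (auto simp: w_def II_pair_nth algebra_simps)
  qed
  show ?thesis by (rule prod_eqI[OF 1 2])
qed

lemma subst_W_const_dilate:
  assumes "nilpotent (h - 1)"
  shows "subst_W (fps_const b) (II_pair \<eta> h 0 c) = fps_const (dilate h b)"
proof -
  have v: "II_pair \<eta> h 0 c = (fps_const (shift h), snd (II_pair \<eta> h 0 c))"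
    by (intro prod_eqI fps_ext) (auto simp: II_pair_nth shift_def)
  show ?thesis
    by (subst v, subst subst_W_dilate[OF assms]) simp_all
qed

lemma mutually_commute_II_pairD:
  assumes "mutually_commute (II_pair \<eta> e f b) (II_pair \<eta> h k c)"
  shows "e * h = h * e" "e * c $ n = c $ n * e" "b $ n * h = h * b $ n"
proof -
  have 1: "fst u $ m $ n \<in> pair_coeffs u" and 2: "snd u $ m $ n \<in> pair_coeffs u" for u :: "'a fps fps \<times> 'a fps fps" and m n
    by (auto simp: pair_coeffs_def fps2_coeffs_def)
  have e: "e \<in> pair_coeffs (II_pair \<eta> e f b)" for e f b
    using 1[of "II_pair \<eta> e f b" 0 1] by (simp add: II_pair_nth)
  have b: "b $ n \<in> pair_coeffs (II_pair \<eta> e f b)" for e f b n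
    using 2[of "II_pair \<eta> e f b" 1 n] by (simp add: II_pair_nth)
  have comm: "x * y = y * x" if "x \<in> pair_coeffs (II_pair \<eta> e f b)" "y \<in> pair_coeffs (II_pair \<eta> h k c)" for x y
    using assms that unfolding mutually_commute_def by blast
  show "e * h = h * e" "e * c $ n = c $ n * e" "b $ n * h = h * b $ n"
    by (rule comm[OF e e], rule comm[OF e b], rule comm[OF b e])
qed

end

section \<open>The inclusion into \<open>QG\<^sub>I\<^sub>I\<close>\<close>

locale galois_functor = q_generic q lq \<alpha> + nc_alg \<eta>
  for q lq \<alpha> :: complex and \<eta> :: "ratfun \<Rightarrow> 'a::{ring, monoid_mult}"
begin

abbreviation "toII \<equiv> to_QGII q lq \<alpha> \<eta>"
abbreviation "NCFA \<equiv> NCF q lq \<alpha> \<eta>"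

lemma deformationI: "\<phi> \<in> NCFA \<Longrightarrow> deformation q lq \<alpha> \<eta> \<phi>"
  by unfold_locales

lemma params_f_zero: "params q e f b \<Longrightarrow> f = 0"
  using q_commuting_unipotent_zero[OF q_neq_1] by (auto simp: params_def)

lemma NCF_parameters:
  assumes "\<phi> \<in> NCFA"
  shows "\<exists>e f b. NCF_data q lq \<alpha> \<eta> \<phi> e f b \<and> params q e f b"
proof -
  interpret deformation q lq \<alpha> \<eta> \<phi> using assms by (rule deformationI)
  have "params q par_e par_f par_b"
    unfolding params_def by (intro conjI allI par_q_commute par_b_commute par_nilpotent)
  with NCF_data_par show ?thesis by blast
qed

lemma NCF_parameters_unique:
  assumes "\<phi> \<in> NCFA" "NCF_data q lq \<alpha> \<eta> \<phi> e f b" "NCF_data q lq \<alpha> \<eta> \<phi> h k c"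
  shows "h = e" "k = f" "c = b"
proof -
  interpret deformation q lq \<alpha> \<eta> \<phi> using assms(1) by (rule deformationI)
  show "h = e" "k = f" "c = b"
    using NCF_data_unique[OF assms(2)] NCF_data_unique[OF assms(3)] by simp_all
qed

lemma to_QGII_eq:
  assumes "\<phi> \<in> NCFA" "NCF_data q lq \<alpha> \<eta> \<phi> e f b"
  shows "toII \<phi> = II_pair \<eta> e f b"
  unfolding to_QGII_def
proof (rule the_equality)
  fix u assume "\<exists>e f b. NCF_data q lq \<alpha> \<eta> \<phi> e f b \<and> u = II_pair \<eta> e f b"
  then obtain h k c where "NCF_data q lq \<alpha> \<eta> \<phi> h k c" "u = II_pair \<eta> h k c" by blast
  with NCF_parameters_unique[OF assms] show "u = II_pair \<eta> e f b" by simp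
qed (use assms in blast)

lemma to_QG2_eq:
  assumes "\<phi> \<in> NCFA" "NCF_data q lq \<alpha> \<eta> \<phi> e f b"
  shows "to_QG2 q lq \<alpha> \<eta> \<phi> = (vector [vector [e, f], vector [0, 1]], b)"
  unfolding to_QG2_def
proof (rule the_equality)
  fix u assume "\<exists>e f b. NCF_data q lq \<alpha> \<eta> \<phi> e f b \<and> u = (vector [vector [e, f], vector [0, 1]], b)"
  then obtain h k c where "NCF_data q lq \<alpha> \<eta> \<phi> h k c" "u = (vector [vector [h, k], vector [0, 1]], c)" by blast
  with NCF_parameters_unique[OF assms] show "u = (vector [vector [e, f], vector [0, 1]], b)" by simp
qed (use assms in blast)

lemma to_QGII_in:
  assumes "\<phi> \<in> NCFA"
  shows "toII \<phi> \<in> QGII q \<eta>"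
proof -
  obtain e f b where "NCF_data q lq \<alpha> \<eta> \<phi> e f b" "params q e f b"
    using NCF_parameters[OF assms] by blast
  then show ?thesis
    by (simp add: to_QGII_eq[OF assms] II_pair_in_QGII_iff)
qed

lemma to_fract_induct:
  assumes c: "\<And>c. P (Cst c)" and t: "P t_var" and y: "P y_var"
    and a: "\<And>a b. P a \<Longrightarrow> P b \<Longrightarrow> P (a + b)" and m: "\<And>a b. P a \<Longrightarrow> P b \<Longrightarrow> P (a * b)"
  shows "P (to_fract p)"
proof -
  have inner: "P (to_fract [:r:])" for r
  proof (induction r)
    case 0
    then show ?case using c[of 0] by simp
  next
    case (pCons d r)
    have "to_fract [:pCons d r:] = Cst d + t_var * to_fract [:r:]"
      by (simp add: Cst_def t_var_def flip: to_fract_add to_fract_mult)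
    then show ?case using c t a m pCons by simp
  qed
  show ?thesis
  proof (induction p)
    case 0
    then show ?case using c[of 0] by simp
  next
    case (pCons r p)
    have "to_fract (pCons r p) = to_fract [:r:] + y_var * to_fract p"
      by (simp add: y_var_def flip: to_fract_add to_fract_mult)
    then show ?case using inner y a m pCons by simp
  qed
qed

text \<open>
  The elements \<open>a\<close> of \<open>L\<close> with \<open>\<phi>(\<iota>\<^sub>0(a)) = \<psi>(\<iota>\<^sub>0(a))\<close> form a subfield, inverses being unique; it
  contains \<open>\<complex>\<close>, \<open>t\<close> and \<open>y\<close>. All other elements of the hull arise from \<open>\<iota>\<^sub>0(L)\<close> and \<open>L\<close> by
  operations that deformations respect.
\<close>

lemma NCF_eqI:
  assumes "\<phi> \<in> NCFA" "\<psi> \<in> NCFA" "NCF_data q lq \<alpha> \<eta> \<phi> e f b" "NCF_data q lq \<alpha> \<eta> \<psi> e f b"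
  shows "\<phi> = \<psi>"
proof -
  interpret A: deformation q lq \<alpha> \<eta> \<phi> using assms(1) by (rule deformationI)
  interpret B: deformation q lq \<alpha> \<eta> \<psi> using assms(2) by (rule deformationI)
  let ?P = "\<lambda>a. \<phi> (\<iota>0 a) = \<psi> (\<iota>0 a)"
  have const: "\<phi> (tps_const a) = \<psi> (tps_const a)" for a
    by (simp only: A.phi_const B.phi_const)
  have t: "?P t_var" and Y0: "\<phi> (Y0 q lq \<alpha>) = \<psi> (Y0 q lq \<alpha>)"
    using assms(3,4) by (simp_all add: NCF_data_def)
  have y: "?P y_var"
    using Y0 const[of y_var] by (simp add: iota0_y A.phi_mult B.phi_mult hull_Y0 galois_hull.const)
  have add: "?P (a + b)" and mult: "?P (a * b)" if "?P a" "?P b" for a b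
    using that by (simp_all add: iota0_add iota0_mult A.phi_add A.phi_mult B.phi_add B.phi_mult galois_hull.iota0)
  have inv: "?P (inverse a)" if a: "?P a" for a
  proof (cases "a = 0")
    case False
    then have "\<phi> (\<iota>0 (inverse a)) * \<phi> (\<iota>0 a) = 1" and r: "\<psi> (\<iota>0 a) * \<psi> (\<iota>0 (inverse a)) = 1"
      by (simp_all add: galois_hull.iota0 iota0_1 A.phi_1 B.phi_1 flip: A.phi_mult B.phi_mult iota0_mult)
    then have l: "\<phi> (\<iota>0 (inverse a)) * \<psi> (\<iota>0 a) = 1" by (simp only: a)
    have "\<phi> (\<iota>0 (inverse a)) = \<phi> (\<iota>0 (inverse a)) * (\<psi> (\<iota>0 a) * \<psi> (\<iota>0 (inverse a)))"
      by (simp only: r mult_1_right)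
    also have "\<dots> = \<psi> (\<iota>0 (inverse a))"
      by (simp only: mult.assoc[symmetric] l mult_1_left)
    finally show ?thesis .
  qed (use a in simp)
  have fract: "?P (to_fract p)" for p
    by (rule to_fract_induct[of ?P]) (use t y add mult const in \<open>simp_all add: iota0_Cst\<close>)
  have iota0: "?P a" for a
  proof -
    obtain p r where "a = to_fract p / to_fract r" by (rule ratfun_cases)
    then have a: "a = to_fract p * inverse (to_fract r)" by (simp add: divide_inverse)
    show ?thesis unfolding a by (rule mult[OF fract inv[OF fract]])
  qed
  have "\<phi> x = \<psi> x" if "x \<in> GH" for x
    using that
  proof induction
    case (iota0 a)
    then show ?case using \<open>?P a\<close> .
  qed (simp_all add: const A.phi_add B.phi_add A.phi_diff B.phi_diff A.phi_mult B.phi_mult A.phi_Sigma B.phi_Sigma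
      A.phi_Theta B.phi_Theta A.phi_D_t B.phi_D_t A.phi_D_y B.phi_D_y)
  with A.phi_extensional B.phi_extensional show ?thesis
    by (intro extensionalityI)
qed

lemma inj_to_QGII: "inj_on toII NCFA"
proof (rule inj_onI)
  fix \<phi> \<psi> assume *: "\<phi> \<in> NCFA" "\<psi> \<in> NCFA" "toII \<phi> = toII \<psi>"
  obtain e f b where 1: "NCF_data q lq \<alpha> \<eta> \<phi> e f b" using NCF_parameters[OF *(1)] by blast
  obtain h k c where 2: "NCF_data q lq \<alpha> \<eta> \<psi> h k c" using NCF_parameters[OF *(2)] by blast
  have "II_pair \<eta> e f b = II_pair \<eta> h k c"
    using *(3) to_QGII_eq[OF *(1) 1] to_QGII_eq[OF *(2) 2] by simp
  with 2 have "NCF_data q lq \<alpha> \<eta> \<psi> e f b" by (simp add: II_pair_inject)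
  then show "\<phi> = \<psi>" using NCF_eqI[OF *(1,2) 1] by blast
qed

section \<open>Consequences of bijectivity\<close>

lemma matrix_inject:
  "(vector [vector [e, f], vector [0, 1]] :: 'a ^ 2 ^ 2) = vector [vector [h, k], vector [0, 1]] \<longleftrightarrow> e = h \<and> f = k"
proof
  assume *: "(vector [vector [e, f], vector [0, 1]] :: 'a ^ 2 ^ 2) = vector [vector [h, k], vector [0, 1]]"
  show "e = h \<and> f = k"
    using arg_cong[OF *, of "\<lambda>x. vec_nth (vec_nth x 1) 1"] arg_cong[OF *, of "\<lambda>x. vec_nth (vec_nth x 1) 2"]
    by simp
qed simp

lemma params_in_QG2: "params q e f b \<Longrightarrow> (vector [vector [e, f], vector [0, 1]], b) \<in> QG2 q \<eta>"
  unfolding QG2_def params_def by blast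

lemma NCF_with_parameters:
  assumes "QG2 q \<eta> \<subseteq> to_QG2 q lq \<alpha> \<eta> ` NCFA" "params q e f b"
  obtains \<phi> where "\<phi> \<in> NCFA" "NCF_data q lq \<alpha> \<eta> \<phi> e f b"
proof -
  obtain \<phi> where phi: "\<phi> \<in> NCFA" "to_QG2 q lq \<alpha> \<eta> \<phi> = (vector [vector [e, f], vector [0, 1]], b)"
    using subsetD[OF assms(1) params_in_QG2[OF assms(2)]] by force
  obtain h k c where hkc: "NCF_data q lq \<alpha> \<eta> \<phi> h k c" using NCF_parameters[OF phi(1)] by blast
  have "h = e" "k = f" "c = b"
    using phi(2) to_QG2_eq[OF phi(1) hkc] by (simp_all add: matrix_inject)
  with hkc phi(1) that show ?thesis by blast
qed

lemma bij_to_QGII: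
  assumes "QG2 q \<eta> \<subseteq> to_QG2 q lq \<alpha> \<eta> ` NCFA"
  shows "bij_betw toII NCFA (QGII q \<eta>)"
proof -
  have "u \<in> toII ` NCFA" if "u \<in> QGII q \<eta>" for u
  proof -
    obtain e f b where u: "u = II_pair \<eta> e f b" "params q e f b" using \<open>u \<in> _\<close> by (rule QGII_cases)
    obtain \<phi> where "\<phi> \<in> NCFA" "NCF_data q lq \<alpha> \<eta> \<phi> e f b" using NCF_with_parameters[OF assms u(2)] by blast
    then show ?thesis by (intro image_eqI[of _ _ \<phi>]) (simp_all add: to_QGII_eq u(1))
  qed
  then show ?thesis
    unfolding bij_betw_def using inj_to_QGII to_QGII_in by blast
qed

text \<open>
  For nilpotent \<open>x\<close>, \<open>y\<close> the series \<open>b = 1 + x W\<^sub>1 + y W\<^sub>1\<^sup>2\<close> is the parameter of a point of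
  \<open>QG\<^sub>2\<close> with \<open>e = 1\<close>, \<open>f = 0\<close>. As that point comes from a deformation, the coefficients of \<open>b\<close>
  commute.
\<close>

lemma nilpotents_commute:
  fixes x y :: 'a
  assumes surj: "QG2 q \<eta> \<subseteq> to_QG2 q lq \<alpha> \<eta> ` NCFA" and xy: "nilpotent x" "nilpotent y"
  shows "x * y = y * x"
proof -
  define b where "b = Abs_fps (\<lambda>n. if n = 0 then 1 else if n = 1 then x else if n = 2 then y else 0)"
  have b: "b $ 0 = 1" "b $ 1 = x" "b $ 2 = y" by (simp_all add: b_def)
  have "affine_t \<eta> 1 0 * b = b * affine_t \<eta> 1 0" by (rule params_commuteI) simp
  moreover have "nilpotent ((b - 1) $ k)" for k
    using xy by (simp add: b_def)
  ultimately have "params q 1 0 b" by (simp add: params_def)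
  then obtain \<phi> where d: "\<phi> \<in> NCFA" "NCF_data q lq \<alpha> \<eta> \<phi> 1 0 b"
    using NCF_with_parameters[OF surj] by blast
  interpret deformation q lq \<alpha> \<eta> \<phi> using d(1) by (rule deformationI)
  have "par_b = b" using NCF_data_unique(3)[OF d(2)] by simp
  then show ?thesis using par_b_coeffs_commute b by simp
qed

context
  assumes comm: "\<And>x y :: 'a. nilpotent x \<Longrightarrow> nilpotent y \<Longrightarrow> x * y = y * x"
begin

lemma nilpotent_add: "nilpotent (x :: 'a) \<Longrightarrow> nilpotent y \<Longrightarrow> nilpotent (x + y)"
  by (rule nilpotent_add_commuting) (simp_all add: comm)

lemma nilpotent_mult: "nilpotent (x :: 'a) \<Longrightarrow> nilpotent y \<Longrightarrow> nilpotent (x * y)"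
  by (rule nilpotent_mult_commuting) (simp_all add: comm)

lemma nilpotent_sum: "(\<And>i. i \<in> S \<Longrightarrow> nilpotent (F i :: 'a)) \<Longrightarrow> nilpotent (sum F S)"
  by (induction S rule: infinite_finite_induct) (simp_all add: nilpotent_add)

text \<open>
  With \<open>B\<close> the dilation of \<open>b\<close>, write \<open>B c - 1 = (B - 1) (c - 1) + (B - 1) + (c - 1)\<close>; the coefficients
  on the right-hand side are sums of products of nilpotent elements.
\<close>

lemma params_mult:
  assumes u: "params q e 0 b" and v: "params q h 0 c"
    and m: "mutually_commute (II_pair \<eta> e 0 b) (II_pair \<eta> h 0 c)"
  shows "params q (e * h) 0 (dilate h b * c)"
proof -
  note mc = mutually_commute_II_pairD[OF m]
  have h: "nilpotent (h - 1)" and e: "nilpotent (e - 1)" using u v by (simp_all add: params_def)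
  obtain M where M: "\<And>n N. n \<ge> N + M \<Longrightarrow> (shift h ^ n) $ N = 0"
    using shift_power_vanishes[OF h] by blast
  have dil: "x * dilate h b' $ n = dilate h b' $ n * x" if "\<And>n. x * b' $ n = b' $ n * x" "x * h = h * x" for x b' n
  proof -
    have "x * (b' $ i * (shift h ^ i) $ n) = b' $ i * (shift h ^ i) $ n * x" for i
      by (intro commutes_mult that(1) shift_commutes that(2))
    then show ?thesis
      by (simp add: dilate_nth[OF M order_refl] sum_distrib_left sum_distrib_right)
  qed
  have coeff: "x * (F * G) $ n = (F * G) $ n * x" if "\<And>n. x * F $ n = F $ n * x" "\<And>n. x * G $ n = G $ n * x" for x n and F G :: "'a fps"
    using commutes_mult[of "fps_const x" F G] that by (simp add: fps_const_commutes_iff)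
  have "e * (dilate h b * c) $ n = (dilate h b * c) $ n * e" for n
    by (rule coeff dil params_commute[OF u] mc)+
  moreover have "h * (dilate h b * c) $ n = (dilate h b * c) $ n * h" for n
    by (rule coeff dil params_commute[OF v] mc[symmetric] refl)+
  ultimately have "e * h * (dilate h b * c) $ n = (dilate h b * c) $ n * (e * h)" for n
    using commutes_mult[of "(dilate h b * c) $ n" e h] by simp
  then have 1: "affine_t \<eta> (e * h) 0 * (dilate h b * c) = dilate h b * c * affine_t \<eta> (e * h) 0"
    by (rule params_commuteI)
  have "nilpotent ((e - 1) * h)"
    using mc(1) by (intro nilpotent_mult_commuting e) (simp add: algebra_simps)
  from nilpotent_add[OF this h] have 2: "nilpotent (e * h - 1)" by (simp add: algebra_simps)
  have bn: "nilpotent ((b - 1) $ n)" and cn: "nilpotent ((c - 1) $ n)" for n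
    using u v by (simp_all add: params_def)
  have b1: "h * (b - 1) $ n = (b - 1) $ n * h" for n
    using mc(3)[of n] by (simp add: algebra_simps)
  have dil_nth: "dilate h b' $ n = (\<Sum>i<n + M. b' $ i * (shift h ^ i) $ n)" for b' n
    by (rule dilate_nth[OF M order_refl])
  have dn: "nilpotent (dilate h (b - 1) $ n)" for n
    unfolding dil_nth
    by (intro nilpotent_sum nilpotent_mult_commuting bn shift_commutes b1[symmetric])
  have "(dilate h b * c - 1) = dilate h (b - 1) * (c - 1) + dilate h (b - 1) + (c - 1)"
    by (simp add: dilate_diff[OF M] algebra_simps)
  then have 3: "nilpotent ((dilate h b * c - 1) $ n)" for n
    by (simp only: fps_add_nth fps_mult_nth) (intro nilpotent_add nilpotent_sum nilpotent_mult dn cn)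
  show ?thesis
    using 1 2 3 unfolding params_def by simp
qed

lemma QGII_mult_closed:
  assumes "u \<in> QGII q \<eta>" "v \<in> QGII q \<eta>" "mutually_commute u v"
  shows "QGII_mult u v \<in> QGII q \<eta>"
proof -
  obtain e f b where u: "u = II_pair \<eta> e f b" "params q e f b" using assms(1) by (rule QGII_cases)
  obtain h k c where v: "v = II_pair \<eta> h k c" "params q h k c" using assms(2) by (rule QGII_cases)
  have fk: "f = 0" "k = 0" using params_f_zero u(2) v(2) by blast+
  have "nilpotent (h - 1)" using v(2) by (simp add: params_def)
  then show ?thesis
    using params_mult u v assms(3) by (simp add: fk QGII_mult_II_pair II_pair_in_QGII_iff)
qed

end

text \<open>
  With parameters \<open>(e, 0, b)\<close>, \<open>(h, 0, c)\<close>, \<open>(l, 0, d)\<close>, and \<open>S\<^sub>h\<close> for the dilation by \<open>h\<close>, this is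
  \<open>S\<^sub>l (S\<^sub>h(b) c) = S\<^sub>h\<^sub>l(b) S\<^sub>l(c)\<close>, for which \<open>l\<close> has to commute with \<open>h\<close> and with the coefficients of \<open>c\<close>.
\<close>

lemma QGII_mult_assoc:
  assumes "u \<in> QGII q \<eta>" "v \<in> QGII q \<eta>" "w \<in> QGII q \<eta>" and vw: "mutually_commute v w"
  shows "QGII_mult u (QGII_mult v w) = QGII_mult (QGII_mult u v) w"
proof -
  obtain e f b where u: "u = II_pair \<eta> e f b" "params q e f b" using assms(1) by (rule QGII_cases)
  obtain h k c where v: "v = II_pair \<eta> h k c" "params q h k c" using assms(2) by (rule QGII_cases)
  obtain l r d where w: "w = II_pair \<eta> l r d" "params q l r d" using assms(3) by (rule QGII_cases)
  have z: "f = 0" "k = 0" "r = 0" using params_f_zero u(2) v(2) w(2) by blast+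
  have h: "nilpotent (h - 1)" and l: "nilpotent (l - 1)" using v(2) w(2) by (simp_all add: params_def)
  note mc = mutually_commute_II_pairD[OF vw[unfolded v(1) w(1)]]
  have "nilpotent ((h - 1) * l)"
    using mc(1) by (intro nilpotent_mult_commuting h) (simp add: algebra_simps)
  then have "nilpotent ((h - 1) * l + (l - 1))"
  proof (rule nilpotent_add_commuting[OF _ l])
    have "(l - 1) * (h - 1) = (h - 1) * (l - 1)" "(l - 1) * l = l * (l - 1)"
      using mc(1) by (simp_all add: algebra_simps)
    then show "(h - 1) * l * (l - 1) = (l - 1) * ((h - 1) * l)"
      by (rule commutes_mult[symmetric])
  qed
  then have hl: "nilpotent (h * l - 1)" by (simp add: algebra_simps)
  obtain M where M: "\<And>n N. n \<ge> N + M \<Longrightarrow> (shift l ^ n) $ N = 0"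
    using shift_power_vanishes[OF l] by blast
  have "dilate l (dilate h b * c) = dilate l (dilate h b) * dilate l c"
    by (rule dilate_mult[OF M]) (use mc(3) in simp_all)
  also have "dilate l (dilate h b) = dilate (h * l) b"
    by (rule dilate_dilate[OF h l hl mc(1)])
  finally show ?thesis
    by (simp add: u(1) v(1) w(1) z QGII_mult_II_pair h l hl mult.assoc)
qed

lemma identity_in_QGII: "II_pair \<eta> 1 0 1 = (W1, W2)" "(W1, W2) \<in> QGII q \<eta>"
proof -
  show i: "II_pair \<eta> 1 0 1 = (W1, W2)"
    by (simp add: II_pair_def const_W_def)
  have "params q 1 0 1"
    by (simp add: params_def)
  then show "(W1, W2) \<in> QGII q \<eta>"
    by (simp flip: i add: II_pair_in_QGII_iff)
qed

lemma QGII_mult_identity: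
  assumes "v \<in> QGII q \<eta>"
  shows "QGII_mult (W1, W2) v = v"
proof -
  obtain h k c where v: "v = II_pair \<eta> h k c" "params q h k c" using assms by (rule QGII_cases)
  have "k = 0" by (rule params_f_zero[OF v(2)])
  moreover have "nilpotent (h - 1)" using v(2) by (simp add: params_def)
  ultimately show ?thesis
    by (simp flip: identity_in_QGII(1) add: v(1) QGII_mult_II_pair)
qed

lemma QGII_act_identity:
  assumes "\<phi> \<in> NCFA"
  shows "QGII_act q lq \<alpha> \<eta> (W1, W2) \<phi> = \<phi>"
  unfolding QGII_act_def QGII_mult_identity[OF to_QGII_in[OF assms]]
  by (rule the_inv_into_f_f[OF inj_to_QGII assms])

context
  assumes surj: "QG2 q \<eta> \<subseteq> to_QG2 q lq \<alpha> \<eta> ` NCFA"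
begin

lemma QGII_act:
  assumes "u \<in> QGII q \<eta>" "\<phi> \<in> NCFA" "mutually_commute u (toII \<phi>)"
  shows "QGII_act q lq \<alpha> \<eta> u \<phi> \<in> NCFA"
    and "toII (QGII_act q lq \<alpha> \<eta> u \<phi>) = QGII_mult u (toII \<phi>)"
proof -
  have "QGII_mult u (toII \<phi>) \<in> QGII q \<eta>"
    by (rule QGII_mult_closed[OF nilpotents_commute[OF surj] assms(1) to_QGII_in[OF assms(2)] assms(3)])
  then have im: "QGII_mult u (toII \<phi>) \<in> toII ` NCFA"
    using bij_to_QGII[OF surj] by (simp add: bij_betw_def)
  show "QGII_act q lq \<alpha> \<eta> u \<phi> \<in> NCFA"
    unfolding QGII_act_def by (rule the_inv_into_into[OF inj_to_QGII im order_refl])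
  show "toII (QGII_act q lq \<alpha> \<eta> u \<phi>) = QGII_mult u (toII \<phi>)"
    unfolding QGII_act_def by (rule f_the_inv_into_f[OF inj_to_QGII im])
qed

lemma QGII_act_act:
  assumes "u \<in> QGII q \<eta>" "u' \<in> QGII q \<eta>" "\<phi> \<in> NCFA" "mutually_commute u' (toII \<phi>)"
  shows "QGII_act q lq \<alpha> \<eta> u (QGII_act q lq \<alpha> \<eta> u' \<phi>) = QGII_act q lq \<alpha> \<eta> (QGII_mult u u') \<phi>"
proof -
  have "QGII_mult u (toII (QGII_act q lq \<alpha> \<eta> u' \<phi>)) = QGII_mult (QGII_mult u u') (toII \<phi>)"
    unfolding QGII_act(2)[OF assms(2-4)] by (rule QGII_mult_assoc[OF assms(1,2) to_QGII_in[OF assms(3)] assms(4)])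
  then show ?thesis
    by (simp only: QGII_act_def[of q lq \<alpha> \<eta> u] QGII_act_def[of q lq \<alpha> \<eta> "QGII_mult u u'"])
qed

end

end

section \<open>Functoriality\<close>

locale galois_functor_map = A: galois_functor q lq \<alpha> \<eta> + B: galois_functor q lq \<alpha> \<eta>'
  for q lq \<alpha> :: complex and \<eta> :: "ratfun \<Rightarrow> 'a::{ring, monoid_mult}"
    and \<eta>' :: "ratfun \<Rightarrow> 'b::{ring, monoid_mult}" +
  fixes g :: "'a \<Rightarrow> 'b"
  assumes g: "nc_algebra_hom \<eta> \<eta>' g"
begin

lemma hom_g: "is_ring_hom g" and g_eta [simp]: "g (\<eta> a) = \<eta>' a"
  using g by (auto simp: nc_algebra_hom_def is_ring_hom_def)

lemmas g_hom = is_ring_homD[OF hom_g]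
lemmas W_hom = is_ring_homD[OF is_ring_hom_map_W[OF hom_g]]
lemmas fps_hom = is_ring_homD[OF is_ring_hom_fps_map[OF hom_g]]
lemmas tps_hom = is_ring_homD[OF is_ring_hom_tps_map[OF is_ring_hom_map_W[OF hom_g]]]

lemma map_W_scalar [simp]: "map_W g (scalar_W \<eta> c) = scalar_W \<eta>' c"
  by (rule fps2_eqI) (simp add: scalar_W_def g_hom)

lemma map_W_fps_const [simp]: "map_W g (fps_const x) = fps_const (fps_map g x)"
  by (rule fps2_eqI) (simp add: g_hom)

lemma map_W_D: "map_W g (D_W1 F) = D_W1 (map_W g F)" "map_W g (D_W2 F) = D_W2 (map_W g F)"
  by (rule fps2_eqI, simp add: D_W1_nth D_W2_nth g_hom)+

lemma map_canonical: "tps_map (map_W g) (canonical \<eta> x) = canonical \<eta>' x"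
  by (rule tps_eqI, rule fps2_eqI) (simp add: canonical_def)

lemma NCF_map_apply: "x \<in> A.GH \<Longrightarrow> NCF_map q lq \<alpha> g \<phi> x = tps_map (map_W g) (\<phi> x)"
  by (simp add: NCF_map_def)

lemma NCF_map_in:
  assumes "\<phi> \<in> A.NCFA"
  shows "NCF_map q lq \<alpha> g \<phi> \<in> B.NCFA"
proof -
  interpret deformation q lq \<alpha> \<eta> \<phi> using assms by (rule A.deformationI)
  have scalar: "tps_map (map_W g) (tps_const (scalar_W \<eta> c) * F) = tps_const (scalar_W \<eta>' c) * tps_map (map_W g) F" for c F
    by (rule tps_eqI) (simp add: W_hom)
  have Sigma: "tps_map (map_W g) (tps_Sigma q (scalar_W \<eta>) F) = tps_Sigma q (scalar_W \<eta>') (tps_map (map_W g) F)" for F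
    by (rule tps_eqI) (simp add: tps_Sigma_def W_hom)
  have Theta: "tps_map (map_W g) (tps_Theta q (scalar_W \<eta>) l F) = tps_Theta q (scalar_W \<eta>') l (tps_map (map_W g) F)" for l F
    by (rule tps_eqI) (simp add: tps_Theta_def W_hom)
  have D: "tps_map (map_W g) (tps_map D_W1 F) = tps_map D_W1 (tps_map (map_W g) F)"
    "tps_map (map_W g) (tps_map D_W2 F) = tps_map D_W2 (tps_map (map_W g) F)" for F
    by (rule tps_eqI, simp add: map_W_D)+
  have nil: "\<forall>c \<in> fps2_coeffs (tps_nth (NCF_map q lq \<alpha> g \<phi> x - canonical \<eta>' x) i n). nilpotent c"
    if x: "x \<in> A.GH" for x i n
  proof -
    have "nilpotent (g ((tps_nth (\<phi> x) i n - map_W \<eta> (taylor (tps_nth x i n))) $ m $ k))" for m k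
      by (rule nilpotent_hom[OF hom_g phi_nilpotent[OF x]])
    then show ?thesis
      by (auto simp: fps2_coeffs_def NCF_map_apply[OF x] canonical_def g_hom)
  qed
  show ?thesis
    unfolding NCF_def
  proof (intro CollectI conjI ballI allI)
    show "NCF_map q lq \<alpha> g \<phi> \<in> extensional A.GH"
      by (simp add: NCF_map_def)
    show "NCF_map q lq \<alpha> g \<phi> (tps_const (Cst c) * x) = tps_const (scalar_W \<eta>' c) * NCF_map q lq \<alpha> g \<phi> x"
      if "x \<in> A.GH" for c x
      using that by (simp only: NCF_map_apply galois_hull.mult galois_hull.const phi_scalar scalar)
  qed (simp_all add: NCF_map_apply galois_hull.intros A.hull_1 phi_1 phi_add phi_mult phi_scalar phi_Sigma phi_Theta
      phi_D_t phi_D_y phi_const tps_hom scalar Sigma Theta D map_canonical nil)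
qed

lemma fps_map_affine: "fps_map g (affine_t \<eta> e f) = affine_t \<eta>' (g e) (g f)"
  by (rule fps_ext) (simp add: A.affine_t_nth B.affine_t_nth g_hom)

lemma NCF_data_map:
  assumes "\<phi> \<in> A.NCFA" "NCF_data q lq \<alpha> \<eta> \<phi> e f b"
  shows "NCF_data q lq \<alpha> \<eta>' (NCF_map q lq \<alpha> g \<phi>) (g e) (g f) (fps_map g b)"
proof -
  interpret deformation q lq \<alpha> \<eta> \<phi> using assms(1) by (rule A.deformationI)
  note ef = NCF_data_unique[OF assms(2)]
  obtain w where w: "affine_t \<eta> e f * w = 1" "w * affine_t \<eta> e f = 1" "two_sided_inverse (affine_t \<eta> e f) = w"
    unfolding ef by (rule aff_inverse)
  have w': "two_sided_inverse (affine_t \<eta>' (g e) (g f)) = fps_map g w"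
    using w(1,2) by (intro two_sided_inverse_eq) (simp_all add: fps_hom(3) flip: fps_map_affine fps_hom(2))
  have "NCF_map q lq \<alpha> g \<phi> (iota0 q lq \<alpha> t_var) =
      tps_const (fps_const (affine_t \<eta>' (g e) (g f))) * tps_Q lq (scalar_W \<eta>') 1 + tps_X"
    using assms(2) unfolding NCF_data_def NCF_map_apply[OF galois_hull.iota0]
    by (intro tps_eqI) (simp add: W_hom tps_Q_def tps_X_def fps_map_affine)
  moreover have "NCF_map q lq \<alpha> g \<phi> (Y0 q lq \<alpha>) = Tps (\<lambda>i n. scalar_W \<eta>' (qbinom q lq \<alpha> i)
      * fps_const (two_sided_inverse (affine_t \<eta>' (g e) (g f)) ^ i)
      * scalar_W \<eta>' (qpow lq (of_int n * (\<alpha> - of_nat i))) * fps_const (fps_map g b))"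
    using assms(2) unfolding NCF_data_def NCF_map_apply[OF A.hull_Y0] w' w(3)
    by (intro tps_eqI) (simp add: W_hom(2) fps_hom(6))
  ultimately show ?thesis unfolding NCF_data_def ..
qed

lemma QGII_map_II_pair: "QGII_map g (II_pair \<eta> e f b) = II_pair \<eta>' (g e) (g f) (fps_map g b)"
  by (intro prod_eqI fps2_eqI)
     (simp_all add: QGII_map_def A.II_pair_nth B.II_pair_nth g_hom if_distrib[of g])

lemma params_map:
  assumes "A.params q e f b"
  shows "B.params q (g e) (g f) (fps_map g b)"
proof -
  have *: "e * f = \<eta> (Cst q) * f * e" "affine_t \<eta> e f * b = b * affine_t \<eta> e f"
    "nilpotent (e - 1)" "nilpotent f" "\<And>k. nilpotent ((b - 1) $ k)"
    using assms unfolding A.params_def by blast+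
  have "g e * g f = \<eta>' (Cst q) * g f * g e"
    using arg_cong[OF *(1), of g] by (simp add: g_hom(2))
  moreover have "affine_t \<eta>' (g e) (g f) * fps_map g b = fps_map g b * affine_t \<eta>' (g e) (g f)"
    using arg_cong[OF *(2), of "fps_map g"] by (simp add: fps_hom(2) fps_map_affine)
  moreover have "nilpotent (g e - 1)"
    using nilpotent_hom[OF hom_g *(3)] by (simp add: g_hom(3,5))
  moreover have "nilpotent (g f)"
    by (rule nilpotent_hom[OF hom_g *(4)])
  moreover have "nilpotent ((fps_map g b - 1) $ k)" for k
  proof -
    have "(fps_map g b - 1) $ k = g ((b - 1) $ k)"
      by (simp only: fps_map_nth[of g, symmetric] fps_hom(3,5))
    then show ?thesis using nilpotent_hom[OF hom_g *(5)] by simp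
  qed
  ultimately show ?thesis unfolding B.params_def by blast
qed

lemma QGII_map_in: "u \<in> QGII q \<eta> \<Longrightarrow> QGII_map g u \<in> QGII q \<eta>'"
  by (erule A.QGII_cases) (simp add: QGII_map_II_pair B.II_pair_in_QGII_iff params_map)

lemma to_QGII_natural:
  assumes "\<phi> \<in> A.NCFA"
  shows "B.toII (NCF_map q lq \<alpha> g \<phi>) = QGII_map g (A.toII \<phi>)"
proof -
  obtain e f b where d: "NCF_data q lq \<alpha> \<eta> \<phi> e f b" using A.NCF_parameters[OF assms] by blast
  show ?thesis
    using A.to_QGII_eq[OF assms d] B.to_QGII_eq[OF NCF_map_in[OF assms] NCF_data_map[OF assms d]]
    by (simp add: QGII_map_II_pair)
qed

lemma dilate_map:
  assumes "nilpotent (h - 1)"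
  shows "fps_map g (A.dilate h b) = B.dilate (g h) (fps_map g b)"
proof (rule fps_ext)
  fix N
  obtain M where M: "\<And>n N. n \<ge> N + M \<Longrightarrow> (A.shift h ^ n) $ N = 0"
    using A.shift_power_vanishes[OF assms] by blast
  have eq: "fps_map g (A.shift h) = B.shift (g h)"
    by (rule fps_ext) (simp add: A.shift_nth B.shift_nth g_hom)
  have shift: "g ((A.shift h ^ n) $ N) = (B.shift (g h) ^ n) $ N" for n N
    by (simp only: fps_map_nth[of g, symmetric] fps_hom(6) eq)
  have M': "(B.shift (g h) ^ n) $ N = 0" if "n \<ge> N + M" for n N
    by (simp only: shift[symmetric] M[OF that] g_hom(4))
  show "fps_map g (A.dilate h b) $ N = B.dilate (g h) (fps_map g b) $ N"
  proof -
    have "A.dilate h b $ N = (\<Sum>i<N + M. b $ i * (A.shift h ^ i) $ N)"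
      by (rule A.dilate_nth[OF M order_refl])
    moreover have "B.dilate (g h) (fps_map g b) $ N = (\<Sum>i<N + M. fps_map g b $ i * (B.shift (g h) ^ i) $ N)"
      by (rule B.dilate_nth[OF M' order_refl])
    ultimately show ?thesis by (simp add: g_hom(2,7) shift)
  qed
qed

lemma QGII_map_mult:
  assumes "u \<in> QGII q \<eta>" "v \<in> QGII q \<eta>"
  shows "QGII_map g (QGII_mult u v) = QGII_mult (QGII_map g u) (QGII_map g v)"
proof -
  obtain e f b where u: "u = II_pair \<eta> e f b" using assms(1) by (rule A.QGII_cases)
  obtain h k c where v: "v = II_pair \<eta> h k c" "A.params q h k c" using assms(2) by (rule A.QGII_cases)
  have k: "k = 0" using A.params_f_zero v(2) by blast
  have h: "nilpotent (h - 1)" using v(2) by (simp add: A.params_def)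
  from nilpotent_hom[OF hom_g this] have gh: "nilpotent (g h - 1)" by (simp add: g_hom)
  show ?thesis
    by (simp add: u v(1) k QGII_map_II_pair A.QGII_mult_II_pair[OF h] B.QGII_mult_II_pair[OF gh] g_hom fps_hom(2) dilate_map[OF h])
qed

text \<open>
  Both sides are deformations over the target with the same point of \<open>QG\<^sub>I\<^sub>I\<close>. The left-hand side is one
  because the action over the source yields a deformation, so injectivity over the target suffices.
\<close>

lemma QGII_act_natural:
  assumes surj: "QG2 q \<eta> \<subseteq> to_QG2 q lq \<alpha> \<eta> ` A.NCFA"
    and u: "u \<in> QGII q \<eta>" and phi: "\<phi> \<in> A.NCFA" and m: "mutually_commute u (A.toII \<phi>)"
  shows "NCF_map q lq \<alpha> g (QGII_act q lq \<alpha> \<eta> u \<phi>) = QGII_act q lq \<alpha> \<eta>' (QGII_map g u) (NCF_map q lq \<alpha> g \<phi>)"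
proof -
  let ?\<psi> = "NCF_map q lq \<alpha> g (QGII_act q lq \<alpha> \<eta> u \<phi>)"
  note act = A.QGII_act[OF surj u phi m]
  have "QGII_mult (QGII_map g u) (B.toII (NCF_map q lq \<alpha> g \<phi>)) = B.toII ?\<psi>"
    unfolding to_QGII_natural[OF phi] to_QGII_natural[OF act(1)] act(2)
    by (rule QGII_map_mult[OF u A.to_QGII_in[OF phi], symmetric])
  moreover have "the_inv_into B.NCFA B.toII (B.toII ?\<psi>) = ?\<psi>"
    by (rule the_inv_into_f_f[OF B.inj_to_QGII NCF_map_in[OF act(1)]])
  ultimately show ?thesis
    by (simp only: QGII_act_def[of q lq \<alpha> \<eta>' "QGII_map g u"])
qed

end

section \<open>The quantum formal Galois group\<close>

theorem theorem5p22:
  fixes q lq \<alpha> :: complex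
    and \<eta> :: "ratfun \<Rightarrow> 'a::{ring, monoid_mult}"
    and \<eta>' :: "ratfun \<Rightarrow> 'b::{ring, monoid_mult}"
    and g :: "'a \<Rightarrow> 'b"
  assumes q_nonzero: "q \<noteq> 0"
    and log_q: "exp lq = q"
    and not_root_of_unity: "\<forall>n::nat. n > 0 \<longrightarrow> q ^ n \<noteq> 1"
    and irrational: "\<alpha> \<notin> \<rat>"
    and A: "nc_algebra \<eta>"
    and B: "nc_algebra \<eta>'"
    and hom: "nc_algebra_hom \<eta> \<eta>' g"
  shows
    \<comment> \<open>the inclusion at \<open>A\<close>\<close>
    "(\<forall>\<phi> \<in> NCF q lq \<alpha> \<eta>. \<exists>!(e, f, b). NCF_data q lq \<alpha> \<eta> \<phi> e f b) \<and>
     to_QGII q lq \<alpha> \<eta> \<in> NCF q lq \<alpha> \<eta> \<rightarrow> QGII q \<eta> \<and>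
     inj_on (to_QGII q lq \<alpha> \<eta>) (NCF q lq \<alpha> \<eta>) \<and>
     \<comment> \<open>its functoriality\<close>
     NCF_map q lq \<alpha> g \<in> NCF q lq \<alpha> \<eta> \<rightarrow> NCF q lq \<alpha> \<eta>' \<and>
     QGII_map g \<in> QGII q \<eta> \<rightarrow> QGII q \<eta>' \<and>
     (\<forall>\<phi> \<in> NCF q lq \<alpha> \<eta>.
        to_QGII q lq \<alpha> \<eta>' (NCF_map q lq \<alpha> g \<phi>) = QGII_map g (to_QGII q lq \<alpha> \<eta> \<phi>)) \<and>
     \<comment> \<open>the product, i.e. the composite transformation, in terms of the parameters\<close>
     (\<forall>e f b h k c. II_pair \<eta> e f b \<in> QGII q \<eta> \<longrightarrow> II_pair \<eta> h k c \<in> QGII q \<eta> \<longrightarrow>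
        mutually_commute (II_pair \<eta> e f b) (II_pair \<eta> h k c) \<longrightarrow>
        (\<exists>\<beta>. fps_const \<beta> = subst_W (fps_const b) (II_pair \<eta> h k c) * fps_const c \<and>
             QGII_mult (II_pair \<eta> e f b) (II_pair \<eta> h k c) = II_pair \<eta> (e * h) (e * k + f) \<beta>)) \<and>
     \<comment> \<open>if \<open>NCF(A) \<rightarrow> QG2(A)\<close> is bijective\<close>
     (bij_betw (to_QG2 q lq \<alpha> \<eta>) (NCF q lq \<alpha> \<eta>) (QG2 q \<eta>) \<longrightarrow>
        bij_betw (to_QGII q lq \<alpha> \<eta>) (NCF q lq \<alpha> \<eta>) (QGII q \<eta>) \<and>
        (\<forall>u \<in> QGII q \<eta>. \<forall>\<phi> \<in> NCF q lq \<alpha> \<eta>. mutually_commute u (to_QGII q lq \<alpha> \<eta> \<phi>) \<longrightarrow>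
           QGII_act q lq \<alpha> \<eta> u \<phi> \<in> NCF q lq \<alpha> \<eta> \<and>
           to_QGII q lq \<alpha> \<eta> (QGII_act q lq \<alpha> \<eta> u \<phi>) = QGII_mult u (to_QGII q lq \<alpha> \<eta> \<phi>)) \<and>
        (W1, W2) \<in> QGII q \<eta> \<and>
        (\<forall>\<phi> \<in> NCF q lq \<alpha> \<eta>. QGII_act q lq \<alpha> \<eta> (W1, W2) \<phi> = \<phi>) \<and>
        (\<forall>u \<in> QGII q \<eta>. \<forall>u' \<in> QGII q \<eta>. \<forall>\<phi> \<in> NCF q lq \<alpha> \<eta>.
           mutually_commute u u' \<longrightarrow> mutually_commute u (to_QGII q lq \<alpha> \<eta> \<phi>) \<longrightarrow>
           mutually_commute u' (to_QGII q lq \<alpha> \<eta> \<phi>) \<longrightarrow>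
           QGII_mult u u' \<in> QGII q \<eta> \<and>
           QGII_act q lq \<alpha> \<eta> u (QGII_act q lq \<alpha> \<eta> u' \<phi>) = QGII_act q lq \<alpha> \<eta> (QGII_mult u u') \<phi>) \<and>
        (bij_betw (to_QG2 q lq \<alpha> \<eta>') (NCF q lq \<alpha> \<eta>') (QG2 q \<eta>') \<longrightarrow>
           (\<forall>u \<in> QGII q \<eta>. \<forall>\<phi> \<in> NCF q lq \<alpha> \<eta>. mutually_commute u (to_QGII q lq \<alpha> \<eta> \<phi>) \<longrightarrow>
              NCF_map q lq \<alpha> g (QGII_act q lq \<alpha> \<eta> u \<phi>) =
              QGII_act q lq \<alpha> \<eta>' (QGII_map g u) (NCF_map q lq \<alpha> g \<phi>))))"
proof -
  interpret galois_functor_map q lq \<alpha> \<eta> \<eta>' g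
    by unfold_locales (use log_q not_root_of_unity A B hom in blast)+
  have unique: "\<exists>!(e, f, b). NCF_data q lq \<alpha> \<eta> \<phi> e f b" if phi: "\<phi> \<in> A.NCFA" for \<phi>
  proof -
    obtain e f b where d: "NCF_data q lq \<alpha> \<eta> \<phi> e f b"
      using A.NCF_parameters[OF phi] by blast
    show ?thesis
    proof (rule ex1I[of _ "(e, f, b)"])
      fix p assume p: "case p of (e, f, b) \<Rightarrow> NCF_data q lq \<alpha> \<eta> \<phi> e f b"
      obtain h k c where "p = (h, k, c)" by (cases p)
      with p A.NCF_parameters_unique[OF phi d, of h k c] show "p = (e, f, b)" by simp
    qed (use d in simp)
  qed
  have product: "\<exists>\<beta>. fps_const \<beta> = subst_W (fps_const b) (II_pair \<eta> h k c) * fps_const c \<and>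
      QGII_mult (II_pair \<eta> e f b) (II_pair \<eta> h k c) = II_pair \<eta> (e * h) (e * k + f) \<beta>"
    if "II_pair \<eta> h k c \<in> QGII q \<eta>" for e f b h k c
  proof -
    have p: "A.params q h k c" using that by (simp add: A.II_pair_in_QGII_iff)
    have "k = 0" by (rule A.params_f_zero[OF p])
    moreover have "nilpotent (h - 1)" using p by (simp add: A.params_def)
    ultimately show ?thesis
      by (intro exI[of _ "A.dilate h b * c"]) (simp add: A.QGII_mult_II_pair A.subst_W_const_dilate)
  qed
  show ?thesis
  proof (intro conjI)
    show "\<forall>\<phi> \<in> A.NCFA. \<exists>!(e, f, b). NCF_data q lq \<alpha> \<eta> \<phi> e f b"
      using unique by blast
    show "A.toII \<in> A.NCFA \<rightarrow> QGII q \<eta>" using A.to_QGII_in by blast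
    show "inj_on A.toII A.NCFA" by (rule A.inj_to_QGII)
    show "NCF_map q lq \<alpha> g \<in> A.NCFA \<rightarrow> B.NCFA" using NCF_map_in by blast
    show "QGII_map g \<in> QGII q \<eta> \<rightarrow> QGII q \<eta>'" using QGII_map_in by blast
    show "\<forall>\<phi> \<in> A.NCFA. B.toII (NCF_map q lq \<alpha> g \<phi>) = QGII_map g (A.toII \<phi>)"
      using to_QGII_natural by blast
    show "\<forall>e f b h k c. II_pair \<eta> e f b \<in> QGII q \<eta> \<longrightarrow> II_pair \<eta> h k c \<in> QGII q \<eta> \<longrightarrow>
        mutually_commute (II_pair \<eta> e f b) (II_pair \<eta> h k c) \<longrightarrow>
        (\<exists>\<beta>. fps_const \<beta> = subst_W (fps_const b) (II_pair \<eta> h k c) * fps_const c \<and>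
             QGII_mult (II_pair \<eta> e f b) (II_pair \<eta> h k c) = II_pair \<eta> (e * h) (e * k + f) \<beta>)"
      using product by simp
  next
    show "bij_betw (to_QG2 q lq \<alpha> \<eta>) A.NCFA (QG2 q \<eta>) \<longrightarrow>
        bij_betw A.toII A.NCFA (QGII q \<eta>) \<and>
        (\<forall>u \<in> QGII q \<eta>. \<forall>\<phi> \<in> A.NCFA. mutually_commute u (A.toII \<phi>) \<longrightarrow>
           QGII_act q lq \<alpha> \<eta> u \<phi> \<in> A.NCFA \<and>
           A.toII (QGII_act q lq \<alpha> \<eta> u \<phi>) = QGII_mult u (A.toII \<phi>)) \<and>
        (W1, W2) \<in> QGII q \<eta> \<and>
        (\<forall>\<phi> \<in> A.NCFA. QGII_act q lq \<alpha> \<eta> (W1, W2) \<phi> = \<phi>) \<and>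
        (\<forall>u \<in> QGII q \<eta>. \<forall>u' \<in> QGII q \<eta>. \<forall>\<phi> \<in> A.NCFA.
           mutually_commute u u' \<longrightarrow> mutually_commute u (A.toII \<phi>) \<longrightarrow>
           mutually_commute u' (A.toII \<phi>) \<longrightarrow>
           QGII_mult u u' \<in> QGII q \<eta> \<and>
           QGII_act q lq \<alpha> \<eta> u (QGII_act q lq \<alpha> \<eta> u' \<phi>) = QGII_act q lq \<alpha> \<eta> (QGII_mult u u') \<phi>) \<and>
        (bij_betw (to_QG2 q lq \<alpha> \<eta>') B.NCFA (QG2 q \<eta>') \<longrightarrow>
           (\<forall>u \<in> QGII q \<eta>. \<forall>\<phi> \<in> A.NCFA. mutually_commute u (A.toII \<phi>) \<longrightarrow>
              NCF_map q lq \<alpha> g (QGII_act q lq \<alpha> \<eta> u \<phi>) =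
              QGII_act q lq \<alpha> \<eta>' (QGII_map g u) (NCF_map q lq \<alpha> g \<phi>)))"
    proof
      assume "bij_betw (to_QG2 q lq \<alpha> \<eta>) A.NCFA (QG2 q \<eta>)"
      then have surj: "QG2 q \<eta> \<subseteq> to_QG2 q lq \<alpha> \<eta> ` A.NCFA" by (simp add: bij_betw_def)
      show "bij_betw A.toII A.NCFA (QGII q \<eta>) \<and>
        (\<forall>u \<in> QGII q \<eta>. \<forall>\<phi> \<in> A.NCFA. mutually_commute u (A.toII \<phi>) \<longrightarrow>
           QGII_act q lq \<alpha> \<eta> u \<phi> \<in> A.NCFA \<and>
           A.toII (QGII_act q lq \<alpha> \<eta> u \<phi>) = QGII_mult u (A.toII \<phi>)) \<and>
        (W1, W2) \<in> QGII q \<eta> \<and>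
        (\<forall>\<phi> \<in> A.NCFA. QGII_act q lq \<alpha> \<eta> (W1, W2) \<phi> = \<phi>) \<and>
        (\<forall>u \<in> QGII q \<eta>. \<forall>u' \<in> QGII q \<eta>. \<forall>\<phi> \<in> A.NCFA.
           mutually_commute u u' \<longrightarrow> mutually_commute u (A.toII \<phi>) \<longrightarrow>
           mutually_commute u' (A.toII \<phi>) \<longrightarrow>
           QGII_mult u u' \<in> QGII q \<eta> \<and>
           QGII_act q lq \<alpha> \<eta> u (QGII_act q lq \<alpha> \<eta> u' \<phi>) = QGII_act q lq \<alpha> \<eta> (QGII_mult u u') \<phi>) \<and>
        (bij_betw (to_QG2 q lq \<alpha> \<eta>') B.NCFA (QG2 q \<eta>') \<longrightarrow>
           (\<forall>u \<in> QGII q \<eta>. \<forall>\<phi> \<in> A.NCFA. mutually_commute u (A.toII \<phi>) \<longrightarrow>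
              NCF_map q lq \<alpha> g (QGII_act q lq \<alpha> \<eta> u \<phi>) =
              QGII_act q lq \<alpha> \<eta>' (QGII_map g u) (NCF_map q lq \<alpha> g \<phi>)))"
      proof (intro conjI ballI impI)
        show "bij_betw A.toII A.NCFA (QGII q \<eta>)" by (rule A.bij_to_QGII[OF surj])
      next
        fix u \<phi> assume "u \<in> QGII q \<eta>" "\<phi> \<in> A.NCFA" "mutually_commute u (A.toII \<phi>)"
        note act = A.QGII_act[OF surj this]
        show "QGII_act q lq \<alpha> \<eta> u \<phi> \<in> A.NCFA"
          and "A.toII (QGII_act q lq \<alpha> \<eta> u \<phi>) = QGII_mult u (A.toII \<phi>)"
          by (rule act)+
      next
        show "(W1, W2) \<in> QGII q \<eta>" by (rule A.identity_in_QGII(2))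
      next
        show "QGII_act q lq \<alpha> \<eta> (W1, W2) \<phi> = \<phi>" if "\<phi> \<in> A.NCFA" for \<phi>
          by (rule A.QGII_act_identity[OF that])
      next
        fix u u' \<phi>
        assume *: "u \<in> QGII q \<eta>" "u' \<in> QGII q \<eta>" "\<phi> \<in> A.NCFA" "mutually_commute u u'"
          "mutually_commute u' (A.toII \<phi>)"
        show "QGII_mult u u' \<in> QGII q \<eta>"
          by (rule A.QGII_mult_closed[OF A.nilpotents_commute[OF surj] *(1,2,4)])
        show "QGII_act q lq \<alpha> \<eta> u (QGII_act q lq \<alpha> \<eta> u' \<phi>) = QGII_act q lq \<alpha> \<eta> (QGII_mult u u') \<phi>"
          by (rule A.QGII_act_act[OF surj *(1,2,3,5)])
      next
        fix u \<phi> assume "u \<in> QGII q \<eta>" "\<phi> \<in> A.NCFA" "mutually_commute u (A.toII \<phi>)"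
        then show "NCF_map q lq \<alpha> g (QGII_act q lq \<alpha> \<eta> u \<phi>) =
            QGII_act q lq \<alpha> \<eta>' (QGII_map g u) (NCF_map q lq \<alpha> g \<phi>)"
          by (rule QGII_act_natural[OF surj])
      qed
    qed
  qed
qed
end
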